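(* Let $d\ge 2$. There exists a solution for each of the following optimization problems: $$\min\{F_q(\Omega)\ :\ \Omega\in\mathcal{A}_{convex}\}\qquad\text{for every }0<q<1/2,$$ $$\max\{F_q(\Omega)\ :\ \Omega\in\mathcal{A}_{convex}\}\qquad\text{for every }q>1/2.$$ That is, for every $0<q<1/2$ there is $\Omega^*\in\mathcal{A}_{convex}$ with $F_q(\Omega^* )\le F_q(\Omega)$ for all $\Omega\in\mathcal{A}_{convex}$, and for every $q>1/2$ there is $\Omega^*\in\mathcal{A}_{convex}$ with $F_q(\Omega^* )\ge F_q(\Omega)$ for all $\Omega\in\mathcal{A}_{convex}$.
   Context: $\mathcal{A}_{convex}$ is the class of all nonempty open convex sets $\Omega\subset\mathbb{R}^d$ with finite Lebesgue measure $|\Omega|$. For such $\Omega$: - $P(\Omega)=\sup\{\int_\Omega \mathrm{div}\,\phi\,dx : \phi\in C^1_c(\mathbb{R}^d;\mathbb{R}^d),\ \|\phi\|_{L^\infty(\mathbb{R}^d)}\le 1\}$ is the (De Giorgi) perimeter. - $T(\Omega)=\int_\Omega u\,dx$ is the torsional rigidity, where $u\in H^1_0(\Omega)$ is the unique (weak) solution of $-\Delta u=1$ in $\Omega$. Equivalently, $T(\Omega)=\max\{(\int_\Omega u\,dx)^2(\int_\Omega|\nabla u|^2dx)^{-1} : u\in H^1_0(\Omega)\setminus\{0\}\}$. - For $q>0$, $F_q(\Omega)=\dfrac{P(\Omega)\,T(\Omega)^q}{|\Omega|^{\alpha_q}}$ with $\alpha_q=1+q+\dfrac{2q-1}{d}$.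 *)

theory Defs
  imports "HOL-Analysis.Analysis"
begin

section \<open>Continuously differentiable functions on the whole space\<close>

primrec C_k :: "nat \<Rightarrow> ('a::euclidean_space \<Rightarrow> 'b::real_normed_vector) \<Rightarrow> bool" where
  "C_k 0 f \<longleftrightarrow> continuous_on UNIV f"
| "C_k (Suc k) f \<longleftrightarrow>
     (\<forall>x. f differentiable (at x)) \<and> (\<forall>v. C_k k (\<lambda>x. frechet_derivative f (at x) v))"

definition supp :: "('a::euclidean_space \<Rightarrow> 'b::real_normed_vector) \<Rightarrow> 'a set" where
  "supp f = closure {x. f x \<noteq> 0}"

definition divergence :: "('a::euclidean_space \<Rightarrow> 'a) \<Rightarrow> 'a \<Rightarrow> real" where
  "divergence \<phi> x = (\<Sum>i\<in>Basis. frechet_derivative \<phi> (at x) i \<bullet> i)"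

definition gradient :: "('a::euclidean_space \<Rightarrow> real) \<Rightarrow> 'a \<Rightarrow> 'a" where
  "gradient \<phi> x = (\<Sum>i\<in>Basis. frechet_derivative \<phi> (at x) i *\<^sub>R i)"


section \<open>De Giorgi perimeter\<close>

text \<open>The supremum is taken in the extended reals, so it is meaningful without any a priori bound.\<close>

definition perimeter :: "'a::euclidean_space set \<Rightarrow> ereal" where
  "perimeter \<Omega> =
     (SUP \<phi> \<in> {\<phi> :: 'a \<Rightarrow> 'a. C_k 1 \<phi> \<and> compact (supp \<phi>) \<and> (AE x in lebesgue. norm (\<phi> x) \<le> 1)}.
        ereal (integral\<^sup>L (lebesgue_on \<Omega>) (divergence \<phi>)))"


section \<open>The Sobolev space with zero boundary values, and torsional rigidity\<close>

text \<open>Elements of Lebesgue and Sobolev spaces are represented by functions on the whole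
  space. Their values outside \<open>\<Omega>\<close> and on null sets are irrelevant.\<close>

definition test_functions :: "'a::euclidean_space set \<Rightarrow> ('a \<Rightarrow> real) set" where
  "test_functions \<Omega> = {\<phi>. (\<forall>k. C_k k \<phi>) \<and> compact (supp \<phi>) \<and> supp \<phi> \<subseteq> \<Omega>}"

definition L2_on :: "'a::euclidean_space set \<Rightarrow> ('a \<Rightarrow> 'b::euclidean_space) set" where
  "L2_on \<Omega> = {f. f \<in> borel_measurable (lebesgue_on \<Omega>) \<and>
                  integrable (lebesgue_on \<Omega>) (\<lambda>x. (norm (f x))\<^sup>2)}"

text \<open>\<open>has_H1_gradient \<Omega> u g\<close> says that \<open>u\<close> belongs to the Sobolev space of square integrable
  functions with square integrable distributional gradient, and that this gradient is \<open>g\<close>.\<close>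

definition has_H1_gradient ::
    "'a::euclidean_space set \<Rightarrow> ('a \<Rightarrow> real) \<Rightarrow> ('a \<Rightarrow> 'a) \<Rightarrow> bool" where
  "has_H1_gradient \<Omega> u g \<longleftrightarrow> u \<in> L2_on \<Omega> \<and> g \<in> L2_on \<Omega> \<and>
     (\<forall>\<phi>\<in>test_functions \<Omega>. \<forall>i\<in>Basis.
        integral\<^sup>L (lebesgue_on \<Omega>) (\<lambda>x. u x * frechet_derivative \<phi> (at x) i) =
        - integral\<^sup>L (lebesgue_on \<Omega>) (\<lambda>x. (g x \<bullet> i) * \<phi> x))"

text \<open>Closure of the test functions in the Sobolev norm.\<close>

definition H10 :: "'a::euclidean_space set \<Rightarrow> ('a \<Rightarrow> real) set" where
  "H10 \<Omega> = {u. \<exists>g. has_H1_gradient \<Omega> u g \<and>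
     (\<exists>\<phi>. (\<forall>n::nat. \<phi> n \<in> test_functions \<Omega>) \<and>
        (\<lambda>n. integral\<^sup>L (lebesgue_on \<Omega>) (\<lambda>x. (\<phi> n x - u x)\<^sup>2) +
             integral\<^sup>L (lebesgue_on \<Omega>) (\<lambda>x. (norm (gradient (\<phi> n) x - g x))\<^sup>2))
        \<longlonglongrightarrow> 0)}"

text \<open>Weak solutions of \<open>-\<Delta>u = 1\<close> in \<open>\<Omega>\<close> with zero boundary values.\<close>

definition torsion_function :: "'a::euclidean_space set \<Rightarrow> ('a \<Rightarrow> real) \<Rightarrow> bool" where
  "torsion_function \<Omega> u \<longleftrightarrow> u \<in> H10 \<Omega> \<and>
     (\<exists>g. has_H1_gradient \<Omega> u g \<and>
        (\<forall>\<phi>\<in>test_functions \<Omega>.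
           integral\<^sup>L (lebesgue_on \<Omega>) (\<lambda>x. g x \<bullet> gradient \<phi> x) =
           integral\<^sup>L (lebesgue_on \<Omega>) \<phi>))"

text \<open>The weak solution is unique only up to null sets, hence the description of the value of
  its integral instead of the solution itself.\<close>

definition torsional_rigidity :: "'a::euclidean_space set \<Rightarrow> real" where
  "torsional_rigidity \<Omega> =
     (THE t. \<exists>u. torsion_function \<Omega> u \<and> t = integral\<^sup>L (lebesgue_on \<Omega>) u)"


section \<open>The shape functionals and the admissible class\<close>

definition A_convex :: "'a::euclidean_space set set" where
  "A_convex = {\<Omega>. \<Omega> \<noteq> {} \<and> open \<Omega> \<and> convex \<Omega> \<and> emeasure lebesgue \<Omega> < \<infinity>}"

definition F :: "real \<Rightarrow> 'a::euclidean_space set \<Rightarrow> ereal" where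
  "F q \<Omega> = perimeter \<Omega> * ereal (torsional_rigidity \<Omega> powr q) /
     ereal (measure lebesgue \<Omega> powr (1 + q + (2 * q - 1) / real DIM('a)))"

end

theory Submission
  imports Defs "HOL-Complex_Analysis.Great_Picard"
begin

text \<open>
  The ratio \<open>F q\<close> is invariant under similarities, and each of its three ingredients is monotone
  under inclusion of convex domains. If each of two domains lies in the dilate of the other by a
  factor \<open>l\<close> close to 1, their ratios therefore differ by a factor close to 1
  (\<open>shape_ratio_sandwich\<close>). Convex sets between two fixed balls admit limits in exactly this
  sense, because their Minkowski functionals are equi-Lipschitz (\<open>convex_sandwich_subsequence\<close>).
  An optimizing sequence hence converges to an optimal domain as soon as it can be
  normalized to contain the unit ball and to stay inside a fixed ball.

  The second bound comes from the exponent. A parallelepiped of maximal volume shows that, after a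
  similarity that makes the domain contain the unit ball and keeps its smallest width bounded,
  perimeter and rigidity are both comparable to the volume, with constants that depend on the
  dimension \<open>d\<close> only (\<open>normalized_domain\<close>). So \<open>F q\<close> is comparable to the volume raised to the
  power \<open>(1 - 2 q) / d\<close>. For \<open>q < 1/2\<close> a bounded ratio bounds the volume; for \<open>q > 1/2\<close> the
  exponent is negative, the ratio is bounded, and a ratio that stays away from 0 bounds the
  volume. A convex set that contains the unit ball and has bounded volume has bounded diameter
  (\<open>convex_norm_le_measure\<close>).

  The perimeter enters through its test fields only. Beyond the boundary of a half-space a test
  field can be replaced by the outer unit normal of the half-space, and the transition contributes
  nonnegative divergence. So cutting with half-spaces does not increase the perimeter. As an open
  convex set is a countable intersection of half-spaces up to a null set, monotonicity follows
  (\<open>perimeter_convex_mono\<close>). An upper bound for the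
  perimeter results from translating the domain, a lower bound from one explicit field.

  The rigidity is the supremum of the energy \<open>2 \<integral> \<phi> - \<integral> |\<nabla> \<phi>|\<^sup>2\<close> over test functions
  (\<open>torsional_rigidity_eq_SUP\<close>), which makes monotonicity and scaling immediate and reduces
  bounds to integration by parts and to one explicit bump function. This formula includes the
  existence of the weak solution, by the direct method: a maximizing sequence is Cauchy in the
  Sobolev norm.
\<close>


section \<open>Functions of class \<open>C\<^sup>k\<close>\<close>

lemma frechet_derivative_eqI:
  "(f has_derivative D) (at x) \<Longrightarrow> frechet_derivative f (at x) v = D v"
  using frechet_derivative_at[of f D x] by simp

lemma C_k_SucI:
  assumes "\<And>x. (f has_derivative D x) (at x)" "\<And>v. C_k k (\<lambda>x. D x v)"
  shows "C_k (Suc k) f"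
proof -
  have "frechet_derivative f (at x) = D x" for x
    using assms(1) frechet_derivative_at by metis
  then show ?thesis
    using assms by (auto simp: differentiable_def)
qed

lemma C_k_Suc_has_derivative:
  assumes "C_k (Suc k) f"
  shows "(f has_derivative frechet_derivative f (at x)) (at x)"
  using assms by (simp add: frechet_derivative_works[symmetric])

lemma C_k_Suc_derivative: "C_k (Suc k) f \<Longrightarrow> C_k k (\<lambda>x. frechet_derivative f (at x) v)"
  by simp

lemma C_k_Suc_imp_C_k: "C_k (Suc k) f \<Longrightarrow> C_k k f"
proof (induction k arbitrary: f)
  case 0
  then show ?case
    by (auto simp: continuous_on_eq_continuous_at differentiable_imp_continuous_within)
next
  case (Suc k)
  then show ?case
    by simp
qed

lemma C_k_mono: "C_k m f \<Longrightarrow> n \<le> m \<Longrightarrow> C_k n f"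
  by (induction m) (metis le_zero_eq, metis C_k_Suc_imp_C_k le_Suc_eq)

lemma C_k_imp_continuous: "C_k k f \<Longrightarrow> continuous_on UNIV f"
  using C_k_mono[of k f 0] by simp

lemma C_k_const [simp, intro]: "C_k k (\<lambda>x. c)"
proof (induction k arbitrary: c)
  case (Suc k)
  show ?case
    by (rule C_k_SucI[where D="\<lambda>x v. 0"]) (auto simp: Suc)
qed simp

lemma C_k_bounded_linear:
  assumes "bounded_linear h"
  shows "C_k k h"
proof (cases k)
  case 0
  then show ?thesis
    using assms by (simp add: linear_continuous_on)
next
  case (Suc m)
  show ?thesis
    unfolding Suc
    by (rule C_k_SucI[where D="\<lambda>x v. h v"])
      (auto simp: assms bounded_linear.has_derivative[OF assms] intro: bounded_linear_imp_has_derivative)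
qed

lemma C_k_add: "C_k k f \<Longrightarrow> C_k k g \<Longrightarrow> C_k k (\<lambda>x. f x + g x)"
proof (induction k arbitrary: f g)
  case (Suc k)
  show ?case
    by (rule C_k_SucI[OF has_derivative_add[OF C_k_Suc_has_derivative[OF Suc.prems(1)]
            C_k_Suc_has_derivative[OF Suc.prems(2)]]])
      (use Suc in auto)
qed (auto intro: continuous_on_add)

lemma C_k_sum: "finite I \<Longrightarrow> (\<And>i. i \<in> I \<Longrightarrow> C_k k (f i)) \<Longrightarrow> C_k k (\<lambda>x. \<Sum>i\<in>I. f i x)"
  by (induction I rule: finite_induct) (auto intro: C_k_add)

lemma C_k_bilinear:
  assumes "bounded_bilinear B"
  shows "C_k k f \<Longrightarrow> C_k k g \<Longrightarrow> C_k k (\<lambda>x. B (f x) (g x))"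
proof (induction k arbitrary: f g)
  case 0
  then show ?case
    using bounded_bilinear.continuous_on[OF assms] by auto
next
  case (Suc k)
  show ?case
    by (rule C_k_SucI[OF bounded_bilinear.FDERIV[OF assms
            C_k_Suc_has_derivative[OF Suc.prems(1)] C_k_Suc_has_derivative[OF Suc.prems(2)]]])
      (intro C_k_add Suc.IH C_k_Suc_derivative Suc.prems C_k_Suc_imp_C_k[OF Suc.prems(1)]
         C_k_Suc_imp_C_k[OF Suc.prems(2)])
qed

lemmas C_k_mult = C_k_bilinear[OF bounded_bilinear_mult]
lemmas C_k_scaleR = C_k_bilinear[OF bounded_bilinear_scaleR]
lemmas C_k_inner = C_k_bilinear[OF bounded_bilinear_inner]

lemma C_k_diff:
  assumes "C_k k f" "C_k k g" shows "C_k k (\<lambda>x. f x - g x)"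
  using C_k_add[OF assms(1) C_k_scaleR[OF C_k_const[of _ "-1::real"] assms(2)]] by simp

lemma C_k_affine:
  assumes "bounded_linear L"
  shows "C_k k f \<Longrightarrow> C_k k (\<lambda>x. f (a + L x))"
proof (induction k arbitrary: f)
  case 0
  have "continuous_on UNIV (\<lambda>x. a + L x)"
    using assms by (intro continuous_intros linear_continuous_on)
  with 0 show ?case
    using continuous_on_compose2[of UNIV f UNIV "\<lambda>x. a + L x"] by auto
next
  case (Suc k)
  have D: "((\<lambda>x. f (a + L x)) has_derivative (\<lambda>v. frechet_derivative f (at (a + L x)) (L v))) (at x)" for x
    by (rule has_derivative_compose[of "\<lambda>x. a + L x", OF _ C_k_Suc_has_derivative[OF Suc.prems]])
      (auto intro!: derivative_eq_intros bounded_linear_imp_has_derivative assms)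
  show ?case
    by (rule C_k_SucI[OF D]) (intro Suc.IH C_k_Suc_derivative Suc.prems)
qed

text \<open>One derivative suffices for the fields that test the perimeter, so the outer function need only
  be once continuously differentiable; smooth compositions are treated with \<open>exp_bump\<close>.\<close>

lemma C_1_real_compose:
  fixes h h' :: "real \<Rightarrow> real"
  assumes "\<And>t. (h has_real_derivative h' t) (at t)" "continuous_on UNIV h'" "C_k 1 f"
  shows "C_k 1 (\<lambda>x. h (f x))"
proof -
  have f: "(f has_derivative frechet_derivative f (at x)) (at x)" for x
    using assms(3) C_k_Suc_has_derivative[of 0] by simp
  have c: "continuous_on UNIV f"
    by (rule C_k_imp_continuous[OF assms(3)])
  have D: "((\<lambda>x. h (f x)) has_derivative (\<lambda>v. h' (f x) * frechet_derivative f (at x) v)) (at x)" for x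
    using has_derivative_compose[OF f assms(1)[unfolded has_field_derivative_def]] .
  have "C_k 0 (\<lambda>x. h' (f x) * frechet_derivative f (at x) v)" for v
    using assms(3) continuous_on_compose2[OF assms(2) c]
    by (auto intro!: continuous_on_mult)
  with C_k_SucI[OF D, of 0] show ?thesis by simp
qed

text \<open>The family \<open>p(1/t) exp(-1/t)\<close>, extended by 0 to \<open>t \<le> 0\<close>, is closed under differentiation. Keeping the
  polynomial as a parameter turns the smoothness of \<open>exp(-1/t)\<close> into an induction over \<open>C_k\<close>.\<close>

definition exp_bump :: "real poly \<Rightarrow> real \<Rightarrow> real" where
  "exp_bump p t = (if 0 < t then poly p (1/t) * exp (- (1/t)) else 0)"

lemma poly_times_exp_tendsto_0: "((\<lambda>s. poly p s * exp (- s)) \<longlongrightarrow> 0) (at_top :: real filter)"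
proof -
  have "((\<lambda>s. s ^ n * exp (- s)) \<longlongrightarrow> 0) (at_top :: real filter)" for n
    using tendsto_power_div_exp_0[of n] by (simp add: exp_minus divide_inverse)
  then have "((\<lambda>s. \<Sum>i\<le>degree p. coeff p i * (s ^ i * exp (- s))) \<longlongrightarrow> (\<Sum>i\<le>degree p. coeff p i * 0)) (at_top :: real filter)"
    by (intro tendsto_sum tendsto_mult_left)
  then show ?thesis
    by (simp add: poly_altdef sum_distrib_right mult.assoc)
qed

text \<open>With \<open>s = 1/t\<close> the chain rule gives the polynomial \<open>s\<^sup>2 (p(s) - p'(s))\<close>. At 0 the difference
  quotient from the right is \<open>s p(s) exp(-s)\<close>, and exponential decay beats the polynomial.\<close>

lemma exp_bump_has_derivative:
  "(exp_bump p has_real_derivative exp_bump (monom 1 2 * (p - pderiv p)) t) (at t)"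
proof -
  consider "t < 0" | "t > 0" | "t = 0"
    by linarith
  then show ?thesis
  proof cases
    case 1
    have "((\<lambda>_. 0) has_real_derivative 0) (at t)"
      by simp
    then have "(exp_bump p has_real_derivative 0) (at t)"
      by (rule has_field_derivative_transform_within_open[where S="{..<0}"])
        (use 1 in \<open>auto simp: exp_bump_def\<close>)
    then show ?thesis
      using 1 by (simp add: exp_bump_def)
  next
    case 2
    have "((\<lambda>t. poly p (1/t) * exp (- (1/t))) has_real_derivative
        exp_bump (monom 1 2 * (p - pderiv p)) t) (at t)"
      using 2
      by (auto intro!: derivative_eq_intros poly_DERIV[THEN DERIV_chain2]
          simp: exp_bump_def poly_monom field_simps power2_eq_square)
    then show ?thesis
      by (rule has_field_derivative_transform_within_open[where S="{0<..}"])
        (use 2 in \<open>auto simp: exp_bump_def\<close>)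
  next
    case 3
    have "((\<lambda>h. poly (pCons 0 p) (inverse h) * exp (- (inverse h))) \<longlongrightarrow> 0) (at_right 0)"
      using filterlim_compose[OF poly_times_exp_tendsto_0 filterlim_inverse_at_top_right] .
    then have r: "((\<lambda>h. (exp_bump p (0 + h) - exp_bump p 0) / h) \<longlongrightarrow> 0) (at_right 0)"
      by (rule Lim_transform_eventually)
        (auto simp: eventually_at_right_field exp_bump_def field_simps intro!: exI[of _ 1])
    have l: "((\<lambda>h. (exp_bump p (0 + h) - exp_bump p 0) / h) \<longlongrightarrow> 0) (at_left 0)"
      by (rule Lim_transform_eventually[where f="\<lambda>_. 0"])
        (auto simp: eventually_at_left_field exp_bump_def intro!: exI[of _ "-1"])
    show ?thesis
      using l r 3 by (simp add: DERIV_def filterlim_split_at exp_bump_def)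
  qed
qed

lemma C_k_exp_bump_compose:
  assumes "\<And>k. C_k k f"
  shows "C_k k (\<lambda>x. exp_bump p (f x))"
proof (induction k arbitrary: p)
  case 0
  have "continuous_on UNIV (exp_bump p)"
    using exp_bump_has_derivative by (meson DERIV_isCont continuous_at_imp_continuous_on)
  moreover have "continuous_on UNIV f"
    using assms[of 0] by simp
  ultimately show ?case
    using continuous_on_compose2 by fastforce
next
  case (Suc k)
  let ?p = "monom 1 2 * (p - pderiv p)"
  have D: "((\<lambda>x. exp_bump p (f x)) has_derivative
      (\<lambda>v. exp_bump ?p (f x) * frechet_derivative f (at x) v)) (at x)" for x
    using has_derivative_compose[OF C_k_Suc_has_derivative[OF assms[of "Suc 0"]]
        exp_bump_has_derivative[unfolded has_field_derivative_def]] .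
  show ?case
    by (rule C_k_SucI[OF D]) (intro C_k_mult Suc.IH C_k_Suc_derivative assms)
qed

lemma exp_bump_mono: "s \<le> t \<Longrightarrow> exp_bump 1 s \<le> exp_bump 1 t"
  by (auto simp: exp_bump_def field_simps)

lemma C_k_vanishing_derivative:
  assumes "x \<notin> supp f"
  shows "frechet_derivative f (at x) = (\<lambda>v. 0)"
proof -
  have "((\<lambda>_. 0) has_derivative (\<lambda>v. 0)) (at x)"
    by simp
  then have "(f has_derivative (\<lambda>v. 0)) (at x)"
  proof (rule has_derivative_transform_within_open[where s="- supp f"])
    show "0 = f y" if "y \<in> - supp f" for y
      using that closure_subset[of "{x. f x \<noteq> 0}"] by (auto simp: supp_def)
  qed (use assms in \<open>auto simp: supp_def\<close>)
  then show ?thesis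
    using frechet_derivative_at by metis
qed

lemma notin_supp_imp_zero: "x \<notin> supp f \<Longrightarrow> f x = 0"
  using closure_subset[of "{x. f x \<noteq> 0}"] by (auto simp: supp_def)

lemma supp_minimal: "closed S \<Longrightarrow> (\<And>x. x \<notin> S \<Longrightarrow> f x = 0) \<Longrightarrow> supp f \<subseteq> S"
  unfolding supp_def by (rule closure_minimal) auto

lemma compact_supp_minimal: "compact S \<Longrightarrow> (\<And>x. x \<notin> S \<Longrightarrow> f x = 0) \<Longrightarrow> compact (supp f)"
  using supp_minimal[of S f] compact_Int_closed[of S "supp f"]
  by (simp add: supp_def compact_imp_closed inf.absorb2)

text \<open>A nonnegative function of class \<open>C\<^sup>1\<close> that vanishes exactly on the nonpositive half-line; composed
  with itself it produces the cut-off functions below.\<close>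

definition pos_sq :: "real \<Rightarrow> real" where
  "pos_sq t = (max 0 t)\<^sup>2"

lemma pos_sq_has_derivative: "(pos_sq has_real_derivative 2 * max 0 t) (at t)"
proof -
  consider "t < 0" | "t > 0" | "t = 0"
    by linarith
  then show ?thesis
  proof cases
    case 1
    have "((\<lambda>_. 0) has_real_derivative 0) (at t)"
      by simp
    then have "(pos_sq has_real_derivative 0) (at t)"
      by (rule has_field_derivative_transform_within_open[where S="{..<0}"])
        (use 1 in \<open>auto simp: pos_sq_def\<close>)
    then show ?thesis
      using 1 by simp
  next
    case 2
    have "((\<lambda>t. t\<^sup>2) has_real_derivative 2 * t) (at t)"
      by (auto intro!: derivative_eq_intros)
    then have "(pos_sq has_real_derivative 2 * t) (at t)"
      by (rule has_field_derivative_transform_within_open[where S="{0<..}"])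
        (use 2 in \<open>auto simp: pos_sq_def\<close>)
    then show ?thesis
      using 2 by simp
  next
    case 3
    have "((\<lambda>h. pos_sq h / h) \<longlongrightarrow> 0) (at 0)"
    proof (rule tendsto_rabs_zero_cancel, rule tendsto_sandwich[of "\<lambda>_. 0" _ _ abs])
      show "(abs \<longlongrightarrow> (0::real)) (at 0)"
        by (rule tendsto_eq_intros | simp)+
      show "\<forall>\<^sub>F h in at 0. \<bar>pos_sq h / h\<bar> \<le> \<bar>h\<bar>"
        by (rule always_eventually) (auto simp: pos_sq_def power2_eq_square max_def)
    qed auto
    then show ?thesis
      using 3 by (simp add: DERIV_def pos_sq_def)
  qed
qed

lemma C_1_pos_sq_compose: "C_k 1 f \<Longrightarrow> C_k 1 (\<lambda>x. pos_sq (f x))"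
  by (rule C_1_real_compose[OF pos_sq_has_derivative]) (auto intro!: continuous_intros)

lemma C_1_cutoff:
  fixes R :: real
  assumes "0 < R"
  obtains \<eta> :: "'a::euclidean_space \<Rightarrow> real"
  where "C_k 1 \<eta>" "\<And>x. norm x \<le> R \<Longrightarrow> \<eta> x = 1" "\<And>x. norm x \<ge> 2 * R \<Longrightarrow> \<eta> x = 0"
    "\<And>x. 0 \<le> \<eta> x" "\<And>x. \<eta> x \<le> 1"
proof
  let ?n = "\<lambda>x::'a. x \<bullet> x / R\<^sup>2"
  \<comment> \<open>The inner square exceeds 1 as soon as \<open>norm x \<ge> 2 R\<close>, and it is 0 while \<open>norm x \<le> R\<close>.\<close>
  let ?\<eta> = "\<lambda>x::'a. pos_sq (1 - pos_sq (?n x - 1))"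
  have id: "C_k 1 (\<lambda>x::'a. x)"
    by (rule C_k_bounded_linear[OF bounded_linear_ident])
  have "C_k 1 (\<lambda>x::'a. (1 / R\<^sup>2) * (x \<bullet> x))"
    by (intro C_k_mult C_k_const C_k_inner id)
  then show "C_k 1 ?\<eta>"
    by (intro C_1_pos_sq_compose C_k_diff C_k_const) (auto simp: field_simps)
  have n: "?n x = (norm x / R)\<^sup>2" for x
    by (simp add: power_divide power2_norm_eq_inner)
  show "?\<eta> x = 1" if "norm x \<le> R" for x
  proof -
    have "?n x \<le> 1"
      unfolding n using that assms by (auto simp: power_le_one_iff field_simps)
    then show ?thesis
      by (auto simp: pos_sq_def max_def)
  qed
  show "?\<eta> x = 0" if "norm x \<ge> 2 * R" for x
  proof -
    have "2\<^sup>2 \<le> ?n x"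
      unfolding n by (intro power_mono) (use that assms in \<open>auto simp: field_simps\<close>)
    then have "1 \<le> (?n x - 1)\<^sup>2"
      by (intro one_le_power) auto
    then have "1 \<le> pos_sq (?n x - 1)"
      using \<open>2\<^sup>2 \<le> ?n x\<close> by (simp add: pos_sq_def max_def)
    moreover have "pos_sq s = 0" if "s \<le> 0" for s
      using that by (simp add: pos_sq_def max_absorb1)
    ultimately show ?thesis
      by simp
  qed
  show "0 \<le> ?\<eta> x" for x
    by (simp add: pos_sq_def)
  show "?\<eta> x \<le> 1" for x
    by (auto simp: pos_sq_def max_def power_le_one_iff)
qed



section \<open>Integrals of derivatives\<close>

lemma C_1_derivative_bounded:
  fixes f :: "'a::euclidean_space \<Rightarrow> 'b::euclidean_space"
  assumes "C_k 1 f" "compact (supp f)"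
  obtains B where "0 \<le> B" "\<And>x v. norm (frechet_derivative f (at x) v) \<le> B * norm v"
proof -
  have "\<exists>b. \<forall>x. norm (frechet_derivative f (at x) i) \<le> b" for i
  proof -
    have "continuous_on (supp f) (\<lambda>x. frechet_derivative f (at x) i)"
      using assms(1) by (auto intro: continuous_on_subset)
    then have "bounded ((\<lambda>x. frechet_derivative f (at x) i) ` supp f)"
      using assms(2) compact_continuous_image compact_imp_bounded by blast
    then obtain b where "\<And>x. x \<in> supp f \<Longrightarrow> norm (frechet_derivative f (at x) i) \<le> b"
      by (auto simp: bounded_iff)
    then have "norm (frechet_derivative f (at x) i) \<le> max b 0" for x
      using C_k_vanishing_derivative[of x f] by (cases "x \<in> supp f") force+
    then show ?thesis
      by blast
  qed
  then obtain b where b: "\<And>i x. norm (frechet_derivative f (at x) i) \<le> b i"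
    by metis
  have b0: "0 \<le> b i" for i
    using b[of 0 i] norm_ge_zero order_trans by blast
  show ?thesis
  proof
    show "0 \<le> (\<Sum>i\<in>Basis. b i)"
      by (intro sum_nonneg b0)
    fix x v
    have lin: "linear (frechet_derivative f (at x))"
      using assms(1) by (intro linear_frechet_derivative) auto
    have "frechet_derivative f (at x) v = frechet_derivative f (at x) (\<Sum>i\<in>Basis. (v \<bullet> i) *\<^sub>R i)"
      by (simp add: euclidean_representation)
    also have "\<dots> = (\<Sum>i\<in>Basis. (v \<bullet> i) *\<^sub>R frechet_derivative f (at x) i)"
      using lin by (simp add: linear_sum linear_scale)
    also have "norm \<dots> \<le> (\<Sum>i\<in>Basis. norm v * b i)"
    proof (rule sum_norm_le)
      fix i :: 'a assume "i \<in> Basis"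
      then have "\<bar>v \<bullet> i\<bar> * norm (frechet_derivative f (at x) i) \<le> norm v * b i"
        using b b0 Basis_le_norm by (intro mult_mono) auto
      then show "norm ((v \<bullet> i) *\<^sub>R frechet_derivative f (at x) i) \<le> norm v * b i"
        by simp
    qed
    finally show "norm (frechet_derivative f (at x) v) \<le> (\<Sum>i\<in>Basis. b i) * norm v"
      by (simp add: sum_distrib_left mult.commute)
  qed
qed

lemma C_1_continuous_derivative: "C_k 1 f \<Longrightarrow> continuous_on UNIV (\<lambda>x. frechet_derivative f (at x) v)"
  by simp

lemma C_1_has_derivative: "C_k 1 f \<Longrightarrow> (f has_derivative frechet_derivative f (at x)) (at x)"
  using C_k_Suc_has_derivative[of 0 f] by simp

lemma compact_supp_subset_cball:
  assumes "compact (supp f)"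
  obtains R where "0 < R" "supp f \<subseteq> cball 0 R"
  using assms compact_imp_bounded bounded_pos[of "supp f"] by (metis mem_cball_0 subsetI)

text \<open>The difference quotients are dominated by a Lipschitz constant on one ball, which contains the
  translates of the support by all vectors that are no longer than \<open>v\<close>.\<close>

lemma difference_quotient_integral_tendsto:
  fixes f :: "'a::euclidean_space \<Rightarrow> real"
  assumes "C_k 1 f" "compact (supp f)" and [measurable]: "A \<in> sets borel"
  shows "(\<lambda>n. \<integral>x. indicator A x * ((f (x + inverse (real (Suc n)) *\<^sub>R v) - f x) / inverse (real (Suc n))) \<partial>lborel)
     \<longlonglongrightarrow> (\<integral>x. indicator A x * frechet_derivative f (at x) v \<partial>lborel)"
    and "integrable lborel (\<lambda>x. indicator A x * frechet_derivative f (at x) v)"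
proof -
  obtain B where B: "0 \<le> B" "\<And>x v. norm (frechet_derivative f (at x) v) \<le> B * norm v"
    using C_1_derivative_bounded[OF assms(1,2)] by blast
  obtain R where R: "0 < R" "supp f \<subseteq> cball 0 R"
    using compact_supp_subset_cball[OF assms(2)] by blast
  have lip: "norm (f y - f x) \<le> B * norm (y - x)" for x y
  proof (rule differentiable_bound[where S=UNIV and f'="\<lambda>x. frechet_derivative f (at x)"])
    show "onorm (frechet_derivative f (at x)) \<le> B" for x
      by (rule onorm_bound) (use B in auto)
  qed (use C_1_has_derivative[OF assms(1)] in \<open>auto intro: has_derivative_at_withinI\<close>)
  have [measurable]: "f \<in> borel_measurable borel"
    using C_k_imp_continuous[OF assms(1)] by (rule borel_measurable_continuous_onI)
  have [measurable]: "(\<lambda>x. frechet_derivative f (at x) v) \<in> borel_measurable borel"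
    using C_1_continuous_derivative[OF assms(1)] by (rule borel_measurable_continuous_onI)
  let ?C = "cball (0::'a) (R + norm v)"
  let ?w = "\<lambda>x::'a. B * norm v * indicator ?C x"
  have w: "integrable lborel ?w"
    using emeasure_bounded_finite[OF bounded_cball[of "0::'a" "R + norm v"]]
    by (intro integrable_mult_right integrable_real_indicator) (auto simp: less_top)
  have f0: "f x = 0" if "norm x > R" for x
    using that R by (intro notin_supp_imp_zero) auto
  have bd: "norm (indicator A x * ((f (x + inverse (real (Suc n)) *\<^sub>R v) - f x) / inverse (real (Suc n)))) \<le> ?w x" for n x
  proof (cases "x \<in> ?C")
    case True
    have "\<bar>f (x + inverse (real (Suc n)) *\<^sub>R v) - f x\<bar> \<le> B * norm v * inverse (real (Suc n))"
      using lip[of "x + inverse (real (Suc n)) *\<^sub>R v" x] by (simp add: mult_ac)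
    then have "\<bar>(f (x + inverse (real (Suc n)) *\<^sub>R v) - f x) / inverse (real (Suc n))\<bar> \<le> B * norm v"
      by (subst abs_divide, subst pos_divide_le_eq) (simp_all add: mult_ac)
    then show ?thesis
      using True B by (auto simp: indicator_def)
  next
    case False
    have n1: "norm (inverse (real (Suc n)) *\<^sub>R v) \<le> norm v"
      using mult_right_mono[of "inverse (real (Suc n))" 1 "norm v"] by (simp add: field_simps)
    have "norm x > R + norm v"
      using False by simp
    moreover have "norm x \<le> norm (x + inverse (real (Suc n)) *\<^sub>R v) + norm (inverse (real (Suc n)) *\<^sub>R v)"
      by (metis add_diff_cancel_right' norm_triangle_ineq4)
    ultimately have "norm (x + inverse (real (Suc n)) *\<^sub>R v) > R" "norm x > R"
      using n1 norm_ge_zero[of v] by linarith+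
    then show ?thesis
      using f0 B by simp
  qed
  have h0: "(\<lambda>n. inverse (real (Suc n))) \<longlonglongrightarrow> 0"
    by (rule LIMSEQ_inverse_real_of_nat)
  have lim: "(\<lambda>n. (f (x + inverse (real (Suc n)) *\<^sub>R v) - f x) / inverse (real (Suc n))) \<longlonglongrightarrow> frechet_derivative f (at x) v" for x
  proof -
    have "((\<lambda>t. f (x + t *\<^sub>R v)) has_derivative (\<lambda>t. frechet_derivative f (at x) (t *\<^sub>R v))) (at 0)"
      by (rule has_derivative_compose[of "\<lambda>t. x + t *\<^sub>R v" "\<lambda>t. t *\<^sub>R v"])
        (use C_1_has_derivative[OF assms(1), of x] in \<open>auto intro!: derivative_eq_intros\<close>)
    moreover have "frechet_derivative f (at x) (t *\<^sub>R v) = frechet_derivative f (at x) v * t" for t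
      using linear_frechet_derivative[of f "at x"] assms(1) by (simp add: linear_scale mult.commute)
    ultimately have "((\<lambda>t. f (x + t *\<^sub>R v)) has_real_derivative frechet_derivative f (at x) v) (at 0)"
      by (simp add: has_field_derivative_def)
    then have "((\<lambda>t. (f (x + t *\<^sub>R v) - f x) / t) \<longlongrightarrow> frechet_derivative f (at x) v) (at 0)"
      by (simp add: DERIV_def)
    moreover have "filterlim (\<lambda>n. inverse (real (Suc n))) (at 0) sequentially"
      using h0 by (simp add: filterlim_at del: of_nat_Suc)
    ultimately show ?thesis
      by (rule filterlim_compose)
  qed
  have lim': "AE x in lborel. (\<lambda>n. indicator A x * ((f (x + inverse (real (Suc n)) *\<^sub>R v) - f x) / inverse (real (Suc n))))
      \<longlonglongrightarrow> indicator A x * frechet_derivative f (at x) v"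
    by (intro AE_I2 tendsto_mult_left lim)
  show "(\<lambda>n. \<integral>x. indicator A x * ((f (x + inverse (real (Suc n)) *\<^sub>R v) - f x) / inverse (real (Suc n))) \<partial>lborel)
     \<longlonglongrightarrow> (\<integral>x. indicator A x * frechet_derivative f (at x) v \<partial>lborel)"
    by (rule integral_dominated_convergence[OF _ _ w lim' AE_I2[OF bd]]) measurable
  show "integrable lborel (\<lambda>x. indicator A x * frechet_derivative f (at x) v)"
    by (rule integrable_dominated_convergence[OF _ _ w lim' AE_I2[OF bd]]) measurable
qed

lemma lborel_integral_affine:
  fixes f :: "'a::euclidean_space \<Rightarrow> real"
  assumes "c \<noteq> 0" and [measurable]: "f \<in> borel_measurable borel"
  shows "(\<integral>x. f x \<partial>lborel) = \<bar>c\<bar> ^ DIM('a) * (\<integral>x. f (a + c *\<^sub>R x) \<partial>lborel)"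
proof -
  have "(\<integral>x. f x \<partial>lborel) = (\<integral>x. f x \<partial>density (distr lborel borel (\<lambda>x. a + c *\<^sub>R x)) (\<lambda>_. ennreal (\<bar>c\<bar> ^ DIM('a))))"
    using lborel_affine[OF assms(1), of a] by (simp add: ennreal_power)
  also have "\<dots> = (\<integral>x. \<bar>c\<bar> ^ DIM('a) * f x \<partial>distr lborel borel (\<lambda>x. a + c *\<^sub>R x))"
    by (subst integral_density) auto
  also have "\<dots> = (\<integral>x. \<bar>c\<bar> ^ DIM('a) * f (a + c *\<^sub>R x) \<partial>lborel)"
    by (subst integral_distr) auto
  finally show ?thesis
    by simp
qed

lemma lborel_integral_translate:
  fixes f :: "'a::euclidean_space \<Rightarrow> real"
  assumes "f \<in> borel_measurable borel"
  shows "(\<integral>x. f (x + a) \<partial>lborel) = (\<integral>x. f x \<partial>lborel)"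
  using lborel_integral_affine[of 1 f a] assms by (simp add: add.commute)

lemma integrable_C_compact_supp:
  fixes f :: "'a::euclidean_space \<Rightarrow> real"
  assumes "continuous_on UNIV f" "compact K" "\<And>x. x \<notin> K \<Longrightarrow> f x = 0"
  shows "integrable lborel f"
proof -
  have "integrable lborel (\<lambda>x. indicator K x *\<^sub>R f x)"
    using assms by (intro borel_integrable_compact) (auto intro: continuous_on_subset)
  also have "(\<lambda>x. indicator K x *\<^sub>R f x) = f"
    using assms(3) by (force simp: indicator_def)
  finally show ?thesis .
qed

text \<open>The integral is invariant under translations, so all difference quotients integrate to 0.\<close>

lemma integral_derivative_eq_0:
  fixes f :: "'a::euclidean_space \<Rightarrow> real"
  assumes "C_k 1 f" "compact (supp f)"
  shows "(\<integral>x. frechet_derivative f (at x) v \<partial>lborel) = 0"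
proof -
  have f [measurable]: "f \<in> borel_measurable borel"
    using C_k_imp_continuous[OF assms(1)] by (rule borel_measurable_continuous_onI)
  have i: "integrable lborel f"
    by (rule integrable_C_compact_supp[OF C_k_imp_continuous[OF assms(1)] assms(2)])
      (rule notin_supp_imp_zero)
  have i2: "integrable lborel (\<lambda>x. f (x + w))" for w
  proof -
    have "integrable (distr lborel borel ((+) w)) f"
      using i by (simp add: lborel_distr_plus)
    then show ?thesis
      by (subst (asm) integrable_distr_eq) (auto simp: add.commute)
  qed
  have "(\<integral>x. (f (x + inverse (real (Suc n)) *\<^sub>R v) - f x) / inverse (real (Suc n)) \<partial>lborel) = 0" for n
    by (simp add: i i2 lborel_integral_translate Bochner_Integration.integral_diff del: of_nat_Suc)
  then have "(\<lambda>n. 0) \<longlonglongrightarrow> (\<integral>x. frechet_derivative f (at x) v \<partial>lborel)"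
    using difference_quotient_integral_tendsto(1)[OF assms, of UNIV v] by simp
  then show ?thesis
    by (simp add: LIMSEQ_const_iff)
qed

lemma integral_lebesgue_on_borel:
  fixes f :: "'a::euclidean_space \<Rightarrow> real"
  assumes "A \<in> sets borel" "f \<in> borel_measurable borel"
  shows "integral\<^sup>L (lebesgue_on A) f = (\<integral>x. indicator A x * f x \<partial>lborel)"
proof -
  have "integral\<^sup>L (lebesgue_on A) f = (\<integral>x. indicator A x * f x \<partial>lebesgue)"
    using assms(1) by (subst integral_restrict_space) auto
  also have "\<dots> = (\<integral>x. indicator A x * f x \<partial>lborel)"
    using assms by (intro integral_completion borel_measurable_times borel_measurable_indicator) auto
  finally show ?thesis .
qed



section \<open>Perimeter: test fields and similarities\<close>

lemma divergence_continuous: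
  assumes "C_k 1 \<phi>"
  shows "continuous_on UNIV (divergence \<phi>)"
  unfolding divergence_def[abs_def]
  by (intro continuous_intros C_1_continuous_derivative assms)

lemma divergence_vanishes: "x \<notin> supp \<phi> \<Longrightarrow> divergence \<phi> x = 0"
  by (simp add: divergence_def C_k_vanishing_derivative)

lemma integrable_divergence:
  assumes "C_k 1 \<phi>" "compact (supp \<phi>)"
  shows "integrable lborel (divergence \<phi>)"
  by (rule integrable_C_compact_supp[OF divergence_continuous[OF assms(1)] assms(2)])
    (rule divergence_vanishes)

lemma C_1_component:
  fixes \<phi> :: "'a::euclidean_space \<Rightarrow> 'b::euclidean_space"
  assumes "C_k 1 \<phi>"
  shows "C_k 1 (\<lambda>x. \<phi> x \<bullet> i)" "frechet_derivative (\<lambda>x. \<phi> x \<bullet> i) (at x) v = frechet_derivative \<phi> (at x) v \<bullet> i"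
proof -
  show "C_k 1 (\<lambda>x. \<phi> x \<bullet> i)"
    by (intro C_k_inner assms C_k_const)
  have "((\<lambda>x. \<phi> x \<bullet> i) has_derivative (\<lambda>v. frechet_derivative \<phi> (at x) v \<bullet> i)) (at x)"
    by (intro has_derivative_inner_left C_1_has_derivative assms)
  then show "frechet_derivative (\<lambda>x. \<phi> x \<bullet> i) (at x) v = frechet_derivative \<phi> (at x) v \<bullet> i"
    using frechet_derivative_at by metis
qed

text \<open>Test fields are continuous, so the bound 1 that is required almost everywhere holds everywhere.\<close>

lemma perimeter_leI:
  fixes A :: "'a::euclidean_space set"
  assumes "A \<in> sets borel"
    and le: "\<And>\<phi>::'a \<Rightarrow> 'a. C_k 1 \<phi> \<Longrightarrow> compact (supp \<phi>) \<Longrightarrow> (\<And>x. norm (\<phi> x) \<le> 1) \<Longrightarrow>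
       ereal (\<integral>x. indicator A x * divergence \<phi> x \<partial>lborel) \<le> c"
  shows "perimeter A \<le> c"
  unfolding perimeter_def
proof (rule SUP_least, safe)
  fix \<phi> :: "'a \<Rightarrow> 'a"
  assume \<phi>: "C_k 1 \<phi>" "compact (supp \<phi>)" "AE x in lebesgue. norm (\<phi> x) \<le> 1"
  have "closed {x. norm (\<phi> x) \<le> 1}"
    using C_k_imp_continuous[OF \<phi>(1)] by (intro closed_Collect_le continuous_intros)
  then have "norm (\<phi> x) \<le> 1" for x
    using mem_closed_if_AE_lebesgue[of "{x. norm (\<phi> x) \<le> 1}" x] \<phi>(3) by simp
  with le[OF \<phi>(1,2)] show "ereal (integral\<^sup>L (lebesgue_on A) (divergence \<phi>)) \<le> c"
    using assms(1) borel_measurable_continuous_onI[OF divergence_continuous[OF \<phi>(1)]]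
    by (simp add: integral_lebesgue_on_borel)
qed

lemma perimeter_geI:
  fixes A :: "'a::euclidean_space set"
  assumes "A \<in> sets borel" "C_k 1 \<phi>" "compact (supp \<phi>)" "\<And>x. norm (\<phi> x) \<le> 1"
  shows "ereal (\<integral>x. indicator A x * divergence \<phi> x \<partial>lborel) \<le> perimeter A"
proof -
  have "ereal (integral\<^sup>L (lebesgue_on A) (divergence \<phi>)) \<le> perimeter A"
    unfolding perimeter_def by (rule SUP_upper) (use assms in auto)
  then show ?thesis
    using assms(1) borel_measurable_continuous_onI[OF divergence_continuous[OF assms(2)]]
    by (simp add: integral_lebesgue_on_borel)
qed

lemma C_k_zero_supp: "supp (\<lambda>_. 0) = {}"
  by (simp add: supp_def)

lemma perimeter_nonneg: "A \<in> sets borel \<Longrightarrow> 0 \<le> perimeter A"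
  using perimeter_geI[of A "\<lambda>_. 0"] by (simp add: C_k_zero_supp divergence_def zero_ereal_def)

lemma affine_image_eq_vimage:
  fixes A :: "'a::real_vector set"
  assumes "c \<noteq> 0"
  shows "a + c *\<^sub>R x \<in> (\<lambda>x. a + c *\<^sub>R x) ` A \<longleftrightarrow> x \<in> A"
  using assms by auto

lemma affine_image_borel:
  fixes A :: "'a::euclidean_space set"
  assumes "c \<noteq> 0" "A \<in> sets borel"
  shows "(\<lambda>x. a + c *\<^sub>R x) ` A \<in> sets borel"
proof -
  have "(\<lambda>x. a + c *\<^sub>R x) ` A = (\<lambda>y. (1/c) *\<^sub>R (y - a)) -` A \<inter> space borel"
  proof (safe)
    fix y assume "(1/c) *\<^sub>R (y - a) \<in> A"
    then show "y \<in> (\<lambda>x. a + c *\<^sub>R x) ` A"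
      using assms(1) by (intro image_eqI[of _ _ "(1/c) *\<^sub>R (y - a)"]) auto
  qed (use assms in auto)
  also have "\<dots> \<in> sets borel"
    by (intro measurable_sets[OF _ assms(2)]) measurable
  finally show ?thesis .
qed

lemma supp_affine:
  fixes f :: "'a::euclidean_space \<Rightarrow> 'b::real_normed_vector"
  assumes "compact (supp f)" "c \<noteq> 0"
  shows "compact (supp (\<lambda>x. f (a + c *\<^sub>R x)))"
    and "supp (\<lambda>x. f (a + c *\<^sub>R x)) \<subseteq> (\<lambda>y. (1/c) *\<^sub>R (y - a)) ` supp f"
proof -
  have K: "compact ((\<lambda>y. (1/c) *\<^sub>R (y - a)) ` supp f)"
    using assms(1) by (intro compact_continuous_image continuous_intros)
  have 0: "f (a + c *\<^sub>R x) = 0" if "x \<notin> (\<lambda>y. (1/c) *\<^sub>R (y - a)) ` supp f" for x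
  proof (rule notin_supp_imp_zero[of "a + c *\<^sub>R x" f])
    have "x = (1/c) *\<^sub>R ((a + c *\<^sub>R x) - a)"
      using assms(2) by simp
    then show "a + c *\<^sub>R x \<notin> supp f"
      using that by blast
  qed
  show "compact (supp (\<lambda>x. f (a + c *\<^sub>R x)))"
    by (rule compact_supp_minimal[of _ "\<lambda>x. f (a + c *\<^sub>R x)", OF K 0])
  show "supp (\<lambda>x. f (a + c *\<^sub>R x)) \<subseteq> (\<lambda>y. (1/c) *\<^sub>R (y - a)) ` supp f"
    by (rule supp_minimal[of _ "\<lambda>x. f (a + c *\<^sub>R x)", OF compact_imp_closed[OF K] 0])
qed

lemma frechet_derivative_affine:
  assumes "C_k 1 f"
  shows "frechet_derivative (\<lambda>x. f (a + c *\<^sub>R x)) (at x) v = c *\<^sub>R frechet_derivative f (at (a + c *\<^sub>R x)) v"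
proof -
  have "((\<lambda>x. f (a + c *\<^sub>R x)) has_derivative (\<lambda>v. frechet_derivative f (at (a + c *\<^sub>R x)) (c *\<^sub>R v))) (at x)"
    by (rule has_derivative_compose[of "\<lambda>x. a + c *\<^sub>R x", OF _ C_1_has_derivative[OF assms]])
      (auto intro!: derivative_eq_intros)
  then have "frechet_derivative (\<lambda>x. f (a + c *\<^sub>R x)) (at x) v = frechet_derivative f (at (a + c *\<^sub>R x)) (c *\<^sub>R v)"
    using frechet_derivative_at by metis
  also have "\<dots> = c *\<^sub>R frechet_derivative f (at (a + c *\<^sub>R x)) v"
    using assms linear_frechet_derivative[of f] by (simp add: linear_scale)
  finally show ?thesis .
qed

text \<open>Test fields on the image pull back to test fields. The divergence contributes one factor \<open>c\<close>, the
  change of variables \<open>c\<^sup>d\<close>. The converse inequality is this one for the inverse similarity.\<close>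

lemma perimeter_affine_le:
  fixes A :: "'a::euclidean_space set"
  assumes "c > 0" and A [measurable]: "A \<in> sets borel" and "perimeter A \<le> ereal p"
  shows "perimeter ((\<lambda>x. a + c *\<^sub>R x) ` A) \<le> ereal (c ^ (DIM('a) - 1) * p)"
proof (rule perimeter_leI)
  show B [measurable]: "(\<lambda>x. a + c *\<^sub>R x) ` A \<in> sets borel"
    using assms by (intro affine_image_borel) auto
  fix \<phi> :: "'a \<Rightarrow> 'a"
  assume \<phi>: "C_k 1 \<phi>" "compact (supp \<phi>)" "\<And>x. norm (\<phi> x) \<le> 1"
  have [measurable]: "divergence \<phi> \<in> borel_measurable borel"
    by (intro borel_measurable_continuous_onI divergence_continuous \<phi>)
  let ?\<psi> = "\<lambda>x. \<phi> (a + c *\<^sub>R x)"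
  have div: "divergence ?\<psi> x = c * divergence \<phi> (a + c *\<^sub>R x)" for x
    by (simp add: divergence_def frechet_derivative_affine[OF \<phi>(1)] sum_distrib_left)
  have "ereal (\<integral>x. indicator A x * divergence ?\<psi> x \<partial>lborel) \<le> perimeter A"
    using \<phi> assms(1)
    by (intro perimeter_geI A C_k_affine supp_affine(1) bounded_linear_scaleR_right) auto
  also have "\<dots> \<le> ereal p"
    by fact
  finally have le: "c * (\<integral>x. indicator A x * divergence \<phi> (a + c *\<^sub>R x) \<partial>lborel) \<le> p"
    by (simp add: div mult.left_commute)
  have "(\<integral>x. indicator ((\<lambda>x. a + c *\<^sub>R x) ` A) x * divergence \<phi> x \<partial>lborel)
      = c ^ DIM('a) * (\<integral>x. indicator ((\<lambda>x. a + c *\<^sub>R x) ` A) (a + c *\<^sub>R x) * divergence \<phi> (a + c *\<^sub>R x) \<partial>lborel)"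
    using assms(1) by (subst lborel_integral_affine[of c _ a]) auto
  also have "\<dots> = c ^ DIM('a) * (\<integral>x. indicator A x * divergence \<phi> (a + c *\<^sub>R x) \<partial>lborel)"
    using assms(1) affine_image_eq_vimage[of c a _ A] by (simp add: indicator_def)
  also have "\<dots> = c ^ (DIM('a) - 1) * (c * (\<integral>x. indicator A x * divergence \<phi> (a + c *\<^sub>R x) \<partial>lborel))"
    using power_minus_mult[of "DIM('a)" c] DIM_positive[where 'a='a] by (simp add: mult.assoc[symmetric])
  also have "\<dots> \<le> c ^ (DIM('a) - 1) * p"
    using le assms(1) by (intro mult_left_mono) auto
  finally show "ereal (\<integral>x. indicator ((\<lambda>x. a + c *\<^sub>R x) ` A) x * divergence \<phi> x \<partial>lborel) \<le> ereal (c ^ (DIM('a) - 1) * p)"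
    by simp
qed

lemma emeasure_affine_image:
  fixes A :: "'a::euclidean_space set"
  assumes "c > 0" and A [measurable]: "A \<in> sets borel"
  shows "emeasure lborel ((\<lambda>x. a + c *\<^sub>R x) ` A) = ennreal (c ^ DIM('a)) * emeasure lborel A"
proof -
  let ?g = "\<lambda>x. a + c *\<^sub>R x"
  have [measurable]: "?g ` A \<in> sets borel"
    using assms by (intro affine_image_borel) auto
  have "emeasure lborel (?g ` A) = emeasure (density (distr lborel borel ?g) (\<lambda>_. ennreal (c ^ DIM('a)))) (?g ` A)"
    using lborel_affine[of c a] assms(1) by (simp add: ennreal_power)
  also have "\<dots> = ennreal (c ^ DIM('a)) * emeasure (distr lborel borel ?g) (?g ` A)"
    by (rule emeasure_density_const) simp
  also have "emeasure (distr lborel borel ?g) (?g ` A) = emeasure lborel (?g -` ?g ` A \<inter> space lborel)"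
    by (rule emeasure_distr) auto
  also have "?g -` ?g ` A \<inter> space lborel = A"
    using assms(1) by auto
  finally show ?thesis .
qed

lemma measure_affine_image:
  fixes A :: "'a::euclidean_space set"
  assumes "c > 0" "A \<in> sets borel"
  shows "measure lborel ((\<lambda>x. a + c *\<^sub>R x) ` A) = c ^ DIM('a) * measure lborel A"
  using assms(1) by (simp add: measure_def emeasure_affine_image[OF assms] enn2real_mult)

section \<open>Perimeter: comparison with the volume\<close>

text \<open>The integral over \<open>A\<close> of a difference quotient of \<open>f\<close> is the difference of the integrals of \<open>f\<close> over
  a translate of \<open>A\<close> and over \<open>A\<close>. As \<open>|f| \<le> 1\<close>, it is at most the measure of the symmetric
  difference, whose two halves have the same measure; this is where the factor 2 comes from.\<close>

lemma integral_derivative_le: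
  fixes f :: "'a::euclidean_space \<Rightarrow> real"
  assumes "C_k 1 f" "compact (supp f)" "\<And>x. \<bar>f x\<bar> \<le> 1"
    and A [measurable]: "A \<in> sets borel" and fin: "emeasure lborel A < \<infinity>"
    and K: "\<And>t. 0 < t \<Longrightarrow> t \<le> 1 \<Longrightarrow> measure lborel ({x. x - t *\<^sub>R v \<in> A} - A) \<le> K * t"
  shows "(\<integral>x. indicator A x * frechet_derivative f (at x) v \<partial>lborel) \<le> 2 * K"
proof (rule LIMSEQ_le_const2[OF difference_quotient_integral_tendsto(1)[OF assms(1,2) A]], intro exI allI impI)
  fix n :: nat
  define t where "t = inverse (real (Suc n))"
  have t: "0 < t" "t \<le> 1"
    by (auto simp: t_def field_simps)
  have f [measurable]: "f \<in> borel_measurable borel"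
    using C_k_imp_continuous[OF assms(1)] by (rule borel_measurable_continuous_onI)
  have fi: "integrable lborel f"
    by (rule integrable_C_compact_supp[OF C_k_imp_continuous[OF assms(1)] assms(2)])
      (rule notin_supp_imp_zero)
  let ?A = "{x. x - t *\<^sub>R v \<in> A}"
  have A' [measurable]: "?A \<in> sets borel"
    by measurable
  have Aeq: "?A = (\<lambda>x. t *\<^sub>R v + 1 *\<^sub>R x) ` A"
    by (auto intro!: image_eqI[where x="_ - t *\<^sub>R v"])
  have mA: "measure lborel ?A = measure lborel A"
    unfolding Aeq by (subst measure_affine_image) auto
  have fin': "emeasure lborel ?A < \<infinity>"
  proof -
    have "emeasure lborel ?A = emeasure (distr lborel borel ((+) (- t *\<^sub>R v))) A"
      by (subst emeasure_distr) (auto intro!: arg_cong2[where f=emeasure] simp: vimage_def algebra_simps)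
    then show ?thesis
      using fin by (simp only: lborel_distr_plus)
  qed
  have int: "integrable lborel (\<lambda>x. indicator A x * f x)" "integrable lborel (\<lambda>x. indicator ?A x * f x)"
    using fi by (auto intro!: integrable_mult_indicator[where 'b=real, simplified])
  have shift: "(\<integral>x. indicator A x * f (x + t *\<^sub>R v) \<partial>lborel) = (\<integral>x. indicator ?A x * f x \<partial>lborel)"
    using lborel_integral_translate[of "\<lambda>x. indicator ?A x * f x" "t *\<^sub>R v"]
    by (simp add: indicator_def)
  have int': "integrable lborel (\<lambda>x. indicator A x * f (x + t *\<^sub>R v))"
  proof -
    have "integrable (distr lborel borel ((+) (t *\<^sub>R v))) (\<lambda>x. indicator ?A x * f x)"
      using int(2) by (simp add: lborel_distr_plus)
    then have "integrable lborel (\<lambda>x. indicator ?A (t *\<^sub>R v + x) * f (t *\<^sub>R v + x))"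
      by (subst (asm) integrable_distr_eq) auto
    then show ?thesis
      by (simp add: indicator_def add.commute)
  qed
  have dfin: "emeasure lborel (?A - A) < \<infinity>" "emeasure lborel (A - ?A) < \<infinity>"
    using fin fin' by (auto intro: le_less_trans[OF emeasure_mono])
  have mD: "measure lborel (A - ?A) = measure lborel (?A - A)"
  proof -
    have "measure lborel (A - A \<inter> ?A) = measure lborel A - measure lborel (A \<inter> ?A)"
      by (rule measure_Diff) (use fin in auto)
    moreover have "measure lborel (?A - A \<inter> ?A) = measure lborel ?A - measure lborel (A \<inter> ?A)"
      by (rule measure_Diff) (use fin' in auto)
    moreover have "A - A \<inter> ?A = A - ?A" "?A - A \<inter> ?A = ?A - A"
      by auto
    ultimately show ?thesis
      using mA by simp
  qed
  have "(\<integral>x. indicator A x * ((f (x + t *\<^sub>R v) - f x) / t) \<partial>lborel)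
      = (\<integral>x. (indicator A x * f (x + t *\<^sub>R v) - indicator A x * f x) / t \<partial>lborel)"
    by (simp add: right_diff_distrib)
  also have "\<dots> = ((\<integral>x. indicator A x * f (x + t *\<^sub>R v) \<partial>lborel) - (\<integral>x. indicator A x * f x \<partial>lborel)) / t"
    by (subst integral_divide_zero, subst Bochner_Integration.integral_diff[OF int' int(1)]) (rule refl)
  also have "\<dots> = (\<integral>x. indicator ?A x * f x - indicator A x * f x \<partial>lborel) / t"
    using int shift by simp
  also have "(\<integral>x. indicator ?A x * f x - indicator A x * f x \<partial>lborel)
      \<le> (\<integral>x. indicator (?A - A) x + indicator (A - ?A) x \<partial>lborel)"
  proof (rule integral_mono)
    show "integrable lborel (\<lambda>x. indicator (?A - A) x + indicator (A - ?A) x :: real)"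
      using dfin by (intro Bochner_Integration.integrable_add integrable_real_indicator) auto
    show "indicator ?A x * f x - indicator A x * f x \<le> indicator (?A - A) x + indicator (A - ?A) x" for x
      using assms(3)[of x] by (auto simp: indicator_def abs_le_iff)
  qed (use int in auto)
  also have "\<dots> = 2 * measure lborel (?A - A)"
    using dfin mD by (subst Bochner_Integration.integral_add) (auto intro!: integrable_real_indicator)
  also have "\<dots> \<le> 2 * (K * t)"
    using K[OF t] by simp
  finally show "(\<integral>x. indicator A x * ((f (x + inverse (real (Suc n)) *\<^sub>R v) - f x) / inverse (real (Suc n))) \<partial>lborel) \<le> 2 * K"
    using t by (simp add: t_def divide_right_mono)
qed

lemma one_plus_power_le: "0 \<le> s \<Longrightarrow> s \<le> 1 \<Longrightarrow> (1 + s :: real) ^ n - 1 \<le> 2 ^ n * s"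
proof (induction n)
  case (Suc n)
  have "(1 + s) ^ n \<le> 2 ^ n"
    using Suc.prems by (intro power_mono) auto
  then have "s * (1 + s) ^ n \<le> s * 2 ^ n"
    using Suc.prems by (intro mult_left_mono) auto
  then show ?case
    using Suc by (simp add: algebra_simps)
qed simp

text \<open>The translation vector has length at most \<open>t\<close> and is absorbed by \<open>t\<close> times the unit ball in \<open>A\<close>.\<close>

lemma convex_translate_subset_dilate:
  fixes A :: "'a::real_normed_vector set"
  assumes "convex A" "cball 0 1 \<subseteq> A" "norm v \<le> 1" "0 < t" "x - t *\<^sub>R v \<in> A"
  shows "x \<in> (\<lambda>x. 0 + (1 + t) *\<^sub>R x) ` A"
proof
  have "(1 / (1 + t)) *\<^sub>R (x - t *\<^sub>R v) + (t / (1 + t)) *\<^sub>R v \<in> A"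
    using assms by (intro convexD[OF assms(1)]) (auto simp: field_simps)
  moreover have "(1 / (1 + t)) *\<^sub>R (x - t *\<^sub>R v) + (t / (1 + t)) *\<^sub>R v = (1 / (1 + t)) *\<^sub>R x"
    by (simp add: scaleR_diff_right)
  ultimately show "(1 / (1 + t)) *\<^sub>R x \<in> A"
    by simp
  show "x = 0 + (1 + t) *\<^sub>R (1 / (1 + t)) *\<^sub>R x"
    using assms(4) by simp
qed

text \<open>Each partial derivative is estimated by translating \<open>A\<close> along its coordinate axis: the translate lies
  in the dilate of \<open>A\<close> by \<open>1 + t\<close>, whose volume exceeds that of \<open>A\<close> by at most \<open>2\<^sup>d t |A|\<close>.\<close>

lemma perimeter_upper_bound:
  fixes A :: "'a::euclidean_space set"
  assumes "open A" "convex A" "bounded A" "cball 0 1 \<subseteq> A"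
  shows "perimeter A \<le> ereal (DIM('a) * (2 * (2 ^ DIM('a) * measure lborel A)))"
proof (rule perimeter_leI)
  have A [measurable]: "A \<in> sets borel"
    using assms(1) by simp
  then show "A \<in> sets borel" .
  have fin: "emeasure lborel A < \<infinity>"
    using emeasure_bounded_finite[OF assms(3)] by (simp add: less_top)
  have K: "measure lborel ({x. x - t *\<^sub>R v \<in> A} - A) \<le> (2 ^ DIM('a) * measure lborel A) * t"
    if v: "v \<in> Basis" and t: "0 < t" "t \<le> 1" for v :: 'a and t
  proof -
    define S where "S = (\<lambda>x. 0 + (1 + t) *\<^sub>R x) ` A"
    have S [measurable]: "S \<in> sets borel"
      unfolding S_def by (intro affine_image_borel A) (use t in auto)
    have "bounded S"
      unfolding S_def using assms(3) by (simp add: bounded_scaling)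
    then have finS: "S \<in> fmeasurable lborel"
      using emeasure_bounded_finite[of S] by (simp add: fmeasurable_def less_top)
    have "{x. x - t *\<^sub>R v \<in> A} \<subseteq> S"
      unfolding S_def using convex_translate_subset_dilate[OF assms(2,4), of v t] v t by auto
    moreover have AS: "A \<subseteq> S"
      unfolding S_def using convex_translate_subset_dilate[OF assms(2,4), of 0 t] t by auto
    ultimately have "measure lborel ({x. x - t *\<^sub>R v \<in> A} - A) \<le> measure lborel (S - A)"
      using finS by (intro measure_mono_fmeasurable fmeasurable_Diff) auto
    also have "\<dots> = measure lborel S - measure lborel A"
      using AS finS by (intro measure_Diff) (auto simp: fmeasurable_def)
    also have "\<dots> = ((1 + t) ^ DIM('a) - 1) * measure lborel A"
      unfolding S_def using t by (subst measure_affine_image) (auto simp: algebra_simps)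
    also have "\<dots> \<le> (2 ^ DIM('a) * t) * measure lborel A"
      using one_plus_power_le[of t] t by (intro mult_right_mono) auto
    finally show ?thesis
      by (simp add: mult_ac)
  qed
  fix \<phi> :: "'a \<Rightarrow> 'a"
  assume \<phi>: "C_k 1 \<phi>" "compact (supp \<phi>)" "\<And>x. norm (\<phi> x) \<le> 1"
  have cs: "compact (supp (\<lambda>x. \<phi> x \<bullet> i))" for i
    using \<phi>(2) by (rule compact_supp_minimal) (simp add: notin_supp_imp_zero)
  have "(\<integral>x. indicator A x * divergence \<phi> x \<partial>lborel)
      = (\<integral>x. (\<Sum>i\<in>Basis. indicator A x * frechet_derivative (\<lambda>x. \<phi> x \<bullet> i) (at x) i) \<partial>lborel)"
    by (simp add: divergence_def C_1_component[OF \<phi>(1)] sum_distrib_left)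
  also have "\<dots> = (\<Sum>i\<in>Basis. \<integral>x. indicator A x * frechet_derivative (\<lambda>x. \<phi> x \<bullet> i) (at x) i \<partial>lborel)"
    by (intro Bochner_Integration.integral_sum difference_quotient_integral_tendsto(2) C_1_component \<phi> cs A)
  also have "\<dots> \<le> (\<Sum>i\<in>(Basis::'a set). 2 * (2 ^ DIM('a) * measure lborel A))"
  proof (rule sum_mono, rule integral_derivative_le)
    fix i :: 'a assume i: "i \<in> Basis"
    show "\<bar>\<phi> x \<bullet> i\<bar> \<le> 1" for x
      using Basis_le_norm[OF i, of "\<phi> x"] \<phi>(3)[of x] by linarith
  qed (use fin K cs C_1_component[OF \<phi>(1)] in auto)
  finally show "ereal (\<integral>x. indicator A x * divergence \<phi> x \<partial>lborel)
      \<le> ereal (DIM('a) * (2 * (2 ^ DIM('a) * measure lborel A)))"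
    by simp
qed



text \<open>The field \<open>sin (a \<bullet> (x - z)) a / |a|\<close> has norm at most 1 and divergence
  \<open>cos (a \<bullet> (x - z)) |a|\<close>, which is at least \<open>cos 1 |a|\<close> on the slab. A cut-off that equals 1 near \<open>A\<close>
  makes its support compact.\<close>

lemma perimeter_lower_bound:
  fixes A :: "'a::euclidean_space set"
  assumes A [measurable]: "A \<in> sets borel" and "bounded A"
    and slab: "\<And>x. x \<in> A \<Longrightarrow> \<bar>a \<bullet> (x - z)\<bar> \<le> 1"
  shows "ereal (cos 1 * norm a * measure lborel A) \<le> perimeter A"
proof (cases "a = 0")
  case True
  then show ?thesis
    using perimeter_nonneg[OF A] by (simp add: zero_ereal_def)
next
  case False
  obtain R where R: "0 < R" "A \<subseteq> ball 0 R"
    using bounded_subset_ballD[OF assms(2), of 0] by auto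
  obtain \<eta> :: "'a \<Rightarrow> real" where \<eta>: "C_k 1 \<eta>" "\<And>x. norm x \<le> R \<Longrightarrow> \<eta> x = 1"
      "\<And>x. norm x \<ge> 2 * R \<Longrightarrow> \<eta> x = 0" "\<And>x. 0 \<le> \<eta> x" "\<And>x. \<eta> x \<le> 1"
    using C_1_cutoff[OF R(1), where 'a='a] by metis
  define s where "s x = sin (a \<bullet> (x - z))" for x
  define \<phi> where "\<phi> x = (\<eta> x * s x) *\<^sub>R (a /\<^sub>R norm a)" for x
  have l: "C_k 1 (\<lambda>x. a \<bullet> (x - z))"
    by (intro C_k_inner C_k_diff C_k_const C_k_bounded_linear[OF bounded_linear_ident])
  have s: "C_k 1 s"
    unfolding s_def by (rule C_1_real_compose[OF DERIV_sin _ l]) (auto intro: continuous_intros)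
  have \<phi>: "C_k 1 \<phi>"
    unfolding \<phi>_def by (intro C_k_scaleR C_k_mult \<eta>(1) s C_k_const)
  have supp: "compact (supp \<phi>)"
    by (rule compact_supp_minimal[OF compact_cball[of 0 "2*R"]]) (use \<eta>(3) in \<open>auto simp: \<phi>_def\<close>)
  have bd: "norm (\<phi> x) \<le> 1" for x
  proof -
    have "norm (\<phi> x) = \<bar>\<eta> x\<bar> * \<bar>s x\<bar>"
      using False by (simp add: \<phi>_def abs_mult)
    also have "\<dots> \<le> 1 * 1"
      using \<eta>(4,5)[of x] by (intro mult_mono) (auto simp: s_def)
    finally show ?thesis by simp
  qed
  have div: "divergence \<phi> x = cos (a \<bullet> (x - z)) * norm a" if "x \<in> A" for x
  proof -
    have d: "((\<lambda>x. s x *\<^sub>R (a /\<^sub>R norm a)) has_derivative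
        (\<lambda>v. (cos (a \<bullet> (x - z)) * (a \<bullet> v)) *\<^sub>R (a /\<^sub>R norm a))) (at x)"
      unfolding s_def by (auto intro!: derivative_eq_intros)
    have "(\<phi> has_derivative (\<lambda>v. (cos (a \<bullet> (x - z)) * (a \<bullet> v)) *\<^sub>R (a /\<^sub>R norm a))) (at x)"
      by (rule has_derivative_transform_within_open[OF d, of "ball 0 R"])
        (use R that \<eta>(2) in \<open>auto simp: \<phi>_def\<close>)
    then have "frechet_derivative \<phi> (at x) = (\<lambda>v. (cos (a \<bullet> (x - z)) * (a \<bullet> v)) *\<^sub>R (a /\<^sub>R norm a))"
      using frechet_derivative_at by metis
    then have "divergence \<phi> x = (\<Sum>i\<in>Basis. (cos (a \<bullet> (x - z)) / norm a) * ((a \<bullet> i) * (a \<bullet> i)))"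
      by (simp add: divergence_def field_simps)
    also have "\<dots> = (cos (a \<bullet> (x - z)) / norm a) * (a \<bullet> a)"
      by (simp add: euclidean_inner[of a a] sum_distrib_left)
    also have "\<dots> = cos (a \<bullet> (x - z)) * norm a"
      using False by (simp add: dot_square_norm power2_eq_square)
    finally show ?thesis .
  qed
  have fin: "emeasure lborel A < \<infinity>"
    using emeasure_bounded_finite[OF assms(2)] by (simp add: less_top)
  have "cos 1 * norm a * measure lborel A = (\<integral>x. indicator A x * (cos 1 * norm a) \<partial>lborel)"
    by simp
  also have "\<dots> \<le> (\<integral>x. indicator A x * divergence \<phi> x \<partial>lborel)"
  proof (rule integral_mono)
    show "integrable lborel (\<lambda>x. indicator A x * (cos 1 * norm a))"
      using fin by (intro integrable_mult_left integrable_real_indicator) auto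
    show "integrable lborel (\<lambda>x. indicator A x * divergence \<phi> x)"
      using integrable_divergence[OF \<phi> supp] by (intro integrable_mult_indicator[where 'b=real, simplified]) auto
    show "indicator A x * (cos 1 * norm a) \<le> indicator A x * divergence \<phi> x" for x
    proof (cases "x \<in> A")
      case True
      have "cos 1 \<le> cos \<bar>a \<bullet> (x - z)\<bar>"
        using slab[OF True] pi_gt3 by (intro cos_monotone_0_pi_le) auto
      then have "cos 1 \<le> cos (a \<bullet> (x - z))"
        by simp
      then show ?thesis
        using True div[OF True] by (simp add: mult_right_mono)
    qed simp
  qed
  also have "ereal \<dots> \<le> perimeter A"
    by (rule perimeter_geI[OF A \<phi> supp bd])
  finally show ?thesis by simp
qed

section \<open>Perimeter: monotonicity on convex sets\<close>

text \<open>A smooth decreasing step: \<open>logistic (k (\<nu> \<bullet> x - c))\<close> tends to the indicator of a half-space as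
  \<open>k\<close> grows.\<close>

definition logistic :: "real \<Rightarrow> real" where
  "logistic s = 1 / (1 + exp s)"

lemma logistic_has_derivative:
  "(logistic has_real_derivative - (logistic s * (1 - logistic s))) (at s)"
proof -
  have "1 + exp s \<noteq> 0"
    by (smt (verit) exp_gt_zero)
  then show ?thesis
    unfolding logistic_def[abs_def]
    by (auto intro!: derivative_eq_intros simp: field_simps power2_eq_square)
qed

lemma logistic_bounds: "0 < logistic s" "logistic s < 1"
  by (auto simp: logistic_def field_simps add_pos_pos)

lemma logistic_at_top: "(logistic \<longlongrightarrow> 0) at_top"
proof -
  have "filterlim (\<lambda>s. 1 + exp s :: real) at_top at_top"
    by (rule filterlim_tendsto_add_at_top[OF tendsto_const exp_at_top])
  then have "((\<lambda>s. inverse (1 + exp s :: real)) \<longlongrightarrow> 0) at_top"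
    by (rule tendsto_inverse_0_at_top)
  then show ?thesis
    by (simp add: logistic_def[abs_def] inverse_eq_divide)
qed

lemma logistic_at_bot: "(logistic \<longlongrightarrow> 1) at_bot"
proof -
  have "((\<lambda>s. 1 / (1 + exp s :: real)) \<longlongrightarrow> 1 / (1 + 0)) at_bot"
    by (intro tendsto_intros exp_at_bot) auto
  then show ?thesis
    by (simp add: logistic_def[abs_def])
qed

text \<open>Let \<open>\<theta>\<close> be a smoothed indicator of the half-space. The convex combination
  \<open>\<theta> \<phi> + (1 - \<theta>) \<nu>\<close> of a test field and the outer normal is again bounded by 1, and its
  divergence is \<open>\<theta> div \<phi> + \<nabla>\<theta> \<bullet> (\<phi> - \<nu>)\<close>. The last term is nonnegative: \<open>\<nabla>\<theta>\<close> is a nonpositive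
  multiple of \<open>\<nu>\<close>, and \<open>\<nu> \<bullet> \<phi> \<le> 1 = \<nu> \<bullet> \<nu>\<close>. So \<open>\<integral>\<^sub>B \<theta> div \<phi>\<close> is at most the perimeter of \<open>B\<close>,
  and \<open>\<theta>\<close> may tend to the indicator.\<close>

lemma perimeter_Int_halfspace_le_unit:
  fixes B :: "'a::euclidean_space set"
  assumes B [measurable]: "B \<in> sets borel" and "bounded B" and \<nu>: "norm \<nu> = 1"
  shows "perimeter (B \<inter> {x. \<nu> \<bullet> x \<le> c}) \<le> perimeter B"
proof (rule perimeter_leI)
  have H [measurable]: "{x. \<nu> \<bullet> x \<le> c} \<in> sets borel"
    by (intro borel_closed closed_halfspace_le)
  show "B \<inter> {x. \<nu> \<bullet> x \<le> c} \<in> sets borel"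
    by measurable
  fix \<phi> :: "'a \<Rightarrow> 'a"
  assume \<phi>: "C_k 1 \<phi>" "compact (supp \<phi>)" "\<And>x. norm (\<phi> x) \<le> 1"
  obtain R where R: "0 < R" "B \<subseteq> ball 0 R"
    using bounded_subset_ballD[OF assms(2), of 0] by auto
  obtain \<eta> :: "'a \<Rightarrow> real" where \<eta>: "C_k 1 \<eta>" "\<And>x. norm x \<le> R \<Longrightarrow> \<eta> x = 1"
      "\<And>x. norm x \<ge> 2 * R \<Longrightarrow> \<eta> x = 0" "\<And>x. 0 \<le> \<eta> x" "\<And>x. \<eta> x \<le> 1"
    using C_1_cutoff[OF R(1), where 'a='a] by metis
  obtain S where S: "0 < S" "supp \<phi> \<subseteq> cball 0 S"
    using compact_supp_subset_cball[OF \<phi>(2)] by blast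
  \<comment> \<open>The cut-off \<open>\<eta>\<close> makes the constant field \<open>\<nu>\<close> compactly supported without changing it near \<open>B\<close>.\<close>
  define \<theta> where "\<theta> k x = logistic (k * (\<nu> \<bullet> x - c))" for k x
  define \<psi> where "\<psi> k x = \<theta> k x *\<^sub>R \<phi> x + ((1 - \<theta> k x) * \<eta> x) *\<^sub>R \<nu>" for k x
  have \<theta>_d: "(\<theta> k has_derivative (\<lambda>v. - (\<theta> k x * (1 - \<theta> k x)) * (k * (\<nu> \<bullet> v)))) (at x)" for k x
    unfolding \<theta>_def[abs_def]
    by (rule has_derivative_compose[OF _ logistic_has_derivative[unfolded has_field_derivative_def]])
      (auto intro!: derivative_eq_intros)
  have \<theta>_C: "C_k 1 (\<theta> k)" for k
    unfolding \<theta>_def[abs_def]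
  proof (rule C_1_real_compose[OF logistic_has_derivative])
    have "continuous_on UNIV logistic"
      using logistic_has_derivative by (meson DERIV_isCont continuous_at_imp_continuous_on)
    then show "continuous_on UNIV (\<lambda>s. - (logistic s * (1 - logistic s)))"
      by (intro continuous_intros)
  qed (intro C_k_mult C_k_inner C_k_diff C_k_const C_k_bounded_linear[OF bounded_linear_ident])
  have \<theta>01: "0 < \<theta> k x" "\<theta> k x < 1" for k x
    by (auto simp: \<theta>_def logistic_bounds)
  have \<psi>_C: "C_k 1 (\<psi> k)" for k
    unfolding \<psi>_def[abs_def]
    by (intro C_k_add C_k_scaleR C_k_mult C_k_diff C_k_const \<theta>_C \<phi> \<eta>)
  have \<psi>_supp: "compact (supp (\<psi> k))" for k
  proof (rule compact_supp_minimal[OF compact_cball[of 0 "max S (2*R)"]])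
    fix x :: 'a assume "x \<notin> cball 0 (max S (2*R))"
    then have "norm x \<ge> 2 * R" "x \<notin> supp \<phi>"
      using S by auto
    then show "\<psi> k x = 0"
      by (simp add: \<psi>_def \<eta>(3) notin_supp_imp_zero)
  qed
  have \<psi>_norm: "norm (\<psi> k x) \<le> 1" for k x
  proof -
    have "norm (\<psi> k x) \<le> \<theta> k x * norm (\<phi> x) + (1 - \<theta> k x) * \<eta> x"
      unfolding \<psi>_def using \<theta>01[of k x] \<eta>(4)[of x] \<nu>
      by (intro norm_triangle_le) (simp add: abs_mult)
    also have "\<dots> \<le> \<theta> k x * 1 + (1 - \<theta> k x) * 1"
      using \<theta>01[of k x] \<phi>(3) \<eta>(5) by (intro add_mono mult_left_mono) auto
    finally show ?thesis by simp
  qed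
  have div: "\<theta> k x * divergence \<phi> x \<le> divergence (\<psi> k) x" if "x \<in> B" "0 \<le> k" for k x
  proof -
    \<comment> \<open>The gradient of \<open>\<theta> k\<close> is \<open>- m \<nu>\<close>.\<close>
    define m where "m = \<theta> k x * (1 - \<theta> k x) * k"
    have m: "0 \<le> m"
      using \<theta>01[of k x] that by (simp add: m_def)
    have d: "((\<lambda>x. \<theta> k x *\<^sub>R \<phi> x + (1 - \<theta> k x) *\<^sub>R \<nu>) has_derivative
        (\<lambda>v. \<theta> k x *\<^sub>R frechet_derivative \<phi> (at x) v - (m * (\<nu> \<bullet> v)) *\<^sub>R (\<phi> x - \<nu>))) (at x)"
      by (rule derivative_eq_intros \<theta>_d C_1_has_derivative \<phi> refl)+
        (auto simp: fun_eq_iff m_def algebra_simps)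
    have "(\<psi> k has_derivative
        (\<lambda>v. \<theta> k x *\<^sub>R frechet_derivative \<phi> (at x) v - (m * (\<nu> \<bullet> v)) *\<^sub>R (\<phi> x - \<nu>))) (at x)"
      by (rule has_derivative_transform_within_open[OF d, of "ball 0 R"])
        (use R that \<eta>(2) in \<open>auto simp: \<psi>_def\<close>)
    then have "frechet_derivative (\<psi> k) (at x) =
        (\<lambda>v. \<theta> k x *\<^sub>R frechet_derivative \<phi> (at x) v - (m * (\<nu> \<bullet> v)) *\<^sub>R (\<phi> x - \<nu>))"
      using frechet_derivative_at by metis
    then have "divergence (\<psi> k) x = \<theta> k x * divergence \<phi> x - m * (\<Sum>i\<in>Basis. (\<nu> \<bullet> i) * ((\<phi> x - \<nu>) \<bullet> i))"
      by (simp add: divergence_def inner_diff_left sum_subtractf sum_distrib_left mult.assoc)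
    also have "(\<Sum>i\<in>Basis. (\<nu> \<bullet> i) * ((\<phi> x - \<nu>) \<bullet> i)) = \<nu> \<bullet> (\<phi> x - \<nu>)"
      by (rule euclidean_inner[symmetric])
    also have "\<dots> = \<nu> \<bullet> \<phi> x - 1"
      using \<nu> by (simp add: inner_diff_right dot_square_norm)
    finally have eq: "divergence (\<psi> k) x = \<theta> k x * divergence \<phi> x - m * (\<nu> \<bullet> \<phi> x - 1)" .
    have "\<nu> \<bullet> \<phi> x \<le> 1"
      using norm_cauchy_schwarz[of \<nu> "\<phi> x"] \<nu> \<phi>(3)[of x] by simp
    then show ?thesis
      using m eq by (simp add: mult_nonneg_nonpos)
  qed
  have idiv: "integrable lborel (\<lambda>x. indicator B x * divergence \<phi> x)"
    using integrable_divergence[OF \<phi>(1,2)] by (intro integrable_mult_indicator[where 'b=real, simplified]) auto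
  have [measurable]: "divergence \<phi> \<in> borel_measurable borel"
    by (intro borel_measurable_continuous_onI divergence_continuous \<phi>)
  have [measurable]: "\<theta> k \<in> borel_measurable borel" for k
    by (intro borel_measurable_continuous_onI C_k_imp_continuous[OF \<theta>_C])
  have bound: "norm (indicator B x * (\<theta> k x * divergence \<phi> x)) \<le> norm (indicator B x * divergence \<phi> x)" for k x
    using \<theta>01[of k x] mult_right_mono[of "\<theta> k x" 1 "\<bar>divergence \<phi> x\<bar>"]
    by (auto simp: indicator_def abs_mult)
  have le: "ereal (\<integral>x. indicator B x * (\<theta> (real k) x * divergence \<phi> x) \<partial>lborel) \<le> perimeter B" for k :: nat
  proof -
    have "(\<integral>x. indicator B x * (\<theta> (real k) x * divergence \<phi> x) \<partial>lborel)
        \<le> (\<integral>x. indicator B x * divergence (\<psi> (real k)) x \<partial>lborel)"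
    proof (rule integral_mono)
      show "integrable lborel (\<lambda>x. indicator B x * (\<theta> (real k) x * divergence \<phi> x))"
        by (rule Bochner_Integration.integrable_bound[OF idiv]) (use bound in auto)
      show "integrable lborel (\<lambda>x. indicator B x * divergence (\<psi> (real k)) x)"
        using integrable_divergence[OF \<psi>_C \<psi>_supp] by (intro integrable_mult_indicator[where 'b=real, simplified]) auto
      show "indicator B x * (\<theta> (real k) x * divergence \<phi> x) \<le> indicator B x * divergence (\<psi> (real k)) x" for x
        using div[of x "real k"] by (cases "x \<in> B") auto
    qed
    also have "ereal \<dots> \<le> perimeter B"
      by (rule perimeter_geI[OF B \<psi>_C \<psi>_supp \<psi>_norm])
    finally show ?thesis by simp
  qed
  have lim: "(\<lambda>k. \<integral>x. indicator B x * (\<theta> (real k) x * divergence \<phi> x) \<partial>lborel)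
      \<longlonglongrightarrow> (\<integral>x. indicator (B \<inter> {x. \<nu> \<bullet> x \<le> c}) x * divergence \<phi> x \<partial>lborel)"
  proof (rule integral_dominated_convergence[where w="\<lambda>x. norm (indicator B x * divergence \<phi> x)"])
    \<comment> \<open>On the boundary hyperplane the steps have the wrong limit 1/2, but it is a null set.\<close>
    have "{x. \<nu> \<bullet> x = c} \<in> null_sets lebesgue"
      using negligible_hyperplane[of \<nu> c] \<nu> by (cases "\<nu> = 0") (auto simp: negligible_iff_null_sets)
    moreover have "{x. \<nu> \<bullet> x = c} \<in> sets lborel"
      by (simp add: closed_hyperplane)
    ultimately have "{x. \<nu> \<bullet> x = c} \<in> null_sets lborel"
      by (auto simp: null_sets_def)
    then show "AE x in lborel. (\<lambda>k. indicator B x * (\<theta> (real k) x * divergence \<phi> x))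
        \<longlonglongrightarrow> indicator (B \<inter> {x. \<nu> \<bullet> x \<le> c}) x * divergence \<phi> x"
    proof (rule AE_I', safe, goal_cases)
      case (1 x)
      have "\<nu> \<bullet> x = c"
      proof (rule ccontr)
        assume "\<nu> \<bullet> x \<noteq> c"
        then consider "\<nu> \<bullet> x - c < 0" | "\<nu> \<bullet> x - c > 0"
          by linarith
        then have "(\<lambda>k. \<theta> (real k) x) \<longlonglongrightarrow> indicator {x. \<nu> \<bullet> x \<le> c} x"
        proof cases
          case 1
          have "filterlim (\<lambda>k. (\<nu> \<bullet> x - c) * real k) at_bot sequentially"
            by (rule filterlim_tendsto_neg_mult_at_bot[OF tendsto_const 1 filterlim_real_sequentially])
          then have "(\<lambda>k. \<theta> (real k) x) \<longlonglongrightarrow> 1"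
            unfolding \<theta>_def mult.commute[of "real _"] by (rule filterlim_compose[OF logistic_at_bot])
          then show ?thesis
            using 1 by simp
        next
          case 2
          have "filterlim (\<lambda>k. (\<nu> \<bullet> x - c) * real k) at_top sequentially"
            by (rule filterlim_tendsto_pos_mult_at_top[OF tendsto_const 2 filterlim_real_sequentially])
          then have "(\<lambda>k. \<theta> (real k) x) \<longlonglongrightarrow> 0"
            unfolding \<theta>_def mult.commute[of "real _"] by (rule filterlim_compose[OF logistic_at_top])
          then show ?thesis
            using 2 by simp
        qed
        then have "(\<lambda>k. indicator B x * (\<theta> (real k) x * divergence \<phi> x))
            \<longlonglongrightarrow> indicator B x * (indicator {x. \<nu> \<bullet> x \<le> c} x * divergence \<phi> x)"
          by (intro tendsto_intros)
        with 1 show False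
          by (simp add: indicator_inter_arith mult.assoc)
      qed
      then show ?case by simp
    qed
  qed (use idiv bound in auto)
  show "ereal (\<integral>x. indicator (B \<inter> {x. \<nu> \<bullet> x \<le> c}) x * divergence \<phi> x \<partial>lborel) \<le> perimeter B"
    by (rule LIMSEQ_le_const2[OF tendsto_ereal[OF lim]]) (use le in auto)
qed

lemma perimeter_Int_halfspace_le:
  fixes B :: "'a::euclidean_space set"
  assumes "B \<in> sets borel" "bounded B"
  shows "perimeter (B \<inter> {x. a \<bullet> x \<le> b}) \<le> perimeter B"
proof (cases "a = 0")
  case True
  show ?thesis
  proof (cases "0 \<le> b")
    case False
    then have "perimeter (B \<inter> {x. a \<bullet> x \<le> b}) \<le> 0"
      using True by (intro perimeter_leI) (auto simp: zero_ereal_def)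
    then show ?thesis
      using perimeter_nonneg[OF assms(1)] by simp
  qed (simp add: True)
next
  case False
  have "{x. a \<bullet> x \<le> b} = {x. (a /\<^sub>R norm a) \<bullet> x \<le> b / norm a}"
    using False by (auto simp: field_simps)
  moreover have "norm (a /\<^sub>R norm a) = 1"
    using False by simp
  ultimately show ?thesis
    using perimeter_Int_halfspace_le_unit[OF assms, of "a /\<^sub>R norm a" "b / norm a"] by (simp only:)
qed

text \<open>The complements of the closed half-spaces around \<open>C\<close> form an open cover of the complement of \<open>C\<close>, of
  which countably many suffice.\<close>

lemma closed_convex_countable_halfspaces:
  fixes C :: "'a::euclidean_space set"
  assumes "closed C" "convex C"
  obtains a :: "nat \<Rightarrow> 'a" and b where "C = (\<Inter>n. {x. a n \<bullet> x \<le> b n})"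
proof -
  let ?F = "{h. C \<subseteq> h \<and> (\<exists>a b. h = {x. a \<bullet> x \<le> b})}"
  have op: "\<And>S. S \<in> uminus ` ?F \<Longrightarrow> open S"
    by (auto simp: open_closed closed_halfspace_le)
  obtain F' where F': "F' \<subseteq> uminus ` ?F" "countable F'" "\<Union>F' = \<Union>(uminus ` ?F)"
    by (rule Lindelof[OF op])
  let ?G = "insert UNIV (uminus ` F')"
  have "C = \<Inter>?F"
    by (rule convex_halfspace_intersection[OF assms])
  also have "\<dots> = - \<Union>(uminus ` ?F)"
    by auto
  also have "\<dots> = - \<Union>F'"
    by (simp add: F'(3))
  also have "\<dots> = \<Inter>?G"
    by auto
  finally have C: "C = \<Inter>?G" .
  have G: "countable ?G" "?G \<noteq> {}"
    using F'(2) by auto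
  then have r: "range (from_nat_into ?G) = ?G"
    by (simp add: range_from_nat_into)
  have half: "\<exists>a b. h = {x. a \<bullet> x \<le> b}" if "h \<in> ?G" for h
  proof (cases "h = UNIV")
    case True
    then show ?thesis
      by (intro exI[of _ 0]) auto
  next
    case False
    with that obtain g where "g \<in> F'" "h = - g"
      by auto
    from F'(1) \<open>g \<in> F'\<close> have "g \<in> uminus ` ?F"
      by blast
    then obtain f where "f \<in> ?F" "g = - f"
      by (rule imageE)
    with \<open>h = - g\<close> show ?thesis
      by auto
  qed
  have "\<exists>a b. from_nat_into ?G n = {x. a \<bullet> x \<le> b}" for n
    using half[OF from_nat_into[OF G(2)]] .
  then obtain a b where ab: "\<And>n. from_nat_into ?G n = {x. a n \<bullet> x \<le> b n}"
    by metis
  have "C = (\<Inter>n. from_nat_into ?G n)"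
    unfolding r by (rule C)
  also have "\<dots> = (\<Inter>n. {x. a n \<bullet> x \<le> b n})"
    by (simp only: ab)
  finally show ?thesis
    by (rule that)
qed

text \<open>Cut \<open>B\<close> successively with the half-spaces whose intersection is the closure of \<open>A\<close>. No cut increases
  the perimeter, the sets converge to \<open>A\<close> up to its frontier, which is a null set, and the perimeter
  is lower semicontinuous as a supremum.\<close>

lemma perimeter_convex_mono:
  fixes A B :: "'a::euclidean_space set"
  assumes "open A" "convex A" and B [measurable]: "B \<in> sets borel" and "bounded B" "A \<subseteq> B"
  shows "perimeter A \<le> perimeter B"
proof (rule perimeter_leI)
  show A [measurable]: "A \<in> sets borel"
    using assms(1) by simp
  fix \<phi> :: "'a \<Rightarrow> 'a"
  assume \<phi>: "C_k 1 \<phi>" "compact (supp \<phi>)" "\<And>x. norm (\<phi> x) \<le> 1"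
  obtain a :: "nat \<Rightarrow> 'a" and b where ab: "closure A = (\<Inter>n. {x. a n \<bullet> x \<le> b n})"
    using closed_convex_countable_halfspaces[OF closed_closure convex_closure[OF assms(2)]] .
  define D where "D n = B \<inter> (\<Inter>k<n. {x. a k \<bullet> x \<le> b k})" for n
  have H: "{x. a k \<bullet> x \<le> b k} \<in> sets borel" for k
    by (intro borel_closed closed_halfspace_le)
  have D_Suc: "D (Suc n) = D n \<inter> {x. a n \<bullet> x \<le> b n}" for n
    by (auto simp: D_def lessThan_Suc)
  have D [measurable]: "D n \<in> sets borel" for n
    by (induction n) (auto simp: D_Suc H, simp add: D_def)
  have "bounded (D n)" for n
    using assms(4) by (rule bounded_subset) (auto simp: D_def)
  then have PD: "perimeter (D n) \<le> perimeter B" for n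
  proof (induction n)
    case (Suc n)
    then show ?case
      using perimeter_Int_halfspace_le[OF D, of n "a n" "b n"] by (auto simp: D_Suc)
  qed (simp add: D_def)
  have [measurable]: "divergence \<phi> \<in> borel_measurable borel"
    by (intro borel_measurable_continuous_onI divergence_continuous \<phi>)
  have lim: "(\<lambda>n. \<integral>x. indicator (D n) x * divergence \<phi> x \<partial>lborel)
      \<longlonglongrightarrow> (\<integral>x. indicator A x * divergence \<phi> x \<partial>lborel)"
  proof (rule integral_dominated_convergence[where w="\<lambda>x. norm (divergence \<phi> x)"])
    have "frontier A \<in> null_sets lebesgue"
      using negligible_convex_frontier[OF assms(2)] by (simp add: negligible_iff_null_sets)
    then have "frontier A \<in> null_sets lborel"
      by (auto simp: null_sets_def)
    then show "AE x in lborel. (\<lambda>n. indicator (D n) x * divergence \<phi> x) \<longlonglongrightarrow> indicator A x * divergence \<phi> x"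
    proof (rule AE_I', safe, goal_cases)
      case (1 x)
      show ?case
      proof (rule ccontr)
        assume "x \<notin> frontier A"
        then consider "x \<in> A" | "x \<notin> closure A"
          using assms(1) by (auto simp: frontier_def interior_open)
        then have "\<forall>\<^sub>F n in sequentially. indicator (D n) x * divergence \<phi> x = indicator A x * divergence \<phi> x"
        proof cases
          case 1
          then have "x \<in> closure A"
            using closure_subset by auto
          then have "x \<in> D n" for n
            using 1 assms(5) unfolding ab by (auto simp: D_def)
          then show ?thesis
            using 1 by simp
        next
          case 2
          then obtain m where m: "\<not> a m \<bullet> x \<le> b m"
            unfolding ab by auto
          have "x \<notin> A"
            using 2 closure_subset by auto
          moreover have "x \<notin> D n" if "n \<ge> Suc m" for n
            using m that by (auto simp: D_def)
          ultimately show ?thesis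
            by (auto simp: eventually_sequentially intro!: exI[of _ "Suc m"])
        qed
        then have "(\<lambda>n. indicator (D n) x * divergence \<phi> x) \<longlonglongrightarrow> indicator A x * divergence \<phi> x"
          by (rule tendsto_eventually)
        with 1(3) show False by (rule notE)
      qed
    qed
    show "integrable lborel (\<lambda>x. norm (divergence \<phi> x))"
      using integrable_divergence[OF \<phi>(1,2)] by simp
    show "AE x in lborel. norm (indicator (D n) x * divergence \<phi> x) \<le> norm (divergence \<phi> x)" for n
      by (rule AE_I2) (auto simp: indicator_def)
  qed measurable
  have "ereal (\<integral>x. indicator (D n) x * divergence \<phi> x \<partial>lborel) \<le> perimeter B" for n
    using perimeter_geI[OF D[of n] \<phi>] PD[of n] by (rule order_trans)
  then show "ereal (\<integral>x. indicator A x * divergence \<phi> x \<partial>lborel) \<le> perimeter B"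
    by (intro LIMSEQ_le_const2[OF tendsto_ereal[OF lim]]) auto
qed



section \<open>Square integrable functions\<close>

text \<open>Membership in \<open>L\<^sup>2\<close> over an arbitrary measure, so that the Hilbert space arguments need not
  mention restrictions of Lebesgue measure.\<close>

definition sq_int :: "'a measure \<Rightarrow> ('a \<Rightarrow> 'b::euclidean_space) \<Rightarrow> bool" where
  "sq_int M f \<longleftrightarrow> f \<in> borel_measurable M \<and> integrable M (\<lambda>x. (norm (f x))\<^sup>2)"

lemma sq_int_measurable: "sq_int M f \<Longrightarrow> f \<in> borel_measurable M"
  and sq_int_integrable: "sq_int M f \<Longrightarrow> integrable M (\<lambda>x. (norm (f x))\<^sup>2)"
  by (auto simp: sq_int_def)

lemma sq_int_inner_integrable:
  assumes "sq_int M f" "sq_int M g"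
  shows "integrable M (\<lambda>x. f x \<bullet> g x)"
proof (rule Bochner_Integration.integrable_bound)
  show "integrable M (\<lambda>x. (norm (f x))\<^sup>2 + (norm (g x))\<^sup>2)"
    using assms by (intro Bochner_Integration.integrable_add sq_int_integrable)
  show "(\<lambda>x. f x \<bullet> g x) \<in> borel_measurable M"
    using assms by (intro borel_measurable_inner sq_int_measurable)
  have "\<bar>f x \<bullet> g x\<bar> \<le> (norm (f x))\<^sup>2 + (norm (g x))\<^sup>2" for x
  proof -
    have "2 * (norm (f x) * norm (g x)) \<le> (norm (f x))\<^sup>2 + (norm (g x))\<^sup>2"
      using sum_squares_bound[of "norm (f x)" "norm (g x)"] by simp
    moreover have "0 \<le> norm (f x) * norm (g x)"
      by simp
    ultimately show ?thesis
      using Cauchy_Schwarz_ineq2[of "f x" "g x"] by linarith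
  qed
  then show "AE x in M. norm (f x \<bullet> g x) \<le> norm ((norm (f x))\<^sup>2 + (norm (g x))\<^sup>2)"
    by simp
qed

lemma sq_int_scaleR: "sq_int M f \<Longrightarrow> sq_int M (\<lambda>x. c *\<^sub>R f x)"
  by (auto simp: sq_int_def power_mult_distrib)

lemma sq_int_add:
  assumes "sq_int M f" "sq_int M g"
  shows "sq_int M (\<lambda>x. f x + g x)"
proof -
  have eq: "(norm (f x + g x))\<^sup>2 = (norm (f x))\<^sup>2 + 2 * (f x \<bullet> g x) + (norm (g x))\<^sup>2" for x
    by (simp add: power2_norm_eq_inner inner_add_left inner_add_right inner_commute)
  show ?thesis
    unfolding sq_int_def eq using assms
    by (intro conjI borel_measurable_add Bochner_Integration.integrable_add integrable_mult_right
          sq_int_inner_integrable sq_int_measurable sq_int_integrable)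
qed

lemma sq_int_diff: "sq_int M f \<Longrightarrow> sq_int M g \<Longrightarrow> sq_int M (\<lambda>x. f x - g x)"
  using sq_int_add[of M f "\<lambda>x. (-1) *\<^sub>R g x"] sq_int_scaleR[of M g "-1"] by simp

lemma integral_sq_norm_expand:
  assumes "sq_int M f" "sq_int M g"
  shows "(\<integral>x. (norm (f x + t *\<^sub>R g x))\<^sup>2 \<partial>M) =
    (\<integral>x. (norm (f x))\<^sup>2 \<partial>M) + 2 * t * (\<integral>x. f x \<bullet> g x \<partial>M) + t\<^sup>2 * (\<integral>x. (norm (g x))\<^sup>2 \<partial>M)"
proof -
  have eq: "(norm (f x + t *\<^sub>R g x))\<^sup>2 = (norm (f x))\<^sup>2 + ((2 * t) * (f x \<bullet> g x) + t\<^sup>2 * (norm (g x))\<^sup>2)" for x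
    by (simp add: power2_norm_eq_inner inner_add_left inner_add_right inner_commute
        power2_eq_square[of t] algebra_simps)
  show ?thesis
    unfolding eq
    using sq_int_inner_integrable[OF assms] sq_int_integrable[OF assms(1)] sq_int_integrable[OF assms(2)]
    by (simp add: Bochner_Integration.integral_add)
qed

lemma quadratic_nonneg_imp_discriminant:
  assumes "\<And>t::real. 0 \<le> a + 2 * t * b + t\<^sup>2 * c" "0 \<le> c"
  shows "b\<^sup>2 \<le> a * c"
proof (cases "c = 0")
  case True
  have "b = 0"
  proof (rule ccontr)
    assume "b \<noteq> 0"
    then show False
      using assms(1)[of "- (a + 1) / (2 * b)"] True by (simp add: field_simps)
  qed
  then show ?thesis
    using True by simp
next
  case False
  have "0 \<le> a + 2 * (- b / c) * b + (- b / c)\<^sup>2 * c"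
    by (rule assms(1))
  also have "\<dots> = (a * c - b\<^sup>2) / c"
    using False by (simp add: field_simps power2_eq_square)
  finally show ?thesis
    using False assms(2) by (simp add: zero_le_divide_iff)
qed

lemma Cauchy_Schwarz_integral:
  assumes "sq_int M f" "sq_int M g"
  shows "(\<integral>x. f x \<bullet> g x \<partial>M)\<^sup>2 \<le> (\<integral>x. (norm (f x))\<^sup>2 \<partial>M) * (\<integral>x. (norm (g x))\<^sup>2 \<partial>M)"
proof (rule quadratic_nonneg_imp_discriminant)
  fix t :: real
  have "0 \<le> (\<integral>x. (norm (f x + t *\<^sub>R g x))\<^sup>2 \<partial>M)"
    by simp
  then show "0 \<le> (\<integral>x. (norm (f x))\<^sup>2 \<partial>M) + 2 * t * (\<integral>x. f x \<bullet> g x \<partial>M) + t\<^sup>2 * (\<integral>x. (norm (g x))\<^sup>2 \<partial>M)"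
    by (simp only: integral_sq_norm_expand[OF assms])
qed simp

lemma L2_tendsto_inner:
  assumes "\<And>n. sq_int M (h n)" "sq_int M h'" "sq_int M k"
    and lim: "(\<lambda>n. \<integral>x. (norm (h n x - h' x))\<^sup>2 \<partial>M) \<longlonglongrightarrow> 0"
  shows "(\<lambda>n. \<integral>x. h n x \<bullet> k x \<partial>M) \<longlonglongrightarrow> (\<integral>x. h' x \<bullet> k x \<partial>M)"
proof -
  let ?K = "\<integral>x. (norm (k x))\<^sup>2 \<partial>M"
  have "(\<lambda>n. \<bar>(\<integral>x. h n x \<bullet> k x \<partial>M) - (\<integral>x. h' x \<bullet> k x \<partial>M)\<bar>) \<longlonglongrightarrow> 0"
  proof (rule tendsto_sandwich[OF _ _ tendsto_const])
    have "(\<lambda>n. sqrt ((\<integral>x. (norm (h n x - h' x))\<^sup>2 \<partial>M) * ?K)) \<longlonglongrightarrow> sqrt (0 * ?K)"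
      by (intro tendsto_intros lim)
    then show "(\<lambda>n. sqrt ((\<integral>x. (norm (h n x - h' x))\<^sup>2 \<partial>M) * ?K)) \<longlonglongrightarrow> 0"
      by simp
    have "\<bar>(\<integral>x. h n x \<bullet> k x \<partial>M) - (\<integral>x. h' x \<bullet> k x \<partial>M)\<bar> \<le> sqrt ((\<integral>x. (norm (h n x - h' x))\<^sup>2 \<partial>M) * ?K)" for n
    proof -
      have "(\<integral>x. h n x \<bullet> k x \<partial>M) - (\<integral>x. h' x \<bullet> k x \<partial>M) = (\<integral>x. (h n x - h' x) \<bullet> k x \<partial>M)"
        using assms by (simp add: inner_diff_left sq_int_inner_integrable)
      then show ?thesis
        using Cauchy_Schwarz_integral[OF sq_int_diff[OF assms(1)[of n] assms(2)] assms(3)]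
        by (intro real_le_rsqrt) simp
    qed
    then show "\<forall>\<^sub>F n in sequentially. \<bar>(\<integral>x. h n x \<bullet> k x \<partial>M) - (\<integral>x. h' x \<bullet> k x \<partial>M)\<bar>
        \<le> sqrt ((\<integral>x. (norm (h n x - h' x))\<^sup>2 \<partial>M) * ?K)"
      by simp
  qed simp
  then show ?thesis
    using LIM_zero_iff tendsto_rabs_zero_iff by blast
qed

text \<open>Expanding \<open>|h n - h'|\<^sup>2\<close> reduces convergence of norms to weak convergence against \<open>h'\<close>.\<close>

lemma L2_tendsto_norm:
  assumes "\<And>n. sq_int M (h n)" "sq_int M h'"
    and lim: "(\<lambda>n. \<integral>x. (norm (h n x - h' x))\<^sup>2 \<partial>M) \<longlonglongrightarrow> 0"
  shows "(\<lambda>n. \<integral>x. (norm (h n x))\<^sup>2 \<partial>M) \<longlonglongrightarrow> (\<integral>x. (norm (h' x))\<^sup>2 \<partial>M)"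
proof -
  have eq: "(\<integral>x. (norm (h n x))\<^sup>2 \<partial>M) = (\<integral>x. (norm (h n x - h' x))\<^sup>2 \<partial>M)
      + 2 * (\<integral>x. h n x \<bullet> h' x \<partial>M) - (\<integral>x. (norm (h' x))\<^sup>2 \<partial>M)" for n
    using integral_sq_norm_expand[OF assms(1)[of n] assms(2), of "-1"] by simp
  have "(\<lambda>n. (\<integral>x. (norm (h n x - h' x))\<^sup>2 \<partial>M) + 2 * (\<integral>x. h n x \<bullet> h' x \<partial>M) - (\<integral>x. (norm (h' x))\<^sup>2 \<partial>M))
      \<longlonglongrightarrow> 0 + 2 * (\<integral>x. h' x \<bullet> h' x \<partial>M) - (\<integral>x. (norm (h' x))\<^sup>2 \<partial>M)"
    by (intro tendsto_intros lim L2_tendsto_inner assms)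
  then show ?thesis
    unfolding eq by (simp add: power2_norm_eq_inner[of "h' _"])
qed

text \<open>On a finite measure space an \<open>L\<^sup>2\<close> Cauchy sequence has a subsequence whose consecutive
  differences are summable in \<open>L\<^sup>1\<close>, hence convergent almost everywhere; Fatou's lemma upgrades
  this to convergence of the whole sequence in \<open>L\<^sup>2\<close>.\<close>

lemma L2_complete:
  fixes f :: "nat \<Rightarrow> 'a \<Rightarrow> 'b::euclidean_space"
  assumes fin: "emeasure M (space M) < \<infinity>"
    and f: "\<And>n. sq_int M (f n)"
    and Cauchy: "\<And>e. 0 < e \<Longrightarrow> \<exists>N. \<forall>m\<ge>N. \<forall>n\<ge>N. (\<integral>x. (norm (f m x - f n x))\<^sup>2 \<partial>M) < e"
  obtains g where "sq_int M g" "(\<lambda>n. \<integral>x. (norm (f n x - g x))\<^sup>2 \<partial>M) \<longlonglongrightarrow> 0"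
proof -
  interpret finite_measure M
    by (rule finite_measureI) (use fin in auto)
  have f_meas [measurable]: "f n \<in> borel_measurable M" for n
    using f by (rule sq_int_measurable)
  have "\<forall>k. \<exists>N. \<forall>m\<ge>N. \<forall>n\<ge>N. (\<integral>x. (norm (f m x - f n x))\<^sup>2 \<partial>M) < (1/4) ^ k"
    by (intro allI Cauchy) simp
  from choice[OF this] obtain N where
    N: "\<And>k m n. m \<ge> N k \<Longrightarrow> n \<ge> N k \<Longrightarrow> (\<integral>x. (norm (f m x - f n x))\<^sup>2 \<partial>M) < (1/4) ^ k"
    by blast
  \<comment> \<open>Summing the thresholds makes \<open>r\<close> monotone, the term \<open>k\<close> makes it unbounded.\<close>
  define r where "r k = k + (\<Sum>i\<le>k. N i)" for k
  have r_N: "N k \<le> r k" for k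
    unfolding r_def by (intro trans_le_add2 member_le_sum) auto
  have r_mono: "r k \<le> r (Suc k)" for k
    by (simp add: r_def)
  have r_ge: "k \<le> r k" for k
    by (simp add: r_def)
  define d where "d k x = norm (f (r (Suc k)) x - f (r k) x)" for k x
  have d_sq: "sq_int M (d k)" for k
    using sq_int_diff[OF f f, of "r (Suc k)" "r k"] unfolding d_def[abs_def] sq_int_def by simp
  have one: "sq_int M (\<lambda>_. 1::real)"
    by (simp add: sq_int_def)
  have d_int: "integrable M (d k)" for k
    using sq_int_inner_integrable[OF d_sq one, of k] by simp
  have d_le: "(\<integral>x. d k x \<partial>M) \<le> sqrt (measure M (space M)) * (1/2) ^ k" for k
  proof -
    have "(\<integral>x. (d k x)\<^sup>2 \<partial>M) \<le> (1/4) ^ k"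
      using N[of k "r (Suc k)" "r k"] r_N[of k] r_mono[of k] by (simp add: d_def)
    then have "(\<integral>x. (d k x)\<^sup>2 \<partial>M) * measure M (space M) \<le> (1/4) ^ k * measure M (space M)"
      by (intro mult_right_mono) auto
    also have "\<dots> = (sqrt (measure M (space M)) * (1/2) ^ k)\<^sup>2"
    proof -
      have "((1/2::real) ^ k)\<^sup>2 = ((1/2)\<^sup>2) ^ k"
        by (metis power_mult mult.commute)
      then show ?thesis
        unfolding power_mult_distrib by (simp add: power2_eq_square)
    qed
    finally have "(\<integral>x. d k x \<partial>M)\<^sup>2 \<le> (sqrt (measure M (space M)) * (1/2) ^ k)\<^sup>2"
      using Cauchy_Schwarz_integral[OF d_sq one, of k] by simp
    then show ?thesis
      by (rule power2_le_imp_le) simp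
  qed
  have "(\<integral>\<^sup>+x. (\<Sum>k. ennreal (d k x)) \<partial>M) < \<infinity>"
  proof -
    have "(\<integral>\<^sup>+x. (\<Sum>k. ennreal (d k x)) \<partial>M) = (\<Sum>k. \<integral>\<^sup>+x. ennreal (d k x) \<partial>M)"
      unfolding d_def by (rule nn_integral_suminf) measurable
    also have "\<dots> = (\<Sum>k. ennreal (\<integral>x. d k x \<partial>M))"
      by (intro suminf_cong nn_integral_eq_integral d_int) (simp add: d_def)
    also have "\<dots> \<le> (\<Sum>k. ennreal (sqrt (measure M (space M)) * (1/2) ^ k))"
      by (intro suminf_le ennreal_leI d_le) auto
    also have "\<dots> = ennreal (\<Sum>k. sqrt (measure M (space M)) * (1/2) ^ k)"
      by (intro suminf_ennreal2 summable_mult summable_geometric) auto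
    finally show ?thesis
      by (rule le_less_trans) simp
  qed
  then have "AE x in M. (\<Sum>k. ennreal (d k x)) \<noteq> \<infinity>"
    unfolding d_def by (intro nn_integral_noteq_infinite) auto
  then have AE_conv: "AE x in M. convergent (\<lambda>k. f (r k) x)"
  proof eventually_elim
    case (elim x)
    have "summable (\<lambda>k. norm (f (r (Suc k)) x - f (r k) x))"
      using elim by (intro summable_suminf_not_top) (auto simp: d_def top_unique)
    then have "summable (\<lambda>k. f (r (Suc k)) x - f (r k) x)"
      by (rule summable_norm_cancel)
    then have "convergent (\<lambda>n. \<Sum>k<n. f (r (Suc k)) x - f (r k) x)"
      by (simp add: summable_iff_convergent)
    then have "convergent (\<lambda>n. f (r n) x - f (r 0) x)"
      by (simp add: sum_lessThan_telescope[of "\<lambda>k. f (r k) x"])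
    then have "convergent (\<lambda>n. (f (r n) x - f (r 0) x) + f (r 0) x)"
      by (intro convergent_add convergent_const)
    then show ?case
      by simp
  qed
  define g where "g x = lim (\<lambda>k. f (r k) x)" for x
  have g_meas [measurable]: "g \<in> borel_measurable M"
    unfolding g_def[abs_def] by (rule borel_measurable_lim_metric) measurable
  have AE_lim: "AE x in M. (\<lambda>k. f (r k) x) \<longlonglongrightarrow> g x"
    using AE_conv by eventually_elim (simp add: g_def convergent_LIMSEQ_iff)
  have fatou: "(\<integral>\<^sup>+x. ennreal ((norm (f n x - g x))\<^sup>2) \<partial>M) \<le> ennreal e"
    if e: "0 < e" and n: "\<forall>m\<ge>K. (\<integral>x. (norm (f n x - f m x))\<^sup>2 \<partial>M) < e" for n e K
  proof -
    have "(\<integral>\<^sup>+x. ennreal ((norm (f n x - g x))\<^sup>2) \<partial>M)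
        = (\<integral>\<^sup>+x. liminf (\<lambda>k. ennreal ((norm (f n x - f (r k) x))\<^sup>2)) \<partial>M)"
    proof (rule nn_integral_cong_AE)
      show "AE x in M. ennreal ((norm (f n x - g x))\<^sup>2) = liminf (\<lambda>k. ennreal ((norm (f n x - f (r k) x))\<^sup>2))"
        using AE_lim
      proof eventually_elim
        case (elim x)
        have "(\<lambda>k. ennreal ((norm (f n x - f (r k) x))\<^sup>2)) \<longlonglongrightarrow> ennreal ((norm (f n x - g x))\<^sup>2)"
          by (intro tendsto_ennrealI tendsto_intros elim)
        then show ?case
          by (rule lim_imp_Liminf[symmetric, rotated]) simp
      qed
    qed
    also have "\<dots> \<le> liminf (\<lambda>k. \<integral>\<^sup>+x. ennreal ((norm (f n x - f (r k) x))\<^sup>2) \<partial>M)"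
      by (rule nn_integral_liminf) measurable
    also have "\<dots> \<le> liminf (\<lambda>k. ennreal e)"
    proof (rule Liminf_mono, unfold eventually_sequentially, intro exI allI impI)
      fix k assume "k \<ge> K"
      then have "r k \<ge> K"
        using r_ge[of k] by simp
      then have "(\<integral>x. (norm (f n x - f (r k) x))\<^sup>2 \<partial>M) < e"
        using n by blast
      then show "(\<integral>\<^sup>+x. ennreal ((norm (f n x - f (r k) x))\<^sup>2) \<partial>M) \<le> ennreal e"
        using sq_int_integrable[OF sq_int_diff[OF f f]]
        by (subst nn_integral_eq_integral) (auto intro: ennreal_leI)
    qed
    also have "\<dots> = ennreal e"
      by (simp add: Liminf_const)
    finally show ?thesis .
  qed
  have fg: "sq_int M (\<lambda>x. f n x - g x) \<and> (\<integral>x. (norm (f n x - g x))\<^sup>2 \<partial>M) \<le> e"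
    if e: "0 < e" and n: "\<forall>m\<ge>K. (\<integral>x. (norm (f n x - f m x))\<^sup>2 \<partial>M) < e" for n e K
  proof
    have int: "integrable M (\<lambda>x. (norm (f n x - g x))\<^sup>2)"
      using fatou[OF that] by (intro integrableI_bounded) (auto intro: le_less_trans)
    then show "sq_int M (\<lambda>x. f n x - g x)"
      by (simp add: sq_int_def)
    show "(\<integral>x. (norm (f n x - g x))\<^sup>2 \<partial>M) \<le> e"
      using fatou[OF that] int e by (subst (asm) nn_integral_eq_integral) (auto simp: ennreal_le_iff)
  qed
  show ?thesis
  proof
    obtain K where K: "\<forall>m\<ge>K. \<forall>n\<ge>K. (\<integral>x. (norm (f m x - f n x))\<^sup>2 \<partial>M) < 1"
      using Cauchy[of 1] by auto
    then have "sq_int M (\<lambda>x. f K x - g x)"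
      using fg[of 1 K K] by auto
    then have "sq_int M (\<lambda>x. f K x - (f K x - g x))"
      by (rule sq_int_diff[OF f])
    then show "sq_int M g"
      by simp
    show "(\<lambda>n. \<integral>x. (norm (f n x - g x))\<^sup>2 \<partial>M) \<longlonglongrightarrow> 0"
    proof (rule LIMSEQ_I)
      fix e :: real assume "0 < e"
      then obtain K where K: "\<forall>m\<ge>K. \<forall>n\<ge>K. (\<integral>x. (norm (f m x - f n x))\<^sup>2 \<partial>M) < e / 2"
        using Cauchy[of "e/2"] by auto
      have "norm ((\<integral>x. (norm (f n x - g x))\<^sup>2 \<partial>M) - 0) < e" if "n \<ge> K" for n
        using fg[of "e/2" K n] K that \<open>0 < e\<close> by (auto intro: le_less_trans)
      then show "\<exists>K. \<forall>n\<ge>K. norm ((\<integral>x. (norm (f n x - g x))\<^sup>2 \<partial>M) - 0) < e"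
        by blast
    qed
  qed
qed



section \<open>Energy of test functions\<close>

lemma test_functionsD:
  assumes "\<phi> \<in> test_functions \<Omega>"
  shows "C_k k \<phi>" "compact (supp \<phi>)" "supp \<phi> \<subseteq> \<Omega>"
  using assms by (auto simp: test_functions_def)

lemma gradient_inner:
  assumes "C_k 1 \<phi>"
  shows "gradient \<phi> x \<bullet> v = frechet_derivative \<phi> (at x) v"
proof -
  have lin: "linear (frechet_derivative \<phi> (at x))"
    using assms by (intro linear_frechet_derivative) auto
  have "frechet_derivative \<phi> (at x) v = frechet_derivative \<phi> (at x) (\<Sum>i\<in>Basis. (v \<bullet> i) *\<^sub>R i)"
    by (simp add: euclidean_representation)
  also have "\<dots> = (\<Sum>i\<in>Basis. (v \<bullet> i) * frechet_derivative \<phi> (at x) i)"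
    using lin by (simp add: linear_sum linear_scale)
  finally show ?thesis
    by (simp add: gradient_def inner_sum_right inner_commute[of _ v] mult.commute)
qed

lemma gradient_eqI:
  assumes "(\<phi> has_derivative (\<lambda>v. g \<bullet> v)) (at x)"
  shows "gradient \<phi> x = g"
proof -
  have "frechet_derivative \<phi> (at x) = (\<lambda>v. g \<bullet> v)"
    using frechet_derivative_at[OF assms] by simp
  then show ?thesis
    by (simp add: gradient_def euclidean_representation)
qed

lemma has_derivative_gradient: "C_k 1 \<phi> \<Longrightarrow> (\<phi> has_derivative (\<lambda>v. gradient \<phi> x \<bullet> v)) (at x)"
  using C_1_has_derivative[of \<phi> x] by (simp add: gradient_inner)

lemma gradient_continuous: "C_k 1 \<phi> \<Longrightarrow> continuous_on UNIV (gradient \<phi>)"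
  unfolding gradient_def[abs_def] by (intro continuous_intros C_1_continuous_derivative)

lemma gradient_vanishes: "x \<notin> supp \<phi> \<Longrightarrow> gradient \<phi> x = 0"
  by (simp add: gradient_def C_k_vanishing_derivative)

lemma gradient_add_scaled:
  assumes "C_k 1 \<phi>" "C_k 1 \<psi>"
  shows "gradient (\<lambda>x. \<phi> x + t * \<psi> x) x = gradient \<phi> x + t *\<^sub>R gradient \<psi> x"
  by (rule gradient_eqI)
    (auto intro!: derivative_eq_intros has_derivative_gradient assms simp: inner_add_left)

lemma test_functions_add_scaled:
  assumes "\<phi> \<in> test_functions \<Omega>" "\<psi> \<in> test_functions \<Omega>"
  shows "(\<lambda>x. \<phi> x + t * \<psi> x) \<in> test_functions \<Omega>"
proof -
  note \<phi> = test_functionsD[OF assms(1)] and \<psi> = test_functionsD[OF assms(2)]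
  have 0: "\<phi> x + t * \<psi> x = 0" if "x \<notin> supp \<phi> \<union> supp \<psi>" for x
    using that by (simp add: notin_supp_imp_zero)
  have K: "compact (supp \<phi> \<union> supp \<psi>)"
    using \<phi> \<psi> by auto
  have "supp (\<lambda>x. \<phi> x + t * \<psi> x) \<subseteq> supp \<phi> \<union> supp \<psi>"
    by (rule supp_minimal[OF compact_imp_closed[OF K]]) (rule 0)
  moreover have "compact (supp (\<lambda>x. \<phi> x + t * \<psi> x))"
    by (rule compact_supp_minimal[OF K]) (rule 0)
  ultimately show ?thesis
    using \<phi> \<psi> unfolding test_functions_def by (auto intro!: C_k_add C_k_mult)
qed

lemma test_functions_zero: "(\<lambda>_. 0) \<in> test_functions \<Omega>"
  by (simp add: test_functions_def C_k_zero_supp)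

lemma test_functions_scaled: "\<phi> \<in> test_functions \<Omega> \<Longrightarrow> (\<lambda>x. t * \<phi> x) \<in> test_functions \<Omega>"
  using test_functions_add_scaled[OF test_functions_zero, of \<phi> \<Omega> t] by simp

lemma test_functions_derivative:
  assumes "\<phi> \<in> test_functions \<Omega>"
  shows "(\<lambda>x. frechet_derivative \<phi> (at x) v) \<in> test_functions \<Omega>"
proof -
  note \<phi> = test_functionsD[OF assms]
  have 0: "frechet_derivative \<phi> (at x) v = 0" if "x \<notin> supp \<phi>" for x
    using that by (simp add: C_k_vanishing_derivative)
  have "C_k k (\<lambda>x. frechet_derivative \<phi> (at x) v)" for k
    by (rule C_k_Suc_derivative[OF \<phi>(1)])
  moreover have "supp (\<lambda>x. frechet_derivative \<phi> (at x) v) \<subseteq> supp \<phi>"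
    by (rule supp_minimal[OF compact_imp_closed[OF \<phi>(2)]]) (rule 0)
  moreover have "compact (supp (\<lambda>x. frechet_derivative \<phi> (at x) v))"
    by (rule compact_supp_minimal[OF \<phi>(2)]) (rule 0)
  ultimately show ?thesis
    using \<phi>(3) unfolding test_functions_def by auto
qed

lemma test_functions_mono: "A \<subseteq> B \<Longrightarrow> test_functions A \<subseteq> test_functions B"
  by (auto simp: test_functions_def)

lemma sq_int_continuous:
  fixes f :: "'a::euclidean_space \<Rightarrow> 'b::euclidean_space"
  assumes [measurable]: "\<Omega> \<in> sets borel" and f: "continuous_on UNIV f" "compact K" "\<And>x. x \<notin> K \<Longrightarrow> f x = 0"
  shows "sq_int (lebesgue_on \<Omega>) f"
proof -
  have "f \<in> borel_measurable lebesgue"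
    using borel_measurable_continuous_onI[OF f(1)] by (intro measurable_completion) simp
  then have m: "f \<in> borel_measurable (lebesgue_on \<Omega>)"
    by (rule measurable_restrict_space1)
  have "continuous_on UNIV (\<lambda>x. (norm (f x))\<^sup>2)"
    by (intro continuous_intros f)
  then have "integrable lborel (\<lambda>x. (norm (f x))\<^sup>2)"
    by (rule integrable_C_compact_supp[OF _ f(2)]) (simp add: f(3))
  then have "integrable lebesgue (\<lambda>x. (norm (f x))\<^sup>2)"
    by (subst integrable_completion) auto
  then have "integrable (lebesgue_on \<Omega>) (\<lambda>x. (norm (f x))\<^sup>2)"
    by (subst integrable_restrict_space)
      (auto intro!: integrable_mult_indicator[where 'b=real, simplified])
  with m show ?thesis
    by (simp add: sq_int_def)
qed

lemma integral_lebesgue_on_continuous: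
  fixes f :: "'a::euclidean_space \<Rightarrow> real"
  assumes "\<Omega> \<in> sets borel" "continuous_on UNIV f" "\<And>x. x \<notin> \<Omega> \<Longrightarrow> f x = 0"
  shows "integral\<^sup>L (lebesgue_on \<Omega>) f = integral\<^sup>L lborel f"
proof -
  have "(\<lambda>x. indicator \<Omega> x * f x) = f"
    using assms(3) by (force simp: indicator_def)
  then show ?thesis
    using integral_lebesgue_on_borel[OF assms(1) borel_measurable_continuous_onI[OF assms(2)]] by simp
qed

lemma test_sq_int:
  assumes "\<Omega> \<in> sets borel" "\<phi> \<in> test_functions \<Omega>"
  shows "sq_int (lebesgue_on \<Omega>) \<phi>" "sq_int (lebesgue_on \<Omega>) (gradient \<phi>)"
    "sq_int (lebesgue_on \<Omega>) (\<lambda>x. \<phi> x *\<^sub>R i)"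
proof -
  note \<phi> = test_functionsD[OF assms(2)]
  show "sq_int (lebesgue_on \<Omega>) \<phi>"
    by (rule sq_int_continuous[OF assms(1) C_k_imp_continuous[OF \<phi>(1)] \<phi>(2)]) (rule notin_supp_imp_zero)
  show "sq_int (lebesgue_on \<Omega>) (gradient \<phi>)"
    by (rule sq_int_continuous[OF assms(1) gradient_continuous[OF \<phi>(1)] \<phi>(2)]) (rule gradient_vanishes)
  show "sq_int (lebesgue_on \<Omega>) (\<lambda>x. \<phi> x *\<^sub>R i)"
    by (rule sq_int_continuous[OF assms(1) _ \<phi>(2)])
      (auto intro!: continuous_intros C_k_imp_continuous[OF \<phi>(1)] simp: notin_supp_imp_zero)
qed

text \<open>Integrating over the whole space makes the energy of a test function independent of the domain
  that contains its support.\<close>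

definition torsion_energy :: "('a::euclidean_space \<Rightarrow> real) \<Rightarrow> real" where
  "torsion_energy \<phi> = 2 * integral\<^sup>L lborel \<phi> - (\<integral>x. (norm (gradient \<phi> x))\<^sup>2 \<partial>lborel)"

lemma integral_test_lebesgue_on:
  assumes "\<Omega> \<in> sets borel" "\<phi> \<in> test_functions \<Omega>"
  shows "integral\<^sup>L (lebesgue_on \<Omega>) \<phi> = integral\<^sup>L lborel \<phi>"
    and "(\<integral>x. (norm (gradient \<phi> x))\<^sup>2 \<partial>lebesgue_on \<Omega>) = (\<integral>x. (norm (gradient \<phi> x))\<^sup>2 \<partial>lborel)"
proof -
  note \<phi> = test_functionsD[OF assms(2)]
  show "integral\<^sup>L (lebesgue_on \<Omega>) \<phi> = integral\<^sup>L lborel \<phi>"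
    using \<phi> by (intro integral_lebesgue_on_continuous assms C_k_imp_continuous[OF \<phi>(1)] notin_supp_imp_zero) auto
  show "(\<integral>x. (norm (gradient \<phi> x))\<^sup>2 \<partial>lebesgue_on \<Omega>) = (\<integral>x. (norm (gradient \<phi> x))\<^sup>2 \<partial>lborel)"
    using \<phi>(3) gradient_vanishes[of _ \<phi>]
    by (intro integral_lebesgue_on_continuous assms continuous_intros gradient_continuous[OF \<phi>(1)]) auto
qed

lemma torsion_energy_on:
  assumes "\<Omega> \<in> sets borel" "\<phi> \<in> test_functions \<Omega>"
  shows "torsion_energy \<phi> = 2 * integral\<^sup>L (lebesgue_on \<Omega>) \<phi> - (\<integral>x. (norm (gradient \<phi> x))\<^sup>2 \<partial>lebesgue_on \<Omega>)"
  by (simp add: torsion_energy_def integral_test_lebesgue_on[OF assms])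

lemma torsion_energy_zero: "torsion_energy (\<lambda>_. 0) = 0"
  by (simp add: torsion_energy_def gradient_def)

lemma torsion_energy_add_scaled:
  assumes "\<Omega> \<in> sets borel" "\<phi> \<in> test_functions \<Omega>" "\<psi> \<in> test_functions \<Omega>"
    and fin: "emeasure lebesgue \<Omega> < \<infinity>"
  shows "torsion_energy (\<lambda>x. \<phi> x + t * \<psi> x) = torsion_energy \<phi>
    + 2 * t * (integral\<^sup>L (lebesgue_on \<Omega>) \<psi> - (\<integral>x. gradient \<phi> x \<bullet> gradient \<psi> x \<partial>lebesgue_on \<Omega>))
    - t\<^sup>2 * (\<integral>x. (norm (gradient \<psi> x))\<^sup>2 \<partial>lebesgue_on \<Omega>)"
proof -
  let ?M = "lebesgue_on \<Omega>"
  have "sq_int ?M (\<lambda>_. 1::real)"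
    using fin assms(1) by (simp add: sq_int_def finite_measure.integrable_const finite_measure_restrict_space
        finite_measureI emeasure_restrict_space)
  then have int: "integrable ?M \<phi>" "integrable ?M \<psi>"
    using sq_int_inner_integrable[OF test_sq_int(1)[OF assms(1,2)]]
      sq_int_inner_integrable[OF test_sq_int(1)[OF assms(1,3)]] by force+
  have "(\<integral>x. (norm (gradient (\<lambda>x. \<phi> x + t * \<psi> x) x))\<^sup>2 \<partial>?M)
      = (\<integral>x. (norm (gradient \<phi> x + t *\<^sub>R gradient \<psi> x))\<^sup>2 \<partial>?M)"
    by (simp add: gradient_add_scaled test_functionsD(1)[OF assms(2)] test_functionsD(1)[OF assms(3)] del: C_k.simps One_nat_def)
  also have "\<dots> = (\<integral>x. (norm (gradient \<phi> x))\<^sup>2 \<partial>?M) + 2 * t * (\<integral>x. gradient \<phi> x \<bullet> gradient \<psi> x \<partial>?M)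
      + t\<^sup>2 * (\<integral>x. (norm (gradient \<psi> x))\<^sup>2 \<partial>?M)"
    by (rule integral_sq_norm_expand) (intro test_sq_int assms)+
  finally show ?thesis
    using int
    by (simp add: torsion_energy_on[OF assms(1)] assms test_functions_add_scaled algebra_simps)
qed

lemma integral_test_derivative_eq_0:
  assumes "\<phi> \<in> test_functions \<Omega>" "C_k 1 l"
  shows "(\<integral>x. frechet_derivative (\<lambda>x. l x * \<phi> x) (at x) v \<partial>lborel) = 0"
proof (rule integral_derivative_eq_0)
  show "C_k 1 (\<lambda>x. l x * \<phi> x)"
    by (intro C_k_mult assms test_functionsD(1)[OF assms(1)])
  show "compact (supp (\<lambda>x. l x * \<phi> x))"
    by (rule compact_supp_minimal[OF test_functionsD(2)[OF assms(1)]]) (simp add: notin_supp_imp_zero)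
qed

lemma integrable_test_mult:
  assumes "\<phi> \<in> test_functions \<Omega>" "continuous_on UNIV h"
  shows "integrable lborel (\<lambda>x. h x * \<phi> x)"
  by (rule integrable_C_compact_supp[OF _ test_functionsD(2)[OF assms(1)]])
    (auto intro!: continuous_intros assms C_k_imp_continuous[OF test_functionsD(1)[OF assms(1)]]
      simp: notin_supp_imp_zero)

lemma C_1_affine_form: "C_k k (\<lambda>x. a \<bullet> (x - z))"
  by (intro C_k_inner C_k_diff C_k_const C_k_bounded_linear[OF bounded_linear_ident])

lemma integral_test_by_parts:
  assumes "\<phi> \<in> test_functions \<Omega>" "\<psi> \<in> test_functions \<Omega>"
  shows "(\<integral>x. \<phi> x * frechet_derivative \<psi> (at x) v \<partial>lborel) = - (\<integral>x. frechet_derivative \<phi> (at x) v * \<psi> x \<partial>lborel)"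
proof -
  have C: "C_k 1 \<phi>" "C_k 1 \<psi>"
    by (intro test_functionsD(1)[OF assms(1)] test_functionsD(1)[OF assms(2)])+
  have "frechet_derivative (\<lambda>x. \<phi> x * \<psi> x) (at x) v
      = \<phi> x * frechet_derivative \<psi> (at x) v + frechet_derivative \<phi> (at x) v * \<psi> x" for x
    by (rule frechet_derivative_eqI) (intro has_derivative_mult C_1_has_derivative C)
  then have "(\<integral>x. \<phi> x * frechet_derivative \<psi> (at x) v + frechet_derivative \<phi> (at x) v * \<psi> x \<partial>lborel) = 0"
    using integral_test_derivative_eq_0[OF assms(2) C(1), of v] by simp
  moreover have "integrable lborel (\<lambda>x. \<phi> x * frechet_derivative \<psi> (at x) v)"
    by (rule integrable_test_mult[OF test_functions_derivative[OF assms(2)] C_k_imp_continuous[OF C(1)]])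
  moreover have "integrable lborel (\<lambda>x. frechet_derivative \<phi> (at x) v * \<psi> x)"
    by (rule integrable_test_mult[OF assms(2) C_1_continuous_derivative[OF C(1)]])
  ultimately show ?thesis
    by simp
qed

text \<open>Integrating \<open>\<phi>\<close> by parts against the linear function \<open>l(x) = a \<bullet> (x - z)\<close> gives
  \<open>|a|\<^sup>2 \<integral> \<phi> = - \<integral> l \<partial>\<^sub>a \<phi>\<close>. Completing the square in \<open>- 2 l \<partial>\<^sub>a \<phi> / |a|\<^sup>2 - |\<nabla> \<phi>|\<^sup>2\<close>
  leaves \<open>l\<^sup>2 / |a|\<^sup>2\<close>, and \<open>|l| \<le> 1\<close> on the slab.\<close>

lemma torsion_energy_le:
  fixes \<Omega> :: "'a::euclidean_space set"
  assumes [measurable]: "\<Omega> \<in> sets borel" and "\<phi> \<in> test_functions \<Omega>" "a \<noteq> 0"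
    and slab: "\<And>x. x \<in> \<Omega> \<Longrightarrow> \<bar>a \<bullet> (x - z)\<bar> \<le> 1" and fin: "emeasure lborel \<Omega> < \<infinity>"
  shows "torsion_energy \<phi> \<le> measure lborel \<Omega> / (norm a)\<^sup>2"
proof -
  note \<phi> = test_functionsD[OF assms(2)]
  let ?l = "\<lambda>x. a \<bullet> (x - z)"
  have C: "C_k 1 \<phi>" by (rule \<phi>)
  have fd: "frechet_derivative (\<lambda>x. ?l x * \<phi> x) (at x) a = ?l x * (gradient \<phi> x \<bullet> a) + (norm a)\<^sup>2 * \<phi> x" for x
    unfolding power2_norm_eq_inner
    by (rule frechet_derivative_eqI) (auto intro!: derivative_eq_intros has_derivative_gradient C)
  have i1: "integrable lborel (\<lambda>x. ?l x * (gradient \<phi> x \<bullet> a))"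
    unfolding gradient_inner[OF C]
    by (intro integrable_test_mult[OF test_functions_derivative[OF assms(2)]] continuous_intros)
  have i2: "integrable lborel \<phi>"
    using integrable_test_mult[OF assms(2), of "\<lambda>_. 1"] by simp
  have i3: "integrable lborel (\<lambda>x. (norm (gradient \<phi> x))\<^sup>2)"
    by (rule integrable_C_compact_supp[OF _ \<phi>(2)])
      (auto intro!: continuous_intros gradient_continuous C simp: gradient_vanishes)
  have "(\<integral>x. ?l x * (gradient \<phi> x \<bullet> a) + (norm a)\<^sup>2 * \<phi> x \<partial>lborel) = 0"
    using integral_test_derivative_eq_0[OF assms(2) C_1_affine_form, of a z a] by (simp add: fd)
  then have "(norm a)\<^sup>2 * integral\<^sup>L lborel \<phi> = - (\<integral>x. ?l x * (gradient \<phi> x \<bullet> a) \<partial>lborel)"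
    using i1 i2 by simp
  then have "integral\<^sup>L lborel \<phi> = (- (\<integral>x. ?l x * (gradient \<phi> x \<bullet> a) \<partial>lborel)) / (norm a)\<^sup>2"
    using assms(3) by (simp add: field_simps)
  then have eq: "torsion_energy \<phi> =
      (\<integral>x. - (2 / (norm a)\<^sup>2) * (?l x * (gradient \<phi> x \<bullet> a)) - (norm (gradient \<phi> x))\<^sup>2 \<partial>lborel)"
    using i1 i3 by (simp add: torsion_energy_def Bochner_Integration.integral_diff)
  also have "\<dots> \<le> (\<integral>x. indicator \<Omega> x / (norm a)\<^sup>2 \<partial>lborel)"
  proof (rule integral_mono)
    show "integrable lborel (\<lambda>x. - (2 / (norm a)\<^sup>2) * (?l x * (gradient \<phi> x \<bullet> a)) - (norm (gradient \<phi> x))\<^sup>2)"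
      by (intro Bochner_Integration.integrable_diff integrable_mult_right i1 i3)
    show "integrable lborel (\<lambda>x. indicator \<Omega> x / (norm a)\<^sup>2)"
      using fin by (intro Bochner_Integration.integrable_divide integrable_real_indicator) auto
    show "- (2 / (norm a)\<^sup>2) * (?l x * (gradient \<phi> x \<bullet> a)) - (norm (gradient \<phi> x))\<^sup>2 \<le> indicator \<Omega> x / (norm a)\<^sup>2" for x
    proof (cases "x \<in> \<Omega>")
      case True
      define n where "n = norm a"
      define G where "G = norm (gradient \<phi> x)"
      have n: "n > 0"
        using assms(3) by (simp add: n_def)
      have "\<bar>?l x * (gradient \<phi> x \<bullet> a)\<bar> \<le> 1 * (G * n)"
        unfolding abs_mult n_def G_def
        by (intro mult_mono slab[OF True] Cauchy_Schwarz_ineq2) auto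
      then have "- (?l x * (gradient \<phi> x \<bullet> a)) \<le> G * n"
        by linarith
      then have "(2 / n\<^sup>2) * (- (?l x * (gradient \<phi> x \<bullet> a))) \<le> (2 / n\<^sup>2) * (G * n)"
        by (intro mult_left_mono) auto
      also have "\<dots> = 2 * (G * (1 / n))"
        using n by (simp add: power2_eq_square)
      also have "\<dots> \<le> G\<^sup>2 + (1 / n)\<^sup>2"
        using sum_squares_bound[of G "1/n"] by simp
      finally show ?thesis
        using True by (simp add: n_def G_def power_divide)
    next
      case False
      then have "x \<notin> supp \<phi>"
        using \<phi>(3) by auto
      then show ?thesis
        using False by (simp add: gradient_vanishes)
    qed
  qed
  also have "\<dots> = measure lborel \<Omega> / (norm a)\<^sup>2"
    by simp
  finally show ?thesis .
qed

text \<open>The same integration by parts for \<open>\<phi>\<^sup>2\<close>, where half of \<open>|a|\<^sup>2 \<integral> \<phi>\<^sup>2\<close> is absorbed on the left.\<close>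

lemma Poincare:
  fixes \<Omega> :: "'a::euclidean_space set"
  assumes "\<phi> \<in> test_functions \<Omega>" "a \<noteq> 0"
    and slab: "\<And>x. x \<in> \<Omega> \<Longrightarrow> \<bar>a \<bullet> (x - z)\<bar> \<le> 1"
  shows "(\<integral>x. (\<phi> x)\<^sup>2 \<partial>lborel) \<le> 4 / (norm a)\<^sup>2 * (\<integral>x. (norm (gradient \<phi> x))\<^sup>2 \<partial>lborel)"
proof -
  note \<phi> = test_functionsD[OF assms(1)]
  let ?l = "\<lambda>x. a \<bullet> (x - z)"
  have C: "C_k 1 \<phi>" by (rule \<phi>)
  have cont: "continuous_on UNIV \<phi>"
    by (rule C_k_imp_continuous[OF C])
  have D: "((\<lambda>x. (?l x * \<phi> x) * \<phi> x) has_derivative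
      (\<lambda>v. (?l x * \<phi> x) * (gradient \<phi> x \<bullet> v) + (?l x * (gradient \<phi> x \<bullet> v) + (a \<bullet> v) * \<phi> x) * \<phi> x)) (at x)" for x
    by (auto intro!: derivative_eq_intros has_derivative_gradient C)
  have fd: "frechet_derivative (\<lambda>x. (?l x * \<phi> x) * \<phi> x) (at x) a
      = 2 * ((?l x * (gradient \<phi> x \<bullet> a)) * \<phi> x) + (norm a)\<^sup>2 * (\<phi> x)\<^sup>2" for x
    by (subst frechet_derivative_eqI[OF D]) (simp add: power2_norm_eq_inner power2_eq_square[of "\<phi> x"] algebra_simps)
  have i1: "integrable lborel (\<lambda>x. (?l x * (gradient \<phi> x \<bullet> a)) * \<phi> x)"
    by (intro integrable_test_mult[OF assms(1)] continuous_intros gradient_continuous C)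
  have i2: "integrable lborel (\<lambda>x. (\<phi> x)\<^sup>2)"
    using integrable_test_mult[OF assms(1) cont] by (simp add: power2_eq_square)
  have i3: "integrable lborel (\<lambda>x. (norm (gradient \<phi> x))\<^sup>2)"
    by (rule integrable_C_compact_supp[OF _ \<phi>(2)])
      (auto intro!: continuous_intros gradient_continuous C simp: gradient_vanishes)
  have "(\<integral>x. 2 * ((?l x * (gradient \<phi> x \<bullet> a)) * \<phi> x) + (norm a)\<^sup>2 * (\<phi> x)\<^sup>2 \<partial>lborel) = 0"
    using integral_test_derivative_eq_0[OF assms(1) C_k_mult[OF C_1_affine_form C], of a z a] by (simp only: fd)
  then have "(norm a)\<^sup>2 * (\<integral>x. (\<phi> x)\<^sup>2 \<partial>lborel) = - (\<integral>x. 2 * ((?l x * (gradient \<phi> x \<bullet> a)) * \<phi> x) \<partial>lborel)"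
    using i1 i2 by (subst (asm) Bochner_Integration.integral_add) auto
  also have "\<dots> = (\<integral>x. - (2 * ((?l x * (gradient \<phi> x \<bullet> a)) * \<phi> x)) \<partial>lborel)"
    by simp
  also have "\<dots> \<le> (\<integral>x. (norm a)\<^sup>2 / 2 * (\<phi> x)\<^sup>2 + 2 * (norm (gradient \<phi> x))\<^sup>2 \<partial>lborel)"
  proof (rule integral_mono)
    show "integrable lborel (\<lambda>x. - (2 * ((?l x * (gradient \<phi> x \<bullet> a)) * \<phi> x)))"
      using i1 by simp
    show "integrable lborel (\<lambda>x. (norm a)\<^sup>2 / 2 * (\<phi> x)\<^sup>2 + 2 * (norm (gradient \<phi> x))\<^sup>2)"
      by (intro Bochner_Integration.integrable_add integrable_mult_right i2 i3)
    show "- (2 * ((?l x * (gradient \<phi> x \<bullet> a)) * \<phi> x)) \<le> (norm a)\<^sup>2 / 2 * (\<phi> x)\<^sup>2 + 2 * (norm (gradient \<phi> x))\<^sup>2" for x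
    proof (cases "x \<in> \<Omega>")
      case True
      define n where "n = norm a"
      define G where "G = norm (gradient \<phi> x)"
      have "\<bar>?l x * (gradient \<phi> x \<bullet> a)\<bar> * \<bar>\<phi> x\<bar> \<le> (1 * (G * n)) * \<bar>\<phi> x\<bar>"
        unfolding abs_mult n_def G_def
        by (intro mult_mono mult_right_mono slab[OF True] Cauchy_Schwarz_ineq2) auto
      then have "- (2 * ((?l x * (gradient \<phi> x \<bullet> a)) * \<phi> x)) \<le> 2 * (G * (n * \<bar>\<phi> x\<bar>))"
        using abs_ge_minus_self[of "(?l x * (gradient \<phi> x \<bullet> a)) * \<phi> x"] by (simp add: abs_mult mult_ac)
      also have "\<dots> \<le> n\<^sup>2 / 2 * (\<phi> x)\<^sup>2 + 2 * G\<^sup>2"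
        using sum_squares_bound[of "2 * G" "n * \<bar>\<phi> x\<bar>"] by (simp add: power_mult_distrib)
      finally show ?thesis
        by (simp add: n_def G_def)
    next
      case False
      then have "x \<notin> supp \<phi>"
        using \<phi>(3) by auto
      then show ?thesis
        by (simp add: gradient_vanishes)
    qed
  qed
  also have "\<dots> = (norm a)\<^sup>2 / 2 * (\<integral>x. (\<phi> x)\<^sup>2 \<partial>lborel) + 2 * (\<integral>x. (norm (gradient \<phi> x))\<^sup>2 \<partial>lborel)"
    using i2 i3 by simp
  finally have "(norm a)\<^sup>2 * (\<integral>x. (\<phi> x)\<^sup>2 \<partial>lborel) \<le> 4 * (\<integral>x. (norm (gradient \<phi> x))\<^sup>2 \<partial>lborel)"
    by simp
  then show ?thesis
    using assms(2) by (simp add: field_simps)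
qed



section \<open>Torsional rigidity as a supremum of energies\<close>

lemma finite_measure_lebesgue_on:
  assumes "\<Omega> \<in> sets borel" "emeasure lborel \<Omega> < \<infinity>"
  shows "finite_measure (lebesgue_on \<Omega>)"
  using assms by (intro finite_measureI) (simp add: emeasure_restrict_space)

lemma sq_int_const:
  assumes "\<Omega> \<in> sets borel" "emeasure lborel \<Omega> < \<infinity>"
  shows "sq_int (lebesgue_on \<Omega>) (\<lambda>_. c)"
  using finite_measure.integrable_const[OF finite_measure_lebesgue_on[OF assms]]
  by (simp add: sq_int_def)

lemma gradient_scaled:
  assumes "C_k 1 \<phi>"
  shows "gradient (\<lambda>x. c * \<phi> x) x = c *\<^sub>R gradient \<phi> x"
  by (rule gradient_eqI) (auto intro!: derivative_eq_intros has_derivative_gradient assms)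

lemma torsion_energy_scaled:
  assumes "C_k 1 \<phi>"
  shows "torsion_energy (\<lambda>x. c * \<phi> x)
    = 2 * c * integral\<^sup>L lborel \<phi> - c\<^sup>2 * (\<integral>x. (norm (gradient \<phi> x))\<^sup>2 \<partial>lborel)"
  unfolding torsion_energy_def gradient_scaled[OF assms] by (simp add: power_mult_distrib)

lemma has_H1_gradient_iff:
  "has_H1_gradient \<Omega> u g \<longleftrightarrow> sq_int (lebesgue_on \<Omega>) u \<and> sq_int (lebesgue_on \<Omega>) g \<and>
     (\<forall>\<phi>\<in>test_functions \<Omega>. \<forall>i\<in>Basis.
        integral\<^sup>L (lebesgue_on \<Omega>) (\<lambda>x. u x * frechet_derivative \<phi> (at x) i) =
        - integral\<^sup>L (lebesgue_on \<Omega>) (\<lambda>x. (g x \<bullet> i) * \<phi> x))"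
  by (simp add: has_H1_gradient_def L2_on_def sq_int_def)

text \<open>Partial derivatives of test functions are test functions again. Testing the definition of the weak
  gradient against them expresses both integrals by \<open>u\<close> and second derivatives of \<open>\<phi>\<close>. This avoids
  identifying the two gradients almost everywhere.\<close>

lemma weak_gradient_unique:
  fixes \<Omega> :: "'a::euclidean_space set"
  assumes \<Omega>: "\<Omega> \<in> sets borel" and "has_H1_gradient \<Omega> u g" "has_H1_gradient \<Omega> u h" and \<phi>: "\<phi> \<in> test_functions \<Omega>"
  shows "(\<integral>x. g x \<bullet> gradient \<phi> x \<partial>lebesgue_on \<Omega>) = (\<integral>x. h x \<bullet> gradient \<phi> x \<partial>lebesgue_on \<Omega>)"
proof -
  let ?D = "\<lambda>i x. frechet_derivative \<phi> (at x) i"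
  have expand: "(\<integral>x. k x \<bullet> gradient \<phi> x \<partial>lebesgue_on \<Omega>) = (\<Sum>i\<in>Basis. - (\<integral>x. u x * frechet_derivative (?D i) (at x) i \<partial>lebesgue_on \<Omega>))"
    if k: "has_H1_gradient \<Omega> u k" for k
  proof -
    have sq: "sq_int (lebesgue_on \<Omega>) k"
      using k by (simp add: has_H1_gradient_iff)
    have int: "integrable (lebesgue_on \<Omega>) (\<lambda>x. k x \<bullet> (?D i x *\<^sub>R i))" for i
      by (intro sq_int_inner_integrable sq test_sq_int(3) \<Omega> test_functions_derivative \<phi>)
    have "(\<integral>x. k x \<bullet> gradient \<phi> x \<partial>lebesgue_on \<Omega>) = (\<integral>x. (\<Sum>i\<in>Basis. k x \<bullet> (?D i x *\<^sub>R i)) \<partial>lebesgue_on \<Omega>)"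
      by (simp add: gradient_def inner_sum_right)
    also have "\<dots> = (\<Sum>i\<in>Basis. \<integral>x. k x \<bullet> (?D i x *\<^sub>R i) \<partial>lebesgue_on \<Omega>)"
      by (intro Bochner_Integration.integral_sum int)
    also have "\<dots> = (\<Sum>i\<in>Basis. - (\<integral>x. u x * frechet_derivative (?D i) (at x) i \<partial>lebesgue_on \<Omega>))"
    proof (rule sum.cong)
      fix i :: 'a assume "i \<in> Basis"
      then show "(\<integral>x. k x \<bullet> (?D i x *\<^sub>R i) \<partial>lebesgue_on \<Omega>)
          = - (\<integral>x. u x * frechet_derivative (?D i) (at x) i \<partial>lebesgue_on \<Omega>)"
        using k test_functions_derivative[OF \<phi>, of i]
        by (simp add: has_H1_gradient_iff mult.commute)
    qed simp
    finally show ?thesis .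
  qed
  show ?thesis
    using expand[OF assms(2)] expand[OF assms(3)] by simp
qed

lemma quadratic_le_imp_zero:
  assumes "\<And>t::real. 2 * t * c \<le> t\<^sup>2 * e" "0 \<le> e"
  shows "c = 0"
proof -
  have "c\<^sup>2 \<le> 0 * e"
  proof (rule quadratic_nonneg_imp_discriminant)
    show "0 \<le> 0 + 2 * t * c + t\<^sup>2 * e" for t
      using assms(1)[of "-t"] by simp
  qed fact
  then show ?thesis
    by simp
qed

context
  fixes \<Omega> :: "'a::euclidean_space set"
  assumes \<Omega>: "open \<Omega>" "bounded \<Omega>"
begin

lemma bounded_open_borel [measurable]: "\<Omega> \<in> sets borel"
  using \<Omega> by simp

lemma bounded_open_finite_measure: "emeasure lborel \<Omega> < \<infinity>"
  using emeasure_bounded_finite[OF \<Omega>(2)] by (simp add: less_top)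

lemma bounded_open_subset_slab:
  obtains a :: 'a where "a \<noteq> 0" "\<And>x. x \<in> \<Omega> \<Longrightarrow> \<bar>a \<bullet> (x - 0)\<bar> \<le> 1"
proof -
  obtain R where R: "0 < R" "\<And>x. x \<in> \<Omega> \<Longrightarrow> norm x \<le> R"
    using \<Omega>(2) unfolding bounded_pos by auto
  obtain i :: 'a where i: "i \<in> Basis"
    using nonempty_Basis by blast
  show ?thesis
  proof (rule that[of "(1/R) *\<^sub>R i"])
    show "(1/R) *\<^sub>R i \<noteq> 0"
      using R i by (simp add: nonzero_Basis)
    fix x assume "x \<in> \<Omega>"
    then have "\<bar>i \<bullet> x\<bar> \<le> R"
      using R Basis_le_norm[OF i, of x] by (force simp: inner_commute)
    then show "\<bar>(1/R) *\<^sub>R i \<bullet> (x - 0)\<bar> \<le> 1"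
      using R by (simp add: abs_mult field_simps)
  qed
qed

lemma torsion_energy_bdd_above: "bdd_above (torsion_energy ` test_functions \<Omega>)"
proof -
  obtain a where "a \<noteq> 0" "\<And>x. x \<in> \<Omega> \<Longrightarrow> \<bar>a \<bullet> (x - 0)\<bar> \<le> 1"
    using bounded_open_subset_slab by metis
  then show ?thesis
    using torsion_energy_le[OF bounded_open_borel _ _ _ bounded_open_finite_measure] by (intro bdd_aboveI2) blast
qed

text \<open>Let \<open>g\<close> be the gradient of \<open>u\<close>. Testing the equation with the functions that approximate \<open>u\<close> gives
  \<open>\<integral> u = \<integral> |g|\<^sup>2\<close>. The energy of a test function \<open>\<psi>\<close> is \<open>\<integral> |g|\<^sup>2 - \<integral> |\<nabla> \<psi> - g|\<^sup>2\<close>, so \<open>\<integral> |g|\<^sup>2\<close> is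
  an upper bound that the approximating functions attain in the limit. In particular all weak
  solutions have the same integral.\<close>

lemma torsion_function_integral:
  assumes "torsion_function \<Omega> u"
  shows "integral\<^sup>L (lebesgue_on \<Omega>) u = (SUP \<phi>\<in>test_functions \<Omega>. torsion_energy \<phi>)"
proof -
  let ?M = "lebesgue_on \<Omega>"
  obtain g \<phi> where g: "has_H1_gradient \<Omega> u g" and \<phi>: "\<And>n. \<phi> n \<in> test_functions \<Omega>"
    and lim: "(\<lambda>n. integral\<^sup>L ?M (\<lambda>x. (\<phi> n x - u x)\<^sup>2) + integral\<^sup>L ?M (\<lambda>x. (norm (gradient (\<phi> n) x - g x))\<^sup>2))
        \<longlonglongrightarrow> 0"
    using assms unfolding torsion_function_def H10_def by blast
  obtain h where h: "has_H1_gradient \<Omega> u h"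
    "\<And>\<psi>. \<psi> \<in> test_functions \<Omega> \<Longrightarrow> integral\<^sup>L ?M (\<lambda>x. h x \<bullet> gradient \<psi> x) = integral\<^sup>L ?M \<psi>"
    using assms unfolding torsion_function_def by blast
  have eq: "integral\<^sup>L ?M (\<lambda>x. g x \<bullet> gradient \<psi> x) = integral\<^sup>L ?M \<psi>" if "\<psi> \<in> test_functions \<Omega>" for \<psi>
    using weak_gradient_unique[OF bounded_open_borel g h(1) that] h(2)[OF that] by simp
  have sq: "sq_int ?M u" "sq_int ?M g"
    using g by (auto simp: has_H1_gradient_iff)
  have lim_u: "(\<lambda>n. \<integral>x. (norm (\<phi> n x - u x))\<^sup>2 \<partial>?M) \<longlonglongrightarrow> 0"
    by (rule tendsto_sandwich[OF _ _ tendsto_const lim]) (auto intro!: always_eventually)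
  have lim_g: "(\<lambda>n. \<integral>x. (norm (gradient (\<phi> n) x - g x))\<^sup>2 \<partial>?M) \<longlonglongrightarrow> 0"
    by (rule tendsto_sandwich[OF _ _ tendsto_const lim]) (auto intro!: always_eventually)
  note \<phi>_sq = test_sq_int(1,2)[OF bounded_open_borel \<phi>]
  let ?G = "\<integral>x. (norm (g x))\<^sup>2 \<partial>?M"
  have "(\<lambda>n. \<integral>x. \<phi> n x \<bullet> 1 \<partial>?M) \<longlonglongrightarrow> (\<integral>x. u x \<bullet> 1 \<partial>?M)"
    by (rule L2_tendsto_inner[OF \<phi>_sq(1) sq(1) sq_int_const[OF bounded_open_borel bounded_open_finite_measure] lim_u])
  then have lim1: "(\<lambda>n. integral\<^sup>L ?M (\<phi> n)) \<longlonglongrightarrow> integral\<^sup>L ?M u"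
    by simp
  have "(\<lambda>n. \<integral>x. gradient (\<phi> n) x \<bullet> g x \<partial>?M) \<longlonglongrightarrow> (\<integral>x. g x \<bullet> g x \<partial>?M)"
    by (rule L2_tendsto_inner[OF \<phi>_sq(2) sq(2) sq(2) lim_g])
  then have "(\<lambda>n. integral\<^sup>L ?M (\<phi> n)) \<longlonglongrightarrow> ?G"
    using eq[OF \<phi>] by (simp add: inner_commute power2_norm_eq_inner)
  with lim1 have uG: "integral\<^sup>L ?M u = ?G"
    by (rule LIMSEQ_unique)
  have "(SUP \<phi>\<in>test_functions \<Omega>. torsion_energy \<phi>) = ?G"
  proof (rule cSup_eq_non_empty)
    fix y assume "y \<in> torsion_energy ` test_functions \<Omega>"
    then obtain \<psi> where \<psi>: "\<psi> \<in> test_functions \<Omega>" "y = torsion_energy \<psi>"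
      by auto
    have "0 \<le> (\<integral>x. (norm (gradient \<psi> x + (-1) *\<^sub>R g x))\<^sup>2 \<partial>?M)"
      by simp
    also have "\<dots> = (\<integral>x. (norm (gradient \<psi> x))\<^sup>2 \<partial>?M) + 2 * (-1) * (\<integral>x. gradient \<psi> x \<bullet> g x \<partial>?M) + (-1)\<^sup>2 * ?G"
      by (rule integral_sq_norm_expand[OF test_sq_int(2)[OF bounded_open_borel \<psi>(1)] sq(2)])
    also have "(\<integral>x. gradient \<psi> x \<bullet> g x \<partial>?M) = integral\<^sup>L ?M \<psi>"
      using eq[OF \<psi>(1)] by (simp add: inner_commute)
    finally show "y \<le> ?G"
      by (simp add: \<psi> torsion_energy_on[OF bounded_open_borel])
  next
    fix y assume y: "\<And>z. z \<in> torsion_energy ` test_functions \<Omega> \<Longrightarrow> z \<le> y"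
    have "(\<lambda>n. 2 * integral\<^sup>L ?M (\<phi> n) - (\<integral>x. (norm (gradient (\<phi> n) x))\<^sup>2 \<partial>?M)) \<longlonglongrightarrow> 2 * ?G - ?G"
      using lim1 uG by (intro tendsto_intros L2_tendsto_norm \<phi>_sq(2) sq(2) lim_g) auto
    then have "(\<lambda>n. torsion_energy (\<phi> n)) \<longlonglongrightarrow> ?G"
      by (simp add: torsion_energy_on[OF bounded_open_borel \<phi>])
    then show "?G \<le> y"
      by (rule LIMSEQ_le_const2) (use y \<phi> in auto)
  qed (use test_functions_zero in auto)
  then show ?thesis
    using uG by simp
qed

text \<open>Direct method. The energy is a concave quadratic functional, so by the parallelogram identity the
  gradients of a maximizing sequence are Cauchy in \<open>L\<^sup>2\<close>; by the Poincare inequality so are the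
  functions. The energy is maximal at the limit, and its first variation is the weak equation.\<close>

lemma torsion_function_exists: "\<exists>u. torsion_function \<Omega> u"
proof -
  let ?M = "lebesgue_on \<Omega>"
  define S where "S = (SUP \<phi>\<in>test_functions \<Omega>. torsion_energy \<phi>)"
  have le_S: "torsion_energy \<psi> \<le> S" if "\<psi> \<in> test_functions \<Omega>" for \<psi>
    unfolding S_def by (rule cSUP_upper[OF that torsion_energy_bdd_above])
  have "\<exists>\<psi>. \<psi> \<in> test_functions \<Omega> \<and> S - inverse (real (Suc n)) < torsion_energy \<psi>" for n
  proof -
    have "S - inverse (real (Suc n)) < (SUP \<phi>\<in>test_functions \<Omega>. torsion_energy \<phi>)"
      by (simp add: S_def)
    then have "\<exists>\<psi>\<in>test_functions \<Omega>. S - inverse (real (Suc n)) < torsion_energy \<psi>"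
      by (rule less_cSUP_iff[THEN iffD1, rotated 2]) (use test_functions_zero torsion_energy_bdd_above in auto)
    then show ?thesis
      by blast
  qed
  then obtain \<phi> where \<phi>: "\<And>n. \<phi> n \<in> test_functions \<Omega>"
    and near: "\<And>n. S - inverse (real (Suc n)) < torsion_energy (\<phi> n)"
    by metis
  note \<phi>_sq = test_sq_int(1,2)[OF bounded_open_borel \<phi>]
  have fin': "emeasure lebesgue \<Omega> < \<infinity>"
    using bounded_open_finite_measure by simp
  \<comment> \<open>The midpoint of two near-maximizers has energy at most \<open>S\<close>.\<close>
  have par: "(\<integral>x. (norm (gradient (\<phi> m) x - gradient (\<phi> n) x))\<^sup>2 \<partial>?M)
      \<le> 2 * inverse (real (Suc m)) + 2 * inverse (real (Suc n))" for m n
  proof -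
    have e: "(\<integral>x. (norm (gradient (\<phi> m) x - gradient (\<phi> n) x))\<^sup>2 \<partial>?M)
        = (\<integral>x. (norm (gradient (\<phi> m) x))\<^sup>2 \<partial>?M) - 2 * (\<integral>x. gradient (\<phi> m) x \<bullet> gradient (\<phi> n) x \<partial>?M)
          + (\<integral>x. (norm (gradient (\<phi> n) x))\<^sup>2 \<partial>?M)"
      using integral_sq_norm_expand[OF \<phi>_sq(2)[of m] \<phi>_sq(2)[of n], of "-1"] by simp
    let ?p = "\<lambda>x. (1/2) * \<phi> m x + (1/2) * \<phi> n x"
    have p: "?p \<in> test_functions \<Omega>"
      by (intro test_functions_add_scaled test_functions_scaled \<phi>)
    note \<phi>_C = test_functionsD(1)[OF \<phi>]
    note half = gradient_scaled[OF \<phi>_C]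
    have E_lborel: "(\<integral>x. (norm (gradient (\<phi> m) x))\<^sup>2 \<partial>lborel) = (\<integral>x. (norm (gradient (\<phi> m) x))\<^sup>2 \<partial>?M)"
      "integral\<^sup>L lborel (\<phi> m) = integral\<^sup>L ?M (\<phi> m)"
      by (simp_all add: integral_test_lebesgue_on[OF bounded_open_borel \<phi>])
    have "torsion_energy ?p = torsion_energy (\<lambda>x. (1/2) * \<phi> m x)
      + 2 * (1/2) * (integral\<^sup>L ?M (\<phi> n) - (\<integral>x. gradient (\<lambda>x. (1/2) * \<phi> m x) x \<bullet> gradient (\<phi> n) x \<partial>?M))
      - (1/2)\<^sup>2 * (\<integral>x. (norm (gradient (\<phi> n) x))\<^sup>2 \<partial>?M)"
      by (rule torsion_energy_add_scaled[OF bounded_open_borel test_functions_scaled[OF \<phi>] \<phi> fin'])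
    also have "torsion_energy (\<lambda>x. (1/2) * \<phi> m x) = integral\<^sup>L ?M (\<phi> m) - (1/4) * (\<integral>x. (norm (gradient (\<phi> m) x))\<^sup>2 \<partial>?M)"
      unfolding torsion_energy_scaled[OF \<phi>_C] E_lborel by (simp add: power_divide)
    finally have "integral\<^sup>L ?M (\<phi> m) - (1/4) * (\<integral>x. (norm (gradient (\<phi> m) x))\<^sup>2 \<partial>?M)
       + integral\<^sup>L ?M (\<phi> n) - (1/2) * (\<integral>x. gradient (\<phi> m) x \<bullet> gradient (\<phi> n) x \<partial>?M)
       - (1/4) * (\<integral>x. (norm (gradient (\<phi> n) x))\<^sup>2 \<partial>?M) \<le> S"
      using le_S[OF p] unfolding half by (simp add: power_divide)
    then show ?thesis
      using near[of m] near[of n] e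
      by (simp add: torsion_energy_on[OF bounded_open_borel \<phi>] del: of_nat_Suc)
  qed
  have inv_small: "\<exists>N. \<forall>n\<ge>N. inverse (real (Suc n)) < e" if "0 < e" for e
    using LIMSEQ_inverse_real_of_nat that by (auto simp: LIMSEQ_iff)
  obtain g where g: "sq_int ?M g" "(\<lambda>n. \<integral>x. (norm (gradient (\<phi> n) x - g x))\<^sup>2 \<partial>?M) \<longlonglongrightarrow> 0"
  proof (rule L2_complete[OF _ \<phi>_sq(2)])
    show "emeasure ?M (space ?M) < \<infinity>"
      using bounded_open_finite_measure by (simp add: emeasure_restrict_space)
    fix e :: real assume "0 < e"
    then obtain N where N: "\<forall>n\<ge>N. inverse (real (Suc n)) < e / 4"
      using inv_small[of "e/4"] by auto
    show "\<exists>N. \<forall>m\<ge>N. \<forall>n\<ge>N. (\<integral>x. (norm (gradient (\<phi> m) x - gradient (\<phi> n) x))\<^sup>2 \<partial>?M) < e"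
    proof (intro exI[of _ N] allI impI)
      fix m n assume "m \<ge> N" "n \<ge> N"
      then have "inverse (real (Suc m)) < e / 4" "inverse (real (Suc n)) < e / 4"
        using N by auto
      then show "(\<integral>x. (norm (gradient (\<phi> m) x - gradient (\<phi> n) x))\<^sup>2 \<partial>?M) < e"
        using par[of m n] by linarith
    qed
  qed
  obtain a where a: "a \<noteq> 0" "\<And>x. x \<in> \<Omega> \<Longrightarrow> \<bar>a \<bullet> (x - 0)\<bar> \<le> 1"
    using bounded_open_subset_slab by metis
  define C where "C = 4 / (norm a)\<^sup>2"
  have C: "0 < C"
    using a by (simp add: C_def)
  have poin: "(\<integral>x. (norm (\<phi> m x - \<phi> n x))\<^sup>2 \<partial>?M)
      \<le> C * (\<integral>x. (norm (gradient (\<phi> m) x - gradient (\<phi> n) x))\<^sup>2 \<partial>?M)" for m n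
  proof -
    let ?p = "\<lambda>x. \<phi> m x + (-1) * \<phi> n x"
    have p: "?p \<in> test_functions \<Omega>"
      by (intro test_functions_add_scaled \<phi>)
    note pD = test_functionsD[OF p]
    have z: "?p x = 0" if "x \<notin> \<Omega>" for x
      using that pD(3) notin_supp_imp_zero[of x ?p] by auto
    have gr: "gradient ?p x = gradient (\<phi> m) x - gradient (\<phi> n) x" for x
      using gradient_add_scaled[OF test_functionsD(1)[OF \<phi>[of m]] test_functionsD(1)[OF \<phi>[of n]], of "-1" x] by simp
    have "(\<integral>x. (?p x)\<^sup>2 \<partial>lborel) \<le> C * (\<integral>x. (norm (gradient ?p x))\<^sup>2 \<partial>lborel)"
      unfolding C_def by (rule Poincare[OF p a])
    moreover have "(\<integral>x. (?p x)\<^sup>2 \<partial>?M) = (\<integral>x. (?p x)\<^sup>2 \<partial>lborel)"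
      by (intro integral_lebesgue_on_continuous bounded_open_borel continuous_intros
          C_k_imp_continuous[OF test_functionsD(1)[OF \<phi>]]) (simp add: z[simplified])
    moreover have "(\<integral>x. (norm (gradient ?p x))\<^sup>2 \<partial>?M) = (\<integral>x. (norm (gradient ?p x))\<^sup>2 \<partial>lborel)"
      by (rule integral_test_lebesgue_on(2)[OF bounded_open_borel p])
    ultimately have "(\<integral>x. (?p x)\<^sup>2 \<partial>?M) \<le> C * (\<integral>x. (norm (gradient ?p x))\<^sup>2 \<partial>?M)"
      by simp
    then show ?thesis
      unfolding gr by simp
  qed
  obtain u where u: "sq_int ?M u" "(\<lambda>n. \<integral>x. (norm (\<phi> n x - u x))\<^sup>2 \<partial>?M) \<longlonglongrightarrow> 0"
  proof (rule L2_complete[OF _ \<phi>_sq(1)])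
    show "emeasure ?M (space ?M) < \<infinity>"
      using bounded_open_finite_measure by (simp add: emeasure_restrict_space)
    fix e :: real assume "0 < e"
    then have "0 < e / (4 * C)"
      using C by simp
    then obtain N where N: "\<forall>n\<ge>N. inverse (real (Suc n)) < e / (4 * C)"
      using inv_small by blast
    show "\<exists>N. \<forall>m\<ge>N. \<forall>n\<ge>N. (\<integral>x. (norm (\<phi> m x - \<phi> n x))\<^sup>2 \<partial>?M) < e"
    proof (intro exI[of _ N] allI impI)
      fix m n assume "m \<ge> N" "n \<ge> N"
      then have "inverse (real (Suc m)) < e / (4 * C)" "inverse (real (Suc n)) < e / (4 * C)"
        using N by auto
      then have "2 * inverse (real (Suc m)) + 2 * inverse (real (Suc n)) < 4 * (e / (4 * C))"
        by linarith
      then have "(\<integral>x. (norm (gradient (\<phi> m) x - gradient (\<phi> n) x))\<^sup>2 \<partial>?M) < e / C"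
        using par[of m n] by simp
      then have "C * (\<integral>x. (norm (gradient (\<phi> m) x - gradient (\<phi> n) x))\<^sup>2 \<partial>?M) < e"
        using C by (simp add: field_simps)
      then show "(\<integral>x. (norm (\<phi> m x - \<phi> n x))\<^sup>2 \<partial>?M) < e"
        using poin[of m n] by linarith
    qed
  qed
  have weak: "integral\<^sup>L ?M (\<lambda>x. u x * frechet_derivative \<psi> (at x) i) = - integral\<^sup>L ?M (\<lambda>x. (g x \<bullet> i) * \<psi> x)"
    if \<psi>: "\<psi> \<in> test_functions \<Omega>" for \<psi> i
  proof -
    have "(\<lambda>n. \<integral>x. \<phi> n x \<bullet> frechet_derivative \<psi> (at x) i \<partial>?M) \<longlonglongrightarrow> (\<integral>x. u x \<bullet> frechet_derivative \<psi> (at x) i \<partial>?M)"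
      by (rule L2_tendsto_inner[OF \<phi>_sq(1) u(1) test_sq_int(1)[OF bounded_open_borel test_functions_derivative[OF \<psi>]] u(2)])
    moreover have "(\<lambda>n. - (\<integral>x. gradient (\<phi> n) x \<bullet> (\<psi> x *\<^sub>R i) \<partial>?M)) \<longlonglongrightarrow> - (\<integral>x. g x \<bullet> (\<psi> x *\<^sub>R i) \<partial>?M)"
      by (rule tendsto_minus, rule L2_tendsto_inner[OF \<phi>_sq(2) g(1) test_sq_int(3)[OF bounded_open_borel \<psi>] g(2)])
    moreover have "(\<integral>x. \<phi> n x \<bullet> frechet_derivative \<psi> (at x) i \<partial>?M) = - (\<integral>x. gradient (\<phi> n) x \<bullet> (\<psi> x *\<^sub>R i) \<partial>?M)" for n
    proof -
      note \<psi>D = test_functionsD[OF \<psi>] and \<phi>D = test_functionsD[OF \<phi>[of n]]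
      have z: "\<psi> x = 0" if "x \<notin> \<Omega>" for x
        using that \<psi>D(3) notin_supp_imp_zero[of x \<psi>] by auto
      have z': "\<phi> n x = 0" if "x \<notin> \<Omega>" for x
        using that \<phi>D(3) notin_supp_imp_zero[of x "\<phi> n"] by auto
      have "(\<integral>x. \<phi> n x * frechet_derivative \<psi> (at x) i \<partial>?M) = (\<integral>x. \<phi> n x * frechet_derivative \<psi> (at x) i \<partial>lborel)"
        by (intro integral_lebesgue_on_continuous bounded_open_borel continuous_on_mult
             C_k_imp_continuous[OF \<phi>D(1)] C_1_continuous_derivative \<psi>D(1)) (simp add: z')
      moreover have "(\<integral>x. frechet_derivative (\<phi> n) (at x) i * \<psi> x \<partial>?M) = (\<integral>x. frechet_derivative (\<phi> n) (at x) i * \<psi> x \<partial>lborel)"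
        by (intro integral_lebesgue_on_continuous bounded_open_borel continuous_on_mult
             C_k_imp_continuous[OF \<psi>D(1)] C_1_continuous_derivative \<phi>D(1)) (simp add: z)
      ultimately show ?thesis
        using integral_test_by_parts[OF \<phi> \<psi>, of n i] gradient_inner[OF \<phi>D(1)]
        by (simp add: mult.commute)
    qed
    ultimately have "(\<integral>x. u x \<bullet> frechet_derivative \<psi> (at x) i \<partial>?M) = - (\<integral>x. g x \<bullet> (\<psi> x *\<^sub>R i) \<partial>?M)"
      using LIMSEQ_unique by (simp only:)
    then show ?thesis
      by (simp add: mult.commute)
  qed
  then have H1: "has_H1_gradient \<Omega> u g"
    using u(1) g(1) by (simp add: has_H1_gradient_iff)
  have "(\<lambda>n. (\<integral>x. (norm (\<phi> n x - u x))\<^sup>2 \<partial>?M) + (\<integral>x. (norm (gradient (\<phi> n) x - g x))\<^sup>2 \<partial>?M)) \<longlonglongrightarrow> 0 + 0"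
    by (intro tendsto_add u g)
  then have H10: "u \<in> H10 \<Omega>"
    unfolding H10_def using H1 \<phi> by (auto intro!: exI[of _ g] exI[of _ \<phi>])
  have "integral\<^sup>L ?M (\<lambda>x. g x \<bullet> gradient \<psi> x) = integral\<^sup>L ?M \<psi>" if \<psi>: "\<psi> \<in> test_functions \<Omega>" for \<psi>
  proof -
    let ?E = "\<integral>x. (norm (gradient \<psi> x))\<^sup>2 \<partial>?M"
    have "integral\<^sup>L ?M \<psi> - integral\<^sup>L ?M (\<lambda>x. g x \<bullet> gradient \<psi> x) = 0"
    proof (rule quadratic_le_imp_zero)
      fix t :: real
      have limJ: "(\<lambda>n. torsion_energy (\<phi> n)) \<longlonglongrightarrow> S"
      proof (rule tendsto_sandwich[OF _ _ _ tendsto_const])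
        show "(\<lambda>n. S - inverse (real (Suc n))) \<longlonglongrightarrow> S"
          using tendsto_diff[OF tendsto_const[of S] LIMSEQ_inverse_real_of_nat] by simp
        show "\<forall>\<^sub>F n in sequentially. S - inverse (real (Suc n)) \<le> torsion_energy (\<phi> n)"
          using near by (intro always_eventually allI less_imp_le)
        show "\<forall>\<^sub>F n in sequentially. torsion_energy (\<phi> n) \<le> S"
          using le_S[OF \<phi>] by (intro always_eventually allI)
      qed
      have limB: "(\<lambda>n. \<integral>x. gradient (\<phi> n) x \<bullet> gradient \<psi> x \<partial>?M) \<longlonglongrightarrow> (\<integral>x. g x \<bullet> gradient \<psi> x \<partial>?M)"
        by (rule L2_tendsto_inner[OF \<phi>_sq(2) g(1) test_sq_int(2)[OF bounded_open_borel \<psi>] g(2)])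
      have "(\<lambda>n. torsion_energy (\<phi> n) + 2 * t * (integral\<^sup>L ?M \<psi> - (\<integral>x. gradient (\<phi> n) x \<bullet> gradient \<psi> x \<partial>?M)) - t\<^sup>2 * ?E)
          \<longlonglongrightarrow> S + 2 * t * (integral\<^sup>L ?M \<psi> - (\<integral>x. g x \<bullet> gradient \<psi> x \<partial>?M)) - t\<^sup>2 * ?E"
        by (intro tendsto_intros limJ limB)
      then have "S + 2 * t * (integral\<^sup>L ?M \<psi> - (\<integral>x. g x \<bullet> gradient \<psi> x \<partial>?M)) - t\<^sup>2 * ?E \<le> S"
      proof (rule LIMSEQ_le_const2, intro exI allI impI)
        fix n
        have "torsion_energy (\<lambda>x. \<phi> n x + t * \<psi> x) \<le> S"
          by (intro le_S test_functions_add_scaled \<phi> \<psi>)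
        then show "torsion_energy (\<phi> n) + 2 * t * (integral\<^sup>L ?M \<psi> - (\<integral>x. gradient (\<phi> n) x \<bullet> gradient \<psi> x \<partial>?M)) - t\<^sup>2 * ?E \<le> S"
          by (simp only: torsion_energy_add_scaled[OF bounded_open_borel \<phi> \<psi> fin'])
      qed
      then show "2 * t * (integral\<^sup>L ?M \<psi> - integral\<^sup>L ?M (\<lambda>x. g x \<bullet> gradient \<psi> x)) \<le> t\<^sup>2 * ?E"
        by linarith
    qed simp
    then show ?thesis by simp
  qed
  with H1 H10 show ?thesis
    unfolding torsion_function_def by blast
qed

lemma torsional_rigidity_eq_SUP: "torsional_rigidity \<Omega> = (SUP \<phi>\<in>test_functions \<Omega>. torsion_energy \<phi>)"
proof -
  obtain u where u: "torsion_function \<Omega> u"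
    using torsion_function_exists by blast
  show ?thesis
    unfolding torsional_rigidity_def
  proof (rule the_equality)
    show "\<exists>u. torsion_function \<Omega> u \<and> (SUP \<phi>\<in>test_functions \<Omega>. torsion_energy \<phi>) = integral\<^sup>L (lebesgue_on \<Omega>) u"
      using u torsion_function_integral by (intro exI[of _ u]) simp
  qed (use torsion_function_integral in auto)
qed

lemma torsion_energy_le_rigidity:
  assumes "\<phi> \<in> test_functions \<Omega>"
  shows "torsion_energy \<phi> \<le> torsional_rigidity \<Omega>"
  unfolding torsional_rigidity_eq_SUP by (rule cSUP_upper[OF assms torsion_energy_bdd_above])

lemma torsional_rigidity_leI:
  assumes "\<And>\<phi>. \<phi> \<in> test_functions \<Omega> \<Longrightarrow> torsion_energy \<phi> \<le> c"
  shows "torsional_rigidity \<Omega> \<le> c"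
  unfolding torsional_rigidity_eq_SUP by (rule cSUP_least) (use assms test_functions_zero in auto)

end

lemma torsional_rigidity_mono:
  assumes "open A" "open B" "bounded B" "A \<subseteq> B"
  shows "torsional_rigidity A \<le> torsional_rigidity B"
  using assms test_functions_mono[OF assms(4)]
  by (intro torsional_rigidity_leI torsion_energy_le_rigidity) (auto intro: bounded_subset)

lemma torsional_rigidity_upper_bound:
  assumes "open \<Omega>" "bounded \<Omega>" "a \<noteq> 0" "\<And>x. x \<in> \<Omega> \<Longrightarrow> \<bar>a \<bullet> (x - z)\<bar> \<le> 1"
  shows "torsional_rigidity \<Omega> \<le> measure lborel \<Omega> / (norm a)\<^sup>2"
  by (rule torsional_rigidity_leI[OF assms(1,2)])
    (rule torsion_energy_le[OF bounded_open_borel[OF assms(1,2)] _ assms(3,4) bounded_open_finite_measure[OF assms(1,2)]])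



section \<open>Rigidity under similarities\<close>

lemma open_bounded_affine:
  fixes \<Omega> :: "'a::euclidean_space set"
  assumes "open \<Omega>" "bounded \<Omega>" "c > 0"
  shows "open ((\<lambda>x. a + c *\<^sub>R x) ` \<Omega>)" "bounded ((\<lambda>x. a + c *\<^sub>R x) ` \<Omega>)"
proof -
  show "open ((\<lambda>x. a + c *\<^sub>R x) ` \<Omega>)"
    using open_affinity[OF assms(1), of c a] assms(3) by simp
  show "bounded ((\<lambda>x. a + c *\<^sub>R x) ` \<Omega>)"
    using bounded_translation[OF bounded_scaling[OF assms(2), of c], of a] by (simp add: image_image)
qed

text \<open>The test function \<open>\<phi>\<close> on the image corresponds to \<open>c\<^sup>-\<^sup>2 \<phi>(a + c x)\<close>; this factor makes the linear
  and the quadratic part of the energy scale by the same power of \<open>c\<close>.\<close>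

lemma torsional_rigidity_affine_le:
  fixes \<Omega> :: "'a::euclidean_space set"
  assumes "open \<Omega>" "bounded \<Omega>" "c > 0"
  shows "torsional_rigidity ((\<lambda>x. a + c *\<^sub>R x) ` \<Omega>) \<le> c ^ (DIM('a) + 2) * torsional_rigidity \<Omega>"
proof (rule torsional_rigidity_leI[OF open_bounded_affine[OF assms]])
  fix \<phi> assume \<phi>: "\<phi> \<in> test_functions ((\<lambda>x. a + c *\<^sub>R x) ` \<Omega>)"
  note \<phi>D = test_functionsD[OF \<phi>]
  have C: "C_k 1 \<phi>" by (rule \<phi>D)
  let ?\<psi>0 = "\<lambda>x. \<phi> (a + c *\<^sub>R x)"
  define \<psi> where "\<psi> x = (1 / c\<^sup>2) * ?\<psi>0 x" for x
  have C0: "C_k k ?\<psi>0" for k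
    by (intro C_k_affine \<phi>D bounded_linear_scaleR_right)
  have "(\<lambda>y. (1/c) *\<^sub>R (y - a)) ` supp \<phi> \<subseteq> \<Omega>"
    using \<phi>D(3) assms(3) by auto
  then have "?\<psi>0 \<in> test_functions \<Omega>"
    unfolding test_functions_def using C0 supp_affine[OF \<phi>D(2), of c a] assms(3) by auto
  then have \<psi>: "\<psi> \<in> test_functions \<Omega>"
    unfolding \<psi>_def by (rule test_functions_scaled)
  have gr: "gradient \<psi> x = (1 / c) *\<^sub>R gradient \<phi> (a + c *\<^sub>R x)" for x
  proof -
    have "gradient ?\<psi>0 x = c *\<^sub>R gradient \<phi> (a + c *\<^sub>R x)"
      by (simp add: gradient_def frechet_derivative_affine[OF C] scaleR_sum_right)
    then show ?thesis
      unfolding \<psi>_def gradient_scaled[OF C0] using assms(3) by (simp add: power2_eq_square)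
  qed
  have [measurable]: "\<phi> \<in> borel_measurable borel" "(\<lambda>x. (norm (gradient \<phi> x))\<^sup>2) \<in> borel_measurable borel"
    by (intro borel_measurable_continuous_onI continuous_intros gradient_continuous C_k_imp_continuous[OF C] C)+
  have 1: "integral\<^sup>L lborel \<phi> = c ^ (DIM('a) + 2) * integral\<^sup>L lborel \<psi>"
    unfolding \<psi>_def using assms(3)
    by (subst lborel_integral_affine[of c \<phi> a]) (simp_all add: power_add power2_eq_square)
  have 2: "(\<integral>x. (norm (gradient \<phi> x))\<^sup>2 \<partial>lborel) = c ^ (DIM('a) + 2) * (\<integral>x. (norm (gradient \<psi> x))\<^sup>2 \<partial>lborel)"
    unfolding gr using assms(3)
    by (subst lborel_integral_affine[of c _ a]) (simp_all add: power_add power_divide power2_eq_square[of c])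
  have "torsion_energy \<phi> = c ^ (DIM('a) + 2) * torsion_energy \<psi>"
    unfolding torsion_energy_def 1 2 by (simp add: algebra_simps)
  also have "\<dots> \<le> c ^ (DIM('a) + 2) * torsional_rigidity \<Omega>"
    using assms(3) by (intro mult_left_mono torsion_energy_le_rigidity assms \<psi>) auto
  finally show "torsion_energy \<phi> \<le> c ^ (DIM('a) + 2) * torsional_rigidity \<Omega>" .
qed

lemma affine_inverse:
  fixes \<Omega> :: "'a::real_vector set"
  assumes "c \<noteq> 0"
  shows "(\<lambda>x. - (1/c) *\<^sub>R a + (1/c) *\<^sub>R x) ` (\<lambda>x. a + c *\<^sub>R x) ` \<Omega> = \<Omega>"
  using assms by (simp add: image_image algebra_simps)

lemma torsional_rigidity_affine:
  fixes \<Omega> :: "'a::euclidean_space set"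
  assumes "open \<Omega>" "bounded \<Omega>" "c > 0"
  shows "torsional_rigidity ((\<lambda>x. a + c *\<^sub>R x) ` \<Omega>) = c ^ (DIM('a) + 2) * torsional_rigidity \<Omega>"
proof (rule antisym)
  let ?g = "(\<lambda>x. a + c *\<^sub>R x) ` \<Omega>"
  have "torsional_rigidity ((\<lambda>x. - (1/c) *\<^sub>R a + (1/c) *\<^sub>R x) ` ?g) \<le> (1/c) ^ (DIM('a) + 2) * torsional_rigidity ?g"
    by (rule torsional_rigidity_affine_le[OF open_bounded_affine[OF assms]]) (use assms(3) in simp)
  then have "torsional_rigidity \<Omega> \<le> (1/c) ^ (DIM('a) + 2) * torsional_rigidity ?g"
    using assms(3) by (subst (asm) affine_inverse) auto
  then have "c ^ (DIM('a) + 2) * torsional_rigidity \<Omega> \<le> c ^ (DIM('a) + 2) * ((1/c) ^ (DIM('a) + 2) * torsional_rigidity ?g)"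
    using assms(3) by (intro mult_left_mono) auto
  also have "\<dots> = torsional_rigidity ?g"
    using assms(3) by (simp add: power_divide)
  finally show "c ^ (DIM('a) + 2) * torsional_rigidity \<Omega> \<le> torsional_rigidity ?g" .
qed (rule torsional_rigidity_affine_le[OF assms])

section \<open>A lower bound for the rigidity\<close>

lemma exp_bump_bounded:
  obtains B where "0 < B" "\<And>t. t \<le> 1 \<Longrightarrow> \<bar>exp_bump p t\<bar> \<le> B"
proof -
  have "continuous_on {0..1} (exp_bump p)"
    using exp_bump_has_derivative by (meson DERIV_isCont continuous_at_imp_continuous_on)
  then have "bounded (exp_bump p ` {0..1})"
    by (intro compact_imp_bounded compact_continuous_image) auto
  then obtain B where B: "0 < B" "\<And>t. t \<in> {0..1} \<Longrightarrow> \<bar>exp_bump p t\<bar> \<le> B"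
    by (auto simp: bounded_pos)
  have "\<bar>exp_bump p t\<bar> \<le> B" if "t \<le> 1" for t
    using that B by (cases "0 \<le> t") (auto simp: exp_bump_def)
  with B that show ?thesis
    by blast
qed

text \<open>In the coordinates \<open>y = M (x - z)\<close> the domain contains the open cube whose edges are the
  intervals from 0 to the reciprocal of the dimension, and it lies in the cube of all \<open>y\<close> with
  entries between -1 and 1. The row \<open>i\<close> of \<open>M\<close> has the norm \<open>1 / h\<close>, where \<open>2 h\<close> is
  the distance between the two faces on which coordinate \<open>i\<close> is 1 or -1.\<close>

definition comparable_parallelepiped :: "real^'n^'n \<Rightarrow> real^'n \<Rightarrow> (real^'n) set \<Rightarrow> bool" where
  "comparable_parallelepiped M z \<Omega> \<longleftrightarrow> invertible M \<and>
     (\<forall>x\<in>\<Omega>. \<forall>i. \<bar>(M *v (x - z)) $ i\<bar> \<le> 1) \<and>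
     (\<forall>x. (\<forall>i. 0 < (M *v (x - z)) $ i \<and> (M *v (x - z)) $ i < 1 / CARD('n)) \<longrightarrow> x \<in> \<Omega>)"

text \<open>The bump \<open>exp(-1/f)\<close>, where \<open>1/16 - f\<close> is the squared distance to the centre of the inner cube in the
  coordinates \<open>d y\<close>, is a test function on the domain. Its gradient is bounded by a constant times \<open>L\<close>, and
  it is bounded below on a smaller cube \<open>Q\<close>, which occupies a fixed fraction of the volume because the
  domain fits into a homothetic image of \<open>Q\<close>. Choosing the best multiple \<open>t\<close> of the bump yields the
  bound.\<close>

lemma torsional_rigidity_lower_bound:
  "\<exists>c>0. \<forall>(\<Omega> :: (real^'n::finite) set) M z L. open \<Omega> \<longrightarrow> bounded \<Omega> \<longrightarrow>
     comparable_parallelepiped M z \<Omega> \<longrightarrow> 0 < L \<longrightarrow> (\<forall>i. norm (M $ i) \<le> L) \<longrightarrow>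
     c * measure lborel \<Omega> / L\<^sup>2 \<le> torsional_rigidity \<Omega>"
proof -
  define d where "d = real CARD('n)"
  have d: "1 \<le> d"
    by (simp add: d_def Suc_le_eq)
  define p where "p = monom 1 2 * (1 - pderiv 1 :: real poly)"
  obtain B where B: "0 < B" "\<And>t. t \<le> 1 \<Longrightarrow> \<bar>exp_bump p t\<bar> \<le> B"
    using exp_bump_bounded by metis
  define \<beta> where "\<beta> = exp_bump 1 (1/32)"
  have \<beta>: "0 < \<beta>"
    by (simp add: \<beta>_def exp_bump_def)
  define \<kappa> where "\<kappa> = (1 / (8 * d\<^sup>2)) ^ CARD('n)"
  have \<kappa>: "0 < \<kappa>"
    using d by (simp add: \<kappa>_def)
  define c where "c = (\<beta> * \<kappa>)\<^sup>2 / (B * d\<^sup>2 / 2)\<^sup>2"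
  have c: "0 < c"
    using \<beta> \<kappa> B d by (simp add: c_def)
  have "c * measure lborel \<Omega> / L\<^sup>2 \<le> torsional_rigidity \<Omega>"
    if \<Omega>: "open \<Omega>" "bounded \<Omega>" and comp: "comparable_parallelepiped M z \<Omega>"
      and L: "0 < L" "\<And>i. norm (M $ i) \<le> L"
    for \<Omega> :: "(real^'n) set" and M z L
  proof -
    have M: "invertible M"
      and out: "\<And>x i. x \<in> \<Omega> \<Longrightarrow> \<bar>(M *v (x - z)) $ i\<bar> \<le> 1"
      and inn: "\<And>x. (\<forall>i. 0 < (M *v (x - z)) $ i \<and> (M *v (x - z)) $ i < 1 / CARD('n)) \<Longrightarrow> x \<in> \<Omega>"
      using comp unfolding comparable_parallelepiped_def by auto
    define y where "y i x = M $ i \<bullet> (x - z)" for i x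
    define f where "f x = 1/16 - (\<Sum>i\<in>UNIV. (d * y i x - 1/2) * (d * y i x - 1/2))" for x
    define \<phi> where "\<phi> x = exp_bump 1 (f x)" for x
    have yC: "C_k k (y i)" for k i
      unfolding y_def[abs_def] by (rule C_1_affine_form)
    have fC: "C_k k f" for k
      unfolding f_def[abs_def] by (intro C_k_diff C_k_sum C_k_mult C_k_const yC) auto
    have \<phi>C: "C_k k \<phi>" for k
      unfolding \<phi>_def[abs_def] by (rule C_k_exp_bump_compose[OF fC])
    have f_d: "(f has_derivative (\<lambda>v. - (\<Sum>i\<in>UNIV. 2 * (d * y i x - 1/2) * (d * (M $ i \<bullet> v))))) (at x)" for x
      unfolding f_def[abs_def] y_def
      by (auto intro!: derivative_eq_intros simp: algebra_simps)
    have \<phi>_d: "frechet_derivative \<phi> (at x) v = exp_bump p (f x) * - (\<Sum>i\<in>UNIV. 2 * (d * y i x - 1/2) * (d * (M $ i \<bullet> v)))" for x v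
    proof -
      have "(\<phi> has_derivative (\<lambda>v. exp_bump p (f x) * - (\<Sum>i\<in>UNIV. 2 * (d * y i x - 1/2) * (d * (M $ i \<bullet> v))))) (at x)"
        unfolding \<phi>_def[abs_def] p_def
        by (rule has_derivative_compose[OF f_d exp_bump_has_derivative[unfolded has_field_derivative_def]])
      then show ?thesis
        by (rule frechet_derivative_eqI)
    qed
    \<comment> \<open>A cube that contains the support of the bump: \<open>d y\<close> is between 1/4 and 3/4 in each coordinate.\<close>
    define K where "K = {x. \<forall>i. \<bar>d * y i x - 1/2\<bar> \<le> 1/4}"
    have in_K: "x \<in> K" if "0 < f x" for x
      unfolding K_def
    proof safe
      fix i
      have "(d * y i x - 1/2) * (d * y i x - 1/2) \<le> (\<Sum>i\<in>UNIV. (d * y i x - 1/2) * (d * y i x - 1/2))"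
        by (rule member_le_sum) auto
      also have "\<dots> < 1/16"
        using that by (simp add: f_def)
      finally have "\<bar>d * y i x - 1/2\<bar>\<^sup>2 \<le> (1/4)\<^sup>2"
        by (simp add: power2_eq_square)
      then show "\<bar>d * y i x - 1/2\<bar> \<le> 1/4"
        by (rule power2_le_imp_le) simp
    qed
    have \<phi>0: "\<phi> x = 0" if "x \<notin> K" for x
      using in_K[of x] that by (auto simp: \<phi>_def exp_bump_def)
    have "closed K"
      unfolding K_def
      by (intro closed_Collect_all closed_Collect_le continuous_intros C_k_imp_continuous[OF yC])
    have K\<Omega>: "K \<subseteq> \<Omega>"
    proof
      fix x assume x: "x \<in> K"
      have "0 < y i x \<and> y i x < 1 / d" for i
      proof -
        have "\<bar>d * y i x - 1/2\<bar> \<le> 1/4"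
          using x by (simp add: K_def)
        then have "0 < d * y i x" "d * y i x < 1"
          by linarith+
        then show ?thesis
          using d by (simp add: field_simps zero_less_mult_iff)
      qed
      then show "x \<in> \<Omega>"
        by (intro inn) (simp add: y_def d_def matrix_vector_mul_component)
    qed
    have "bounded K"
      by (rule bounded_subset[OF \<Omega>(2) K\<Omega>])
    with \<open>closed K\<close> have K: "compact K"
      by (simp add: compact_eq_bounded_closed)
    have \<phi>: "\<phi> \<in> test_functions \<Omega>"
      unfolding test_functions_def
      using \<phi>C compact_supp_minimal[of K \<phi>, OF K \<phi>0] supp_minimal[of K \<phi>, OF \<open>closed K\<close> \<phi>0] K\<Omega> by blast
    define G where "G = (B * d\<^sup>2 / 2) * L"
    have G: "0 < G"
      using B d L by (simp add: G_def)
    have grad: "norm (gradient \<phi> x) \<le> G" for x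
    proof (cases "x \<in> K")
      case True
      have y_le: "\<bar>2 * (d * y i x - 1/2) * (d * (M $ i \<bullet> v))\<bar> \<le> (1/2) * (d * (L * norm v))" for i v
      proof -
        have "\<bar>d * y i x - 1/2\<bar> \<le> 1/4"
          using True by (simp add: K_def)
        moreover have "\<bar>M $ i \<bullet> v\<bar> \<le> L * norm v"
          using Cauchy_Schwarz_ineq2[of "M $ i" v] L(2)[of i] mult_right_mono[of "norm (M $ i)" L "norm v"] by simp
        ultimately show ?thesis
          unfolding abs_mult using d by (intro mult_mono) auto
      qed
      let ?g = "gradient \<phi> x"
      have f1: "f x \<le> 1"
        unfolding f_def by (rule order_trans[of _ "1/16"]) (auto intro!: sum_nonneg)
      have sum_le: "\<bar>\<Sum>i\<in>UNIV. 2 * (d * y i x - 1/2) * (d * (M $ i \<bullet> ?g))\<bar> \<le> (\<Sum>i\<in>(UNIV::'n set). (1/2) * (d * (L * norm ?g)))"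
      proof -
        have "(\<Sum>i\<in>UNIV. \<bar>2 * (d * y i x - 1/2) * (d * (M $ i \<bullet> ?g))\<bar>) \<le> (\<Sum>i\<in>(UNIV::'n set). (1/2) * (d * (L * norm ?g)))"
          by (intro sum_mono y_le)
        with sum_abs show ?thesis
          by (rule order_trans)
      qed
      have "norm ?g * norm ?g = \<bar>?g \<bullet> ?g\<bar>"
        by (simp add: dot_square_norm power2_eq_square)
      also have "\<dots> = \<bar>exp_bump p (f x)\<bar> * \<bar>\<Sum>i\<in>UNIV. 2 * (d * y i x - 1/2) * (d * (M $ i \<bullet> ?g))\<bar>"
        by (simp add: gradient_inner[OF \<phi>C] \<phi>_d abs_mult)
      also have "\<dots> \<le> B * (\<Sum>i\<in>(UNIV::'n set). (1/2) * (d * (L * norm ?g)))"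
        by (rule mult_mono[OF B(2)[OF f1] sum_le]) (use B in auto)
      also have "\<dots> = G * norm ?g"
        by (simp add: G_def d_def power2_eq_square)
      finally show ?thesis
        using G by (cases "norm ?g = 0") (auto simp: mult_le_cancel_right)
    next
      case False
      then have "x \<notin> supp \<phi>"
        using supp_minimal[of K \<phi>, OF \<open>closed K\<close> \<phi>0] by blast
      then show ?thesis
        using G by (simp add: gradient_vanishes)
    qed
    have \<Omega>b [measurable]: "\<Omega> \<in> sets borel"
      using \<Omega> by simp
    note fin = bounded_open_finite_measure[OF \<Omega>]
    define E where "E = (\<integral>x. (norm (gradient \<phi> x))\<^sup>2 \<partial>lborel)"
    have "E \<le> (\<integral>x. G\<^sup>2 * indicator \<Omega> x \<partial>lborel)"
      unfolding E_def
    proof (rule integral_mono)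
      show "integrable lborel (\<lambda>x. (norm (gradient \<phi> x))\<^sup>2)"
        by (rule integrable_C_compact_supp[OF _ test_functionsD(2)[OF \<phi>]])
          (auto intro!: continuous_intros gradient_continuous \<phi>C simp: gradient_vanishes simp del: One_nat_def C_k.simps)
      show "integrable lborel (\<lambda>x. G\<^sup>2 * indicator \<Omega> x)"
        using fin by (intro integrable_mult_right integrable_real_indicator) auto
      show "(norm (gradient \<phi> x))\<^sup>2 \<le> G\<^sup>2 * indicator \<Omega> x" for x
      proof (cases "x \<in> \<Omega>")
        case True
        then show ?thesis
          using grad[of x] by (simp add: power_mono)
      next
        case False
        then have "x \<notin> supp \<phi>"
          using test_functionsD(3)[OF \<phi>] by blast
        then show ?thesis
          by (simp add: gradient_vanishes)
      qed
    qed
    then have E: "E \<le> G\<^sup>2 * measure lborel \<Omega>"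
      by simp
    \<comment> \<open>The half-side \<open>1 / (8 d)\<close> keeps the sum of \<open>d\<close> squares below 1/32, so that \<open>f \<ge> 1/32\<close> on \<open>Q\<close>.\<close>
    define Q where "Q = {x. \<forall>i. \<bar>d * y i x - 1/2\<bar> \<le> 1/(8*d)}"
    have "closed Q"
      unfolding Q_def
      by (intro closed_Collect_all closed_Collect_le continuous_intros C_k_imp_continuous[OF yC])
    then have Qb [measurable]: "Q \<in> sets borel"
      by simp
    have QK: "Q \<subseteq> K"
    proof -
      have le: "1 / (8 * d) \<le> 1 / 4"
        using d by (simp add: field_simps)
      show ?thesis
        unfolding Q_def K_def by (intro Collect_mono impI allI order_trans[OF _ le]) (erule spec)
    qed
    have finQ: "emeasure lborel Q < \<infinity>"
      using fin QK K\<Omega> by (intro le_less_trans[OF emeasure_mono[of Q \<Omega>]]) auto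
    have \<phi>_Q: "\<beta> \<le> \<phi> x" if "x \<in> Q" for x
    proof -
      have "(\<Sum>i\<in>UNIV. (d * y i x - 1/2) * (d * y i x - 1/2)) \<le> (\<Sum>i\<in>(UNIV::'n set). (1/(8*d))\<^sup>2)"
      proof (rule sum_mono)
        fix i
        have "\<bar>d * y i x - 1/2\<bar> \<le> 1/(8*d)"
          using that by (simp add: Q_def)
        then have "\<bar>d * y i x - 1/2\<bar>\<^sup>2 \<le> (1/(8*d))\<^sup>2"
          by (intro power_mono) auto
        then show "(d * y i x - 1/2) * (d * y i x - 1/2) \<le> (1/(8*d))\<^sup>2"
          by (simp add: power2_eq_square)
      qed
      also have "\<dots> = 1 / (64 * d)"
        using d by (simp add: d_def power2_eq_square field_simps)
      also have "\<dots> \<le> 1/32"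
        using d by (simp add: field_simps)
      finally have "1/32 \<le> f x"
        by (simp add: f_def)
      then show ?thesis
        unfolding \<beta>_def \<phi>_def by (rule exp_bump_mono)
    qed
    define I where "I = integral\<^sup>L lborel \<phi>"
    have "(\<integral>x. \<beta> * indicator Q x \<partial>lborel) \<le> I"
      unfolding I_def
    proof (rule integral_mono)
      show "integrable lborel (\<lambda>x. \<beta> * indicator Q x)"
        using finQ by (intro integrable_mult_right integrable_real_indicator) auto
      show "integrable lborel \<phi>"
        using integrable_test_mult[OF \<phi>, of "\<lambda>_. 1"] by simp
      show "\<beta> * indicator Q x \<le> \<phi> x" for x
        using \<phi>_Q[of x] by (auto simp: indicator_def \<phi>_def exp_bump_def)
    qed
    then have I1: "\<beta> * measure lborel Q \<le> I"
      by simp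
    have \<kappa>Q: "\<kappa> * measure lborel \<Omega> \<le> measure lborel Q"
    proof -
      obtain N where N: "M ** N = mat 1"
        using M unfolding invertible_def by blast
      define w where "w = N *v (\<chi> i. 1 / (2 * d))"
      have Mw: "M *v w = (\<chi> i. 1 / (2 * d))"
        by (simp add: w_def matrix_vector_mul_assoc N)
      \<comment> \<open>The homothety with ratio \<open>s\<close> that maps the cube around the domain onto \<open>Q\<close>.\<close>
      define s where "s = 1 / (8 * d\<^sup>2)"
      have s: "0 < s"
        using d by (simp add: s_def)
      let ?a = "z + w - s *\<^sub>R z"
      have yw: "M $ i \<bullet> w = 1 / (2 * d)" for i
        using Mw matrix_vector_mul_component[of M w i] by simp
      have "(\<lambda>x. ?a + s *\<^sub>R x) ` \<Omega> \<subseteq> Q"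
      proof safe
        fix x assume x: "x \<in> \<Omega>"
        have "\<bar>d * y i (?a + s *\<^sub>R x) - 1/2\<bar> \<le> 1/(8*d)" for i
        proof -
          have "?a + s *\<^sub>R x - z = w + s *\<^sub>R (x - z)"
            by (simp add: algebra_simps)
          then have "y i (?a + s *\<^sub>R x) = 1 / (2 * d) + s * y i x"
            by (simp add: y_def inner_add_right yw)
          then have "d * y i (?a + s *\<^sub>R x) - 1/2 = (1 / (8 * d)) * y i x"
            using d by (simp add: s_def power2_eq_square field_simps)
          moreover have "\<bar>y i x\<bar> \<le> 1"
            using out[OF x, of i] by (simp add: y_def matrix_vector_mul_component)
          ultimately show ?thesis
            using d mult_left_mono[of "\<bar>y i x\<bar>" 1 "1 / (8 * d)"] by (simp add: abs_mult)
        qed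
        then show "?a + s *\<^sub>R x \<in> Q"
          by (simp add: Q_def)
      qed
      then have "measure lborel ((\<lambda>x. ?a + s *\<^sub>R x) ` \<Omega>) \<le> measure lborel Q"
        using finQ affine_image_borel[OF _ \<Omega>b, of s ?a] s
        by (intro measure_mono_fmeasurable) (auto simp: fmeasurable_def)
      then show ?thesis
        using measure_affine_image[OF s \<Omega>b, of ?a] by (simp add: \<kappa>_def s_def)
    qed
    have "\<beta> * (\<kappa> * measure lborel \<Omega>) \<le> \<beta> * measure lborel Q"
      using \<kappa>Q \<beta> by (intro mult_left_mono) auto
    with I1 have I: "\<beta> * \<kappa> * measure lborel \<Omega> \<le> I"
      by (simp only: mult.assoc)
    \<comment> \<open>The maximum of \<open>2 t \<beta> \<kappa> - t\<^sup>2 G\<^sup>2\<close>.\<close>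
    define t where "t = \<beta> * \<kappa> / G\<^sup>2"
    have t: "0 \<le> t"
      using \<beta> \<kappa> by (simp add: t_def)
    have "c * measure lborel \<Omega> / L\<^sup>2 = (2 * t * (\<beta> * \<kappa>) - t\<^sup>2 * G\<^sup>2) * measure lborel \<Omega>"
      using G L B d by (simp add: t_def c_def G_def power2_eq_square field_simps)
    also have "\<dots> = 2 * t * (\<beta> * \<kappa> * measure lborel \<Omega>) - t\<^sup>2 * (G\<^sup>2 * measure lborel \<Omega>)"
      by (simp add: algebra_simps)
    also have "\<dots> \<le> 2 * t * I - t\<^sup>2 * E"
      using I E t by (intro diff_mono mult_left_mono) auto
    also have "\<dots> = torsion_energy (\<lambda>x. t * \<phi> x)"
      unfolding torsion_energy_scaled[OF \<phi>C] I_def E_def ..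
    also have "\<dots> \<le> torsional_rigidity \<Omega>"
      by (intro torsion_energy_le_rigidity \<Omega> test_functions_scaled \<phi>)
    finally show ?thesis .
  qed
  with c show ?thesis
    by (intro exI[of _ c]) blast
qed



section \<open>Inscribed parallelepipeds and diameter of convex sets\<close>

lemma compact_rows:
  fixes C :: "(real^'n::finite) set"
  assumes "compact C"
  shows "compact {A :: real^'n^'m::finite. \<forall>i. A $ i \<in> C}"
proof -
  have "closed {A :: real^'n^'m. A $ i \<in> C}" for i
    using closed_vimage[OF compact_imp_closed[OF assms], of "\<lambda>A :: real^'n^'m. A $ i"]
    by (simp add: vimage_def continuous_on_component continuous_on_id)
  then have "closed {A :: real^'n^'m. \<forall>i. A $ i \<in> C}"
    by (rule closed_Collect_all)
  moreover obtain R where R: "\<And>x. x \<in> C \<Longrightarrow> norm x \<le> R"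
    using compact_imp_bounded[OF assms] by (auto simp: bounded_iff)
  have "bounded {A :: real^'n^'m. \<forall>i. A $ i \<in> C}"
    unfolding bounded_iff
  proof (intro exI ballI)
    fix A :: "real^'n^'m" assume "A \<in> {A. \<forall>i. A $ i \<in> C}"
    then have "(\<Sum>i\<in>UNIV. norm (A $ i)) \<le> (\<Sum>i\<in>(UNIV::'m set). R)"
      using R by (intro sum_mono) auto
    moreover have "norm A \<le> (\<Sum>i\<in>UNIV. norm (A $ i))"
      unfolding norm_vec_def by (rule L2_set_le_sum) auto
    ultimately show "norm A \<le> (\<Sum>i\<in>(UNIV::'m set). R)"
      by linarith
  qed
  ultimately show ?thesis
    by (simp add: compact_eq_bounded_closed)
qed

text \<open>Choose edge vectors from the closure of \<open>\<Omega> - z\<close> that span a parallelepiped of maximal volume. By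
  Cramer's rule the coordinate \<open>i\<close> of a point of the domain is the ratio of two determinants, the
  numerator with edge \<open>i\<close> replaced by the point, so maximality bounds it by 1. The simplex
  spanned by the edges is in the closure of the domain by convexity, and it contains the small cube.\<close>

lemma convex_comparable_parallelepiped:
  fixes \<Omega> :: "(real^'n::finite) set"
  assumes "open \<Omega>" "convex \<Omega>" "bounded \<Omega>" "z \<in> \<Omega>"
  obtains M where "comparable_parallelepiped M z \<Omega>"
proof -
  define C where "C = (\<lambda>x. x - z) ` closure \<Omega>"
  define S where "S = {A :: real^'n^'n. \<forall>i. A $ i \<in> C}"
  have "compact C"
    unfolding C_def using assms(3) by (intro compact_continuous_image continuous_intros) auto
  then have "compact S"
    unfolding S_def by (rule compact_rows)
  moreover have "continuous_on S (\<lambda>A. \<bar>det A\<bar>)"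
    unfolding det_def by (intro continuous_intros)
  moreover obtain e where e: "0 < e" "ball z e \<subseteq> \<Omega>"
    using assms(1,4) open_contains_ball by blast
  have C_ball: "v \<in> C" if "norm v < e" for v
  proof -
    have "z + v \<in> \<Omega>"
      using that e(2) by (auto simp: dist_norm)
    then have "z + v \<in> closure \<Omega>"
      using closure_subset by blast
    then show ?thesis
      unfolding C_def by (intro image_eqI[of _ _ "z + v"]) auto
  qed
  have eS: "mat (e/2) \<in> S"
    unfolding S_def
  proof safe
    fix i :: 'n
    have "mat (e/2) $ i = (e/2) *\<^sub>R (axis i 1 :: real^'n)"
      by (auto simp: mat_def axis_def vec_eq_iff)
    then show "mat (e/2) $ i \<in> C"
      using e by (intro C_ball) simp
  qed
  ultimately obtain V where V: "V \<in> S" "\<And>A. A \<in> S \<Longrightarrow> \<bar>det A\<bar> \<le> \<bar>det V\<bar>"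
    using continuous_attains_sup[of S "\<lambda>A. \<bar>det A\<bar>"] by blast
  have "det (mat (e/2) :: real^'n^'n) = (\<Prod>i\<in>(UNIV::'n set). e/2)"
    by (subst det_diagonal) (auto simp: mat_def)
  moreover have "0 < (e/2) ^ CARD('n)"
    using e(1) by simp
  ultimately have "0 < \<bar>det V\<bar>"
    using V(2)[OF eS] by simp
  then have detV: "det V \<noteq> 0"
    by simp
  then have "invertible (transpose V)"
    by (simp add: invertible_det_nz)
  then obtain M where M: "M ** transpose V = mat 1" "transpose V ** M = mat 1"
    unfolding invertible_def by blast
  have expand: "(\<Sum>i\<in>UNIV. (M *v v) $ i *s (V $ i)) = v" for v
  proof -
    have "v = transpose V *v (M *v v)"
      by (simp only: matrix_vector_mul_assoc M matrix_vector_mul_lid)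
    also have "\<dots> = (\<Sum>i\<in>UNIV. (M *v v) $ i *s column i (transpose V))"
      by (rule matrix_mult_sum)
    finally show ?thesis
      by (simp add: column_def transpose_def)
  qed
  show ?thesis
  proof (rule that, unfold comparable_parallelepiped_def, intro conjI ballI allI impI)
    show "invertible M"
      using M unfolding invertible_def by blast
    fix x i assume "x \<in> \<Omega>"
    define A :: "real^'n^'n" where "A = (\<chi> k. if k = i then x - z else V $ k)"
    have "x - z \<in> C"
      using \<open>x \<in> \<Omega>\<close> closure_subset unfolding C_def by blast
    then have "A \<in> S"
      using V(1) by (simp add: S_def A_def)
    then have "\<bar>det A\<bar> \<le> \<bar>det V\<bar>"
      by (rule V(2))
    moreover have "det A = (M *v (x - z)) $ i * det V"
    proof -
      have row: "row k V = V $ k" for k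
        by (simp add: row_def vec_lambda_eta)
      show ?thesis
        using cramer_lemma_transpose[of i "M *v (x - z)" V] unfolding row expand A_def .
    qed
    ultimately have "\<bar>(M *v (x - z)) $ i\<bar> * \<bar>det V\<bar> \<le> 1 * \<bar>det V\<bar>"
      by (simp add: abs_mult)
    then show "\<bar>(M *v (x - z)) $ i\<bar> \<le> 1"
      using detV by (subst (asm) mult_le_cancel_right_pos) auto
  next
    fix x assume x: "\<forall>i. 0 < (M *v (x - z)) $ i \<and> (M *v (x - z)) $ i < 1 / CARD('n)"
    define U where "U = {x. \<forall>i. 0 < (M *v (x - z)) $ i \<and> (M *v (x - z)) $ i < 1 / CARD('n)}"
    have "open U"
    proof -
      have "U = (\<Inter>i. {x. 0 < (M *v (x - z)) $ i} \<inter> {x. (M *v (x - z)) $ i < 1 / CARD('n)})"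
        by (auto simp: U_def)
      moreover have "continuous_on UNIV (\<lambda>x. (M *v (x - z)) $ i)" for i
        unfolding matrix_vector_mul_component by (intro continuous_intros)
      ultimately show ?thesis
        by (simp add: open_INT open_Int open_Collect_less continuous_on_const)
    qed
    moreover have "U \<subseteq> closure \<Omega>"
    proof
      fix y assume "y \<in> U"
      define l where "l i = (M *v (y - z)) $ i" for i
      have l: "0 < l i" "l i < 1 / CARD('n)" for i
        using \<open>y \<in> U\<close> by (auto simp: U_def l_def)
      have "(\<Sum>i\<in>UNIV. l i) \<le> (\<Sum>i\<in>(UNIV::'n set). 1 / CARD('n))"
        using l by (intro sum_mono less_imp_le)
      then have s: "(\<Sum>i\<in>UNIV. l i) \<le> 1"
        by simp
      have mem: "z + V $ i \<in> closure \<Omega>" for i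
      proof -
        have "V $ i \<in> C"
          using V(1) by (simp add: S_def)
        then obtain w where "w \<in> closure \<Omega>" "V $ i = w - z"
          unfolding C_def by (rule imageE)
        then show ?thesis by simp
      qed
      have zc: "z \<in> closure \<Omega>"
        using assms(4) closure_subset by blast
      \<comment> \<open>A convex combination of the points \<open>z + V $ i\<close> with weights \<open>l i / t\<close>, then one of the result and \<open>z\<close>.\<close>
      define t where "t = (\<Sum>i\<in>UNIV. l i)"
      have t: "0 < t" "t \<le> 1"
        using s l by (auto simp: t_def intro!: sum_pos)
      have "(\<Sum>i\<in>UNIV. (l i / t) *\<^sub>R (z + V $ i)) \<in> closure \<Omega>"
      proof (rule convex_sum)
        show "(\<Sum>i\<in>UNIV. l i / t) = 1"
          using t by (simp add: sum_divide_distrib[symmetric] t_def)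
        show "0 \<le> l i / t" for i
          using l(1)[of i] t by simp
      qed (auto simp: convex_closure assms mem)
      then have "(1 - t) *\<^sub>R z + t *\<^sub>R (\<Sum>i\<in>UNIV. (l i / t) *\<^sub>R (z + V $ i)) \<in> closure \<Omega>"
        using t zc by (intro convexD[OF convex_closure[OF assms(2)]]) auto
      also have "t *\<^sub>R (\<Sum>i\<in>UNIV. (l i / t) *\<^sub>R (z + V $ i)) = (\<Sum>i\<in>UNIV. l i *\<^sub>R (z + V $ i))"
        using t by (simp add: scaleR_sum_right)
      also have "\<dots> = t *\<^sub>R z + (y - z)"
        using expand[of "y - z"]
        by (simp add: scaleR_add_right sum.distrib t_def scaleR_sum_left l_def scalar_mult_eq_scaleR)
      also have "(1 - t) *\<^sub>R z + (t *\<^sub>R z + (y - z)) = y"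
        by (simp add: algebra_simps)
      finally show "y \<in> closure \<Omega>" .
    qed
    ultimately have "U \<subseteq> interior (closure \<Omega>)"
      by (simp add: interior_maximal)
    also have "\<dots> = \<Omega>"
      using convex_interior_closure[OF assms(2)] assms(1) by (simp add: interior_open)
    finally show "x \<in> \<Omega>"
      using x by (auto simp: U_def)
  qed
qed

text \<open>By convexity with the unit ball, the points on the first half of the segment from 0 to \<open>x\<close> are centres
  of balls of radius 1/2 inside the set. Those at distances \<open>0, 1, ..., \<lfloor>norm x / 2\<rfloor>\<close> from 0 are
  disjoint.\<close>

lemma convex_norm_le_measure:
  fixes \<Omega> :: "'a::euclidean_space set"
  assumes "convex \<Omega>" and [measurable]: "\<Omega> \<in> sets borel" and fin: "emeasure lborel \<Omega> < \<infinity>"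
    and ball: "ball 0 1 \<subseteq> \<Omega>" and "x \<in> \<Omega>"
  shows "norm x \<le> 2 * measure lborel \<Omega> / measure lborel (ball (0::'a) (1/2))"
proof (cases "x = 0")
  case False
  define \<beta> where "\<beta> = measure lborel (ball (0::'a) (1/2))"
  have \<beta>: "0 < \<beta>"
    unfolding \<beta>_def using content_ball_pos[of "1/2" "0::'a"] by simp
  define N where "N = nat \<lfloor>norm x / 2\<rfloor>"
  define c where "c k = real k *\<^sub>R (x /\<^sub>R norm x)" for k :: nat
  have N: "real N \<le> norm x / 2" "norm x / 2 < real N + 1"
  proof -
    have "real N = of_int \<lfloor>norm x / 2\<rfloor>"
      by (simp add: N_def)
    then show "real N \<le> norm x / 2" "norm x / 2 < real N + 1"
      by linarith+
  qed
  have sub: "ball (c k) (1/2) \<subseteq> \<Omega>" if "k \<le> N" for k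
  proof
    fix y assume y: "y \<in> ball (c k) (1/2)"
    define t where "t = real k / norm x"
    have t: "0 \<le> t" "t \<le> 1/2"
      using that N(1) False by (auto simp: t_def field_simps)
    have "norm (y - c k) < 1 - t"
      using y t by (auto simp: dist_norm norm_minus_commute)
    then have "norm (y - c k) / (1 - t) < 1"
      using t by (simp add: field_simps)
    moreover have "norm ((1 / (1 - t)) *\<^sub>R (y - c k)) = norm (y - c k) / (1 - t)"
      unfolding norm_scaleR using t by simp
    ultimately have "(1 / (1 - t)) *\<^sub>R (y - c k) \<in> ball 0 1"
      by (simp only: mem_ball_0)
    then have "(1 - t) *\<^sub>R ((1 / (1 - t)) *\<^sub>R (y - c k)) + t *\<^sub>R x \<in> \<Omega>"
      using t ball assms(5) by (intro convexD[OF assms(1)]) auto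
    moreover have "t *\<^sub>R x = c k"
      by (simp add: c_def t_def divide_inverse)
    ultimately show "y \<in> \<Omega>"
      using t by simp
  qed
  have disj: "disjoint_family_on (\<lambda>k. ball (c k) (1/2)) {..N}"
    unfolding disjoint_family_on_def
  proof (intro ballI impI)
    fix j k :: nat assume "j \<noteq> k"
    have "c j - c k = (real j - real k) *\<^sub>R (x /\<^sub>R norm x)"
      by (simp only: c_def scaleR_diff_left)
    moreover have "norm (x /\<^sub>R norm x) = 1"
      using False by simp
    ultimately have "dist (c j) (c k) = \<bar>real j - real k\<bar>"
      by (simp only: dist_norm norm_scaleR) simp
    also have "\<dots> \<ge> 1"
      using \<open>j \<noteq> k\<close> by linarith
    finally show "ball (c j) (1/2) \<inter> ball (c k) (1/2) = {}"
      by (intro disjoint_ballI) simp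
  qed
  have mb: "measure lborel (ball (c k) (1/2)) = \<beta>" for k
    unfolding \<beta>_def using measure_affine_image[of 1 "ball (0::'a) (1/2)" "c k"]
    by (simp add: image_add_ball)
  have bfin: "emeasure lborel (ball (c k) (1/2)) < \<infinity>" for k
    using emeasure_bounded_finite[OF bounded_ball] by (simp add: less_top)
  have "(real N + 1) * \<beta> = (\<Sum>k\<le>N. measure lborel (ball (c k) (1/2)))"
    by (simp add: mb)
  also have "\<dots> = measure lborel (\<Union>k\<le>N. ball (c k) (1/2))"
    using disj bfin by (intro measure_UNION'[symmetric]) (auto simp: fmeasurable_def disjoint_family_on_def pairwise_def disjnt_def)
  also have "\<dots> \<le> measure lborel \<Omega>"
    using sub fin by (intro measure_mono_fmeasurable) (auto simp: fmeasurable_def)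
  finally have "norm x / 2 * \<beta> \<le> measure lborel \<Omega>"
    using N(2) \<beta> mult_right_mono[of "norm x / 2" "real N + 1" \<beta>] by linarith
  then show ?thesis
    using \<beta> by (simp add: \<beta>_def[symmetric] field_simps)
qed simp


section \<open>Compactness of convex sets between two balls\<close>

definition minkowski :: "'a::euclidean_space set \<Rightarrow> 'a \<Rightarrow> real" where
  "minkowski A x = Inf {t. 0 < t \<and> (1/t) *\<^sub>R x \<in> A}"

context
  fixes A :: "'a::euclidean_space set" and R :: real
  assumes A: "open A" "convex A" "ball 0 1 \<subseteq> A" "A \<subseteq> ball 0 R"
begin

lemma minkowski_zero_mem: "0 \<in> A"
  using A(3) by auto

lemma minkowski_radius_pos: "0 < R"
  using minkowski_zero_mem A(4) by auto

lemma minkowski_set: "norm x + 1 \<in> {t. 0 < t \<and> (1/t) *\<^sub>R x \<in> A}" "bdd_below {t. 0 < t \<and> (1/t) *\<^sub>R x \<in> A}"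
proof -
  have pos: "0 < norm x + 1"
    using norm_ge_zero[of x] by linarith
  have "norm ((1 / (norm x + 1)) *\<^sub>R x) = norm x / (norm x + 1)"
    unfolding norm_scaleR using pos by simp
  also have "\<dots> < 1"
    using pos by (simp add: pos_divide_less_eq)
  finally have "(1 / (norm x + 1)) *\<^sub>R x \<in> A"
    using A(3) by auto
  with pos show "norm x + 1 \<in> {t. 0 < t \<and> (1/t) *\<^sub>R x \<in> A}"
    by simp
  show "bdd_below {t. 0 < t \<and> (1/t) *\<^sub>R x \<in> A}"
    by (rule bdd_belowI[of _ 0]) auto
qed

text \<open>From left to right the set is star-shaped about 0. From right to left openness leaves room for a
  slightly larger multiple of the point, which makes the inequality strict.\<close>

lemma minkowski_less_iff:
  assumes "0 < t"
  shows "minkowski A x < t \<longleftrightarrow> (1/t) *\<^sub>R x \<in> A"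
proof
  assume "minkowski A x < t"
  then obtain s where s: "0 < s" "(1/s) *\<^sub>R x \<in> A" "s < t"
    unfolding minkowski_def using cInf_lessD[of "{t. 0 < t \<and> (1/t) *\<^sub>R x \<in> A}" t] minkowski_set(1) by blast
  have "(s/t) *\<^sub>R ((1/s) *\<^sub>R x) + (1 - s/t) *\<^sub>R 0 \<in> A"
    using s assms minkowski_zero_mem by (intro convexD[OF A(2)]) auto
  then show "(1/t) *\<^sub>R x \<in> A"
    using s by simp
next
  assume x: "(1/t) *\<^sub>R x \<in> A"
  define y where "y = (1/t) *\<^sub>R x"
  obtain e where e: "0 < e" "ball y e \<subseteq> A"
    using x A(1) open_contains_ball unfolding y_def by blast
  define m where "m = norm y + 1"
  define \<delta> where "\<delta> = e / (2 * m)"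
  have n1: "0 < m"
    unfolding m_def using norm_ge_zero[of y] by linarith
  then have \<delta>: "0 < \<delta>"
    using e by (simp add: \<delta>_def)
  have "\<delta> * norm y \<le> \<delta> * m"
    using \<delta> by (simp add: m_def)
  also have "\<dots> = e / 2"
    using n1 by (simp add: \<delta>_def)
  finally have "(1 + \<delta>) *\<^sub>R y \<in> ball y e"
    using e \<delta> by (simp add: dist_norm algebra_simps)
  then have "(1 + \<delta>) *\<^sub>R y \<in> A"
    using e by blast
  moreover have "(1 + \<delta>) *\<^sub>R y = (1 / (t / (1 + \<delta>))) *\<^sub>R x"
    by (simp add: y_def)
  ultimately have "minkowski A x \<le> t / (1 + \<delta>)"
    unfolding minkowski_def using assms \<delta> by (intro cInf_lower minkowski_set) simp
  also have "\<dots> < t"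
    using assms \<delta> by (simp add: field_simps)
  finally show "minkowski A x < t" .
qed

lemma minkowski_nonneg: "0 \<le> minkowski A x"
  unfolding minkowski_def by (rule cInf_greatest) (use minkowski_set(1) in auto)

lemma minkowski_le_norm: "minkowski A x \<le> norm x"
proof (rule dense_ge)
  fix t assume t: "norm x < t"
  then have "0 < t"
    using norm_ge_zero[of x] by linarith
  moreover have "norm ((1/t) *\<^sub>R x) < 1"
    using t \<open>0 < t\<close> by simp
  then have "(1/t) *\<^sub>R x \<in> A"
    using A(3) by auto
  ultimately show "minkowski A x \<le> t"
    using minkowski_less_iff[of t x] by simp
qed

lemma norm_le_minkowski: "norm x \<le> R * minkowski A x"
proof -
  have "norm x / R \<le> minkowski A x"
    unfolding minkowski_def
  proof (rule cInf_greatest)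
    fix t assume "t \<in> {t. 0 < t \<and> (1/t) *\<^sub>R x \<in> A}"
    then have "0 < t" "norm ((1/t) *\<^sub>R x) < R"
      using A(4) by auto
    then show "norm x / R \<le> t"
      using minkowski_radius_pos by (simp add: field_simps)
  qed (use minkowski_set(1) in auto)
  then show ?thesis
    using minkowski_radius_pos by (simp add: field_simps)
qed

lemma minkowski_triangle: "minkowski A (x + y) \<le> minkowski A x + minkowski A y"
proof (rule field_le_epsilon)
  fix e :: real assume "0 < e"
  define s where "s = minkowski A x + e/2"
  define t where "t = minkowski A y + e/2"
  have st: "0 < s" "0 < t"
    using minkowski_nonneg[of x] minkowski_nonneg[of y] \<open>0 < e\<close> by (auto simp: s_def t_def)
  have "(1/s) *\<^sub>R x \<in> A" "(1/t) *\<^sub>R y \<in> A"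
    using minkowski_less_iff[OF st(1), of x] minkowski_less_iff[OF st(2), of y] \<open>0 < e\<close>
    by (auto simp: s_def t_def)
  then have "(s/(s+t)) *\<^sub>R ((1/s) *\<^sub>R x) + (t/(s+t)) *\<^sub>R ((1/t) *\<^sub>R y) \<in> A"
    using st by (intro convexD[OF A(2)]) (auto simp: add_divide_distrib[symmetric])
  then have "(1/(s+t)) *\<^sub>R (x + y) \<in> A"
    using st by (simp add: scaleR_add_right)
  then have "minkowski A (x + y) < s + t"
    using minkowski_less_iff[of "s + t" "x + y"] st by simp
  then show "minkowski A (x + y) \<le> minkowski A x + minkowski A y + e"
    by (simp add: s_def t_def)
qed

lemma minkowski_scale_le: "0 < c \<Longrightarrow> minkowski A (c *\<^sub>R x) \<le> c * minkowski A x"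
proof (rule dense_ge)
  fix t assume c: "0 < c" and t: "c * minkowski A x < t"
  have "0 \<le> c * minkowski A x"
    using c minkowski_nonneg[of x] by simp
  then have "0 < t"
    using t by linarith
  moreover have "minkowski A x < t / c"
    using c t by (simp add: field_simps)
  ultimately have "(1/t) *\<^sub>R (c *\<^sub>R x) \<in> A"
    using minkowski_less_iff[of "t/c" x] c by simp
  then show "minkowski A (c *\<^sub>R x) \<le> t"
    using minkowski_less_iff[OF \<open>0 < t\<close>, of "c *\<^sub>R x"] by simp
qed

lemma minkowski_scale:
  assumes "0 \<le> c"
  shows "minkowski A (c *\<^sub>R x) = c * minkowski A x"
proof (cases "c = 0")
  case True
  then show ?thesis
    using minkowski_le_norm[of 0] minkowski_nonneg[of 0] by simp
next
  case False
  with assms have c: "0 < c" by simp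
  have "minkowski A ((1/c) *\<^sub>R (c *\<^sub>R x)) \<le> (1/c) * minkowski A (c *\<^sub>R x)"
    using c by (intro minkowski_scale_le) simp
  then have "c * minkowski A x \<le> minkowski A (c *\<^sub>R x)"
    using c by (simp add: field_simps)
  then show ?thesis
    using minkowski_scale_le[OF c, of x] by simp
qed

lemma minkowski_lipschitz: "\<bar>minkowski A x - minkowski A y\<bar> \<le> norm (x - y)"
  using minkowski_triangle[of y "x - y"] minkowski_triangle[of x "y - x"]
    minkowski_le_norm[of "x - y"] minkowski_le_norm[of "y - x"]
  by (simp add: norm_minus_commute[of y x] abs_le_iff)

end

text \<open>Minkowski functionals of such sets are 1-Lipschitz, so a subsequence converges uniformly on the
  unit ball. The limit extends homogeneously to a sublinear functional \<open>G\<close> on the whole space, and \<open>K\<close> is its open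
  unit ball. The error is at most \<open>e |x|\<close>, and as \<open>|x| \<le> R G(x)\<close> it is a relative error; this is the
  mutual inclusion up to dilation.\<close>

lemma convex_sandwich_subsequence:
  fixes A :: "nat \<Rightarrow> 'a::euclidean_space set"
  assumes A: "\<And>n. open (A n)" "\<And>n. convex (A n)" "\<And>n. ball 0 1 \<subseteq> A n" "\<And>n. A n \<subseteq> ball 0 R"
  obtains K r where "open K" "convex K" "ball 0 1 \<subseteq> K" "bounded K" "strict_mono (r :: nat \<Rightarrow> nat)"
    "\<forall>l>1. \<forall>\<^sub>F n in sequentially.
        K \<subseteq> (\<lambda>x. 0 + l *\<^sub>R x) ` A (r n) \<and> A (r n) \<subseteq> (\<lambda>x. 0 + l *\<^sub>R x) ` K"
proof -
  note R = minkowski_radius_pos[OF A]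
  obtain h r where r: "strict_mono (r :: nat \<Rightarrow> nat)"
    and unif: "\<And>e. 0 < e \<Longrightarrow> \<exists>N. \<forall>n x. n \<ge> N \<and> x \<in> cball 0 1 \<longrightarrow> norm (minkowski (A (r n)) x - h x) < e"
  proof (rule Arzela_Ascoli[of "cball (0::'a) 1" "\<lambda>n. minkowski (A n)" 1])
    show "norm (minkowski (A n) x) \<le> 1" if "x \<in> cball 0 1" for n x
      using minkowski_le_norm[OF A, of n x] minkowski_nonneg[OF A, of n x] that by simp
    show "\<exists>d. 0 < d \<and> (\<forall>n y. y \<in> cball 0 1 \<and> norm (x - y) < d \<longrightarrow> norm (minkowski (A n) x - minkowski (A n) y) < e)"
      if "0 < e" for x e
      using minkowski_lipschitz[OF A] that by (intro exI[of _ e]) (auto intro: le_less_trans)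
  qed auto
  define g where "g n = minkowski (A (r n))" for n
  define G where "G x = norm x * h (x /\<^sub>R norm x)" for x
  have G_unif: "\<exists>N. \<forall>n\<ge>N. \<forall>x. \<bar>g n x - G x\<bar> \<le> e * norm x" if e: "0 < e" for e
  proof -
    obtain N where N: "\<And>n x. n \<ge> N \<Longrightarrow> x \<in> cball 0 1 \<Longrightarrow> norm (g n x - h x) < e"
      using unif[OF e] unfolding g_def by blast
    have "\<bar>g n x - G x\<bar> \<le> e * norm x" if n: "n \<ge> N" for n x
    proof (cases "x = 0")
      case True
      then show ?thesis
        using minkowski_scale[OF A, of 0 "r n" 0] by (simp add: G_def g_def)
    next
      case False
      have "g n x = norm x * g n (x /\<^sub>R norm x)"
        using minkowski_scale[OF A, of "norm x" "r n" "x /\<^sub>R norm x"] False by (simp add: g_def)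
      then have "\<bar>g n x - G x\<bar> = norm x * norm (g n (x /\<^sub>R norm x) - h (x /\<^sub>R norm x))"
        by (simp add: G_def abs_mult flip: right_diff_distrib)
      also have "\<dots> \<le> norm x * e"
        using N[OF n, of "x /\<^sub>R norm x"] False by (intro mult_left_mono less_imp_le) auto
      finally show ?thesis
        by (simp add: mult.commute)
    qed
    then show ?thesis by blast
  qed
  have lim: "(\<lambda>n. g n x) \<longlonglongrightarrow> G x" for x
  proof (rule LIMSEQ_I)
    fix e :: real assume e: "0 < e"
    have n1: "0 < norm x + 1"
      using norm_ge_zero[of x] by linarith
    then have "0 < e / (norm x + 1)"
      using e by simp
    from G_unif[OF this] obtain N where N: "\<And>n x'. n \<ge> N \<Longrightarrow> \<bar>g n x' - G x'\<bar> \<le> e / (norm x + 1) * norm x'"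
      by blast
    have "e / (norm x + 1) * norm x < e"
      using e n1 by (simp add: field_simps)
    then have "norm (g n x - G x) < e" if "n \<ge> N" for n
      using N[OF that, of x] by simp
    then show "\<exists>N. \<forall>n\<ge>N. norm (g n x - G x) < e"
      by blast
  qed
  have G_triangle: "G (x + y) \<le> G x + G y" for x y
    by (rule LIMSEQ_le[OF lim tendsto_add[OF lim lim]]) (auto simp: g_def intro!: minkowski_triangle[OF A])
  have G_scale: "G (c *\<^sub>R x) = c * G x" if "0 \<le> c" for c x
  proof (rule LIMSEQ_unique[OF lim])
    show "(\<lambda>n. g n (c *\<^sub>R x)) \<longlonglongrightarrow> c * G x"
      using tendsto_mult_left[OF lim, of c x] by (simp add: g_def minkowski_scale[OF A that])
  qed
  have G_le: "G x \<le> norm x" for x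
    by (rule LIMSEQ_le_const2[OF lim]) (auto simp: g_def intro!: minkowski_le_norm[OF A])
  have G_ge: "norm x \<le> R * G x" for x
    by (rule LIMSEQ_le_const[OF tendsto_mult_left[OF lim]]) (auto simp: g_def intro!: norm_le_minkowski[OF A])
  define K where "K = {x. G x < 1}"
  show ?thesis
  proof (rule that; (intro allI impI)?)
    show "open K"
    proof (rule openI)
      fix x assume "x \<in> K"
      have "ball x (1 - G x) \<subseteq> K"
      proof
        fix y assume "y \<in> ball x (1 - G x)"
        then have "norm (y - x) < 1 - G x"
          by (simp add: dist_norm norm_minus_commute)
        then show "y \<in> K"
          using G_triangle[of x "y - x"] G_le[of "y - x"] by (simp add: K_def)
      qed
      then show "\<exists>e>0. ball x e \<subseteq> K"
        using \<open>x \<in> K\<close> by (intro exI[of _ "1 - G x"]) (simp add: K_def)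
    qed
    show "convex K"
    proof (rule convexI)
      fix x y :: 'a and u v :: real
      assume xy: "x \<in> K" "y \<in> K" and uv: "0 \<le> u" "0 \<le> v" "u + v = 1"
      have "G (u *\<^sub>R x + v *\<^sub>R y) \<le> u * G x + v * G y"
        using G_triangle[of "u *\<^sub>R x" "v *\<^sub>R y"] G_scale uv by simp
      also have "\<dots> < 1"
        using xy uv by (intro convex_bound_lt) (auto simp: K_def)
      finally show "u *\<^sub>R x + v *\<^sub>R y \<in> K"
        by (simp add: K_def)
    qed
    show "ball 0 1 \<subseteq> K"
    proof
      fix x :: 'a assume "x \<in> ball 0 1"
      then show "x \<in> K"
        using G_le[of x] by (simp add: K_def)
    qed
    have "norm x \<le> R" if "x \<in> K" for x
    proof -
      have "R * G x \<le> R * 1"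
        using that R by (intro mult_left_mono) (auto simp: K_def)
      then show ?thesis
        using G_ge[of x] by simp
    qed
    then show "bounded K"
      unfolding bounded_iff by blast
    show "strict_mono r"
      by fact
    fix l :: real assume l: "1 < l"
    \<comment> \<open>Chosen such that \<open>e R = l - 1\<close>.\<close>
    define e where "e = (l - 1) / R"
    have "0 < e"
      using l R by (simp add: e_def)
    then obtain N where N: "\<And>n x. n \<ge> N \<Longrightarrow> \<bar>g n x - G x\<bar> \<le> e * norm x"
      using G_unif by blast
    have "K \<subseteq> (\<lambda>x. 0 + l *\<^sub>R x) ` A (r n) \<and> A (r n) \<subseteq> (\<lambda>x. 0 + l *\<^sub>R x) ` K" if n: "n \<ge> N" for n
    proof (intro conjI subsetI)
      fix x assume "x \<in> K"
      then have "G x < 1"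
        by (simp add: K_def)
      have "e * norm x \<le> e * (R * G x)"
        using \<open>0 < e\<close> G_ge[of x] by (intro mult_left_mono) auto
      also have "\<dots> = (l - 1) * G x"
        using R by (simp add: e_def)
      finally have "g n x \<le> l * G x"
        using N[OF n, of x] by (simp add: abs_le_iff algebra_simps)
      also have "\<dots> < l"
        using l \<open>G x < 1\<close> by simp
      finally have "(1/l) *\<^sub>R x \<in> A (r n)"
        using minkowski_less_iff[OF A, of l "r n" x] l by (simp add: g_def)
      then show "x \<in> (\<lambda>x. 0 + l *\<^sub>R x) ` A (r n)"
        using l by (intro image_eqI[of _ _ "(1/l) *\<^sub>R x"]) auto
    next
      fix x assume "x \<in> A (r n)"
      then have "g n x < 1"
        using minkowski_less_iff[OF A, of 1 "r n" x] by (simp add: g_def)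
      have "e * norm x \<le> e * (R * g n x)"
        using \<open>0 < e\<close> norm_le_minkowski[OF A, of x "r n"] by (intro mult_left_mono) (auto simp: g_def)
      also have "\<dots> = (l - 1) * g n x"
        using R by (simp add: e_def)
      finally have "G x \<le> l * g n x"
        using N[OF n, of x] by (simp add: abs_le_iff algebra_simps)
      also have "\<dots> < l"
        using l \<open>g n x < 1\<close> by simp
      finally have "(1/l) *\<^sub>R x \<in> K"
        using l G_scale[of "1/l" x] by (simp add: K_def)
      then show "x \<in> (\<lambda>x. 0 + l *\<^sub>R x) ` K"
        using l by (intro image_eqI[of _ _ "(1/l) *\<^sub>R x"]) auto
    qed
    then show "\<forall>\<^sub>F n in sequentially. K \<subseteq> (\<lambda>x. 0 + l *\<^sub>R x) ` A (r n) \<and> A (r n) \<subseteq> (\<lambda>x. 0 + l *\<^sub>R x) ` K"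
      by (auto simp: eventually_sequentially)
  qed
qed



section \<open>The scale invariant ratio\<close>

definition convex_domain :: "'a::euclidean_space set \<Rightarrow> bool" where
  "convex_domain \<Omega> \<longleftrightarrow> open \<Omega> \<and> convex \<Omega> \<and> bounded \<Omega> \<and> \<Omega> \<noteq> {}"

lemma convex_domainD:
  assumes "convex_domain \<Omega>"
  shows "open \<Omega>" "convex \<Omega>" "bounded \<Omega>" "\<Omega> \<noteq> {}" "\<Omega> \<in> sets borel" "emeasure lborel \<Omega> < \<infinity>"
  using assms bounded_open_finite_measure by (auto simp: convex_domain_def)

lemma convex_domain_affine:
  assumes "convex_domain \<Omega>" "c > 0"
  shows "convex_domain ((\<lambda>x. a + c *\<^sub>R x) ` \<Omega>)"
  using assms open_bounded_affine[of \<Omega> c a] convex_affinity[of \<Omega> a c] by (auto simp: convex_domain_def)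

text \<open>Normalization by an arbitrary inscribed ball, which suffices for qualitative statements.\<close>

lemma unit_ball_normalization:
  fixes \<Omega> :: "'a::euclidean_space set"
  assumes "open \<Omega>" "\<Omega> \<noteq> {}"
  obtains a c where "0 < c" "cball 0 1 \<subseteq> (\<lambda>x. a + c *\<^sub>R x) ` \<Omega>"
proof -
  obtain p where "p \<in> \<Omega>"
    using assms(2) by blast
  then obtain r where r: "0 < r" "cball p r \<subseteq> \<Omega>"
    using assms(1) open_contains_cball by blast
  show ?thesis
  proof (rule that[of "1/r" "- (1/r) *\<^sub>R p"])
    show "cball 0 1 \<subseteq> (\<lambda>x. - (1/r) *\<^sub>R p + (1/r) *\<^sub>R x) ` \<Omega>"
    proof
      fix y :: 'a assume "y \<in> cball 0 1"
      then have "norm (r *\<^sub>R y) \<le> r * 1"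
        unfolding norm_scaleR using r(1) by (intro mult_mono) auto
      then have "p + r *\<^sub>R y \<in> \<Omega>"
        using r by (auto simp: dist_norm)
      then show "y \<in> (\<lambda>x. - (1/r) *\<^sub>R p + (1/r) *\<^sub>R x) ` \<Omega>"
        using r(1) by (intro image_eqI[of _ _ "p + r *\<^sub>R y"]) (auto simp: scaleR_add_right)
    qed
  qed (use r in simp)
qed

text \<open>Finite volume forces a convex domain to be bounded, since it contains a ball.\<close>

lemma A_convex_iff: "\<Omega> \<in> A_convex \<longleftrightarrow> convex_domain \<Omega>"
proof
  assume "\<Omega> \<in> A_convex"
  then have \<Omega>: "open \<Omega>" "convex \<Omega>" "\<Omega> \<noteq> {}" "emeasure lebesgue \<Omega> < \<infinity>"
    by (auto simp: A_convex_def)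
  have b: "\<Omega> \<in> sets borel"
    using \<Omega> by simp
  obtain a c where ac: "0 < c" "cball 0 1 \<subseteq> (\<lambda>x. a + c *\<^sub>R x) ` \<Omega>"
    using unit_ball_normalization[OF \<Omega>(1,3)] by metis
  let ?S = "(\<lambda>x. a + c *\<^sub>R x) ` \<Omega>"
  have "emeasure lborel ?S < \<infinity>"
    using emeasure_affine_image[OF ac(1) b, of a] \<Omega>(4) b by (simp add: ennreal_mult_less_top)
  moreover have "ball 0 1 \<subseteq> ?S"
    using ac(2) by (meson ball_subset_cball order_trans)
  moreover have "?S \<in> sets borel"
    using ac b by (intro affine_image_borel) auto
  ultimately have "\<And>x. x \<in> ?S \<Longrightarrow> norm x \<le> 2 * measure lborel ?S / measure lborel (ball (0::'a) (1/2))"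
    by (intro convex_norm_le_measure convex_affinity \<Omega>) auto
  then have "bounded ?S"
    unfolding bounded_iff by blast
  then have "bounded ((\<lambda>x. - (1/c) *\<^sub>R a + (1/c) *\<^sub>R x) ` ?S)"
    using bounded_translation[OF bounded_scaling[of ?S "1/c"], of "- (1/c) *\<^sub>R a"] by (simp add: image_image)
  then have "bounded \<Omega>"
    using ac(1) by (subst (asm) affine_inverse) auto
  with \<Omega> show "convex_domain \<Omega>"
    by (simp add: convex_domain_def)
next
  assume "convex_domain \<Omega>"
  then show "\<Omega> \<in> A_convex"
    using convex_domainD[of \<Omega>] by (simp add: A_convex_def)
qed

lemma measure_convex_domain_pos:
  assumes "convex_domain \<Omega>"
  shows "0 < measure lborel \<Omega>"
proof -
  note \<Omega> = convex_domainD[OF assms]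
  obtain p r where r: "0 < r" "ball p r \<subseteq> \<Omega>"
    using \<Omega>(1,4) open_contains_ball by blast
  have "0 < measure lborel (ball p r)"
    using content_ball_pos[OF r(1)] by simp
  also have "\<dots> \<le> measure lborel \<Omega>"
    using r \<Omega> by (intro measure_mono_fmeasurable) (auto simp: fmeasurable_def)
  finally show ?thesis .
qed

definition real_perimeter :: "'a::euclidean_space set \<Rightarrow> real" where
  "real_perimeter \<Omega> = real_of_ereal (perimeter \<Omega>)"

text \<open>The perimeter is finite by the upper bound for a similar domain that contains the unit ball.\<close>

lemma perimeter_eq_real_perimeter:
  fixes \<Omega> :: "'a::euclidean_space set"
  assumes "convex_domain \<Omega>"
  shows "perimeter \<Omega> = ereal (real_perimeter \<Omega>)"
proof -
  note \<Omega> = convex_domainD[OF assms]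
  obtain a c where ac: "0 < c" "cball 0 1 \<subseteq> (\<lambda>x. a + c *\<^sub>R x) ` \<Omega>"
    using unit_ball_normalization[OF \<Omega>(1,4)] by metis
  let ?S = "(\<lambda>x. a + c *\<^sub>R x) ` \<Omega>"
  note S = convex_domainD[OF convex_domain_affine[OF assms ac(1), of a]]
  have "perimeter ((\<lambda>x. - (1/c) *\<^sub>R a + (1/c) *\<^sub>R x) ` ?S)
      \<le> ereal ((1/c) ^ (DIM('a) - 1) * (DIM('a) * (2 * (2 ^ DIM('a) * measure lborel ?S))))"
    by (rule perimeter_affine_le[OF _ S(5) perimeter_upper_bound[OF S(1,2,3) ac(2)]]) (use ac in simp)
  then have "perimeter \<Omega> \<le> ereal ((1/c) ^ (DIM('a) - 1) * (DIM('a) * (2 * (2 ^ DIM('a) * measure lborel ?S))))"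
    using ac(1) by (subst (asm) affine_inverse) auto
  then have "perimeter \<Omega> \<noteq> \<infinity>" "perimeter \<Omega> \<noteq> - \<infinity>"
    using perimeter_nonneg[OF \<Omega>(5)] by auto
  then show ?thesis
    by (cases "perimeter \<Omega>") (auto simp: real_perimeter_def)
qed

lemma real_perimeter_nonneg: "convex_domain \<Omega> \<Longrightarrow> 0 \<le> real_perimeter \<Omega>"
  using perimeter_nonneg[of \<Omega>] perimeter_eq_real_perimeter[of \<Omega>] convex_domainD(5)[of \<Omega>] by simp

lemma real_perimeter_affine:
  fixes \<Omega> :: "'a::euclidean_space set"
  assumes "convex_domain \<Omega>" "c > 0"
  shows "real_perimeter ((\<lambda>x. a + c *\<^sub>R x) ` \<Omega>) = c ^ (DIM('a) - 1) * real_perimeter \<Omega>"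
proof (rule antisym)
  note \<Omega> = convex_domainD[OF assms(1)]
  let ?S = "(\<lambda>x. a + c *\<^sub>R x) ` \<Omega>"
  note S' = convex_domain_affine[OF assms, of a]
  note S = convex_domainD[OF S']
  show "real_perimeter ?S \<le> c ^ (DIM('a) - 1) * real_perimeter \<Omega>"
    using perimeter_affine_le[OF assms(2) \<Omega>(5), of "real_perimeter \<Omega>" a]
    by (simp add: perimeter_eq_real_perimeter[OF assms(1)] perimeter_eq_real_perimeter[OF S'])
  have "perimeter ((\<lambda>x. - (1/c) *\<^sub>R a + (1/c) *\<^sub>R x) ` ?S) \<le> ereal ((1/c) ^ (DIM('a) - 1) * real_perimeter ?S)"
    by (rule perimeter_affine_le[OF _ S(5)]) (use assms(2) perimeter_eq_real_perimeter[OF S'] in auto)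
  then have "real_perimeter \<Omega> \<le> (1/c) ^ (DIM('a) - 1) * real_perimeter ?S"
    using assms by (subst (asm) affine_inverse) (auto simp: perimeter_eq_real_perimeter)
  then have "c ^ (DIM('a) - 1) * real_perimeter \<Omega> \<le> c ^ (DIM('a) - 1) * ((1/c) ^ (DIM('a) - 1) * real_perimeter ?S)"
    using assms(2) by (intro mult_left_mono) auto
  also have "\<dots> = real_perimeter ?S"
    using assms(2) by (simp add: power_divide)
  finally show "c ^ (DIM('a) - 1) * real_perimeter \<Omega> \<le> real_perimeter ?S" .
qed

lemma torsional_rigidity_nonneg: "convex_domain \<Omega> \<Longrightarrow> 0 \<le> torsional_rigidity \<Omega>"
  using torsion_energy_le_rigidity[OF _ _ test_functions_zero] convex_domainD[of \<Omega>] torsion_energy_zero by metis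

text \<open>The power of the volume for which the ratio is invariant under dilations; the type argument carries
  the dimension.\<close>

definition ratio_exponent :: "real \<Rightarrow> 'a::euclidean_space itself \<Rightarrow> real" where
  "ratio_exponent q _ = 1 + q + (2 * q - 1) / real DIM('a)"

definition shape_ratio :: "real \<Rightarrow> 'a::euclidean_space set \<Rightarrow> real" where
  "shape_ratio q \<Omega> = real_perimeter \<Omega> * torsional_rigidity \<Omega> powr q
     / measure lborel \<Omega> powr ratio_exponent q TYPE('a)"

lemma F_eq_shape_ratio:
  assumes "convex_domain \<Omega>"
  shows "F q \<Omega> = ereal (shape_ratio q \<Omega>)"
proof -
  have "measure lebesgue \<Omega> = measure lborel \<Omega>"
    using convex_domainD(5)[OF assms] by (simp add: measure_completion)
  then show ?thesis
    using measure_convex_domain_pos[OF assms]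
    by (simp add: F_def shape_ratio_def ratio_exponent_def perimeter_eq_real_perimeter[OF assms] powr_gt_zero)
qed

text \<open>The exponents of a dilation factor in volume (left), perimeter and rigidity (right) agree.\<close>

lemma ratio_exponent_scaling:
  "real DIM('a) * ratio_exponent q TYPE('a::euclidean_space) = (real DIM('a) - 1) + (real DIM('a) + 2) * q"
  by (simp add: ratio_exponent_def field_simps)

lemma ratio_exponent_pos:
  assumes "0 < q"
  shows "0 < ratio_exponent q TYPE('a::euclidean_space)"
proof -
  have "1 \<le> real DIM('a)"
    using DIM_positive[where 'a='a] by linarith
  then have "0 < (real DIM('a) - 1) + (real DIM('a) + 2) * q"
    using assms by (intro add_nonneg_pos mult_pos_pos) auto
  then have "0 < real DIM('a) * ratio_exponent q TYPE('a)"
    by (simp only: ratio_exponent_scaling)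
  then show ?thesis
    by (simp add: zero_less_mult_iff)
qed

lemma scaling_powr:
  assumes "0 < c"
  shows "c ^ (DIM('a) - 1) * (c ^ (DIM('a) + 2)) powr q = (c ^ DIM('a)) powr ratio_exponent q TYPE('a::euclidean_space)"
proof -
  have "real (DIM('a) - 1) = real DIM('a) - 1"
    using DIM_positive[where 'a='a] by (simp add: of_nat_diff Suc_leI)
  then have 1: "c ^ (DIM('a) - 1) = c powr (real DIM('a) - 1)"
    using powr_realpow[OF assms, of "DIM('a) - 1"] by (simp only:)
  have 2: "c ^ (DIM('a) + 2) = c powr (real DIM('a) + 2)"
    using powr_realpow[OF assms, of "DIM('a) + 2"] by (simp only: of_nat_add of_nat_numeral)
  have "c ^ (DIM('a) - 1) * (c ^ (DIM('a) + 2)) powr q = c powr ((real DIM('a) - 1) + (real DIM('a) + 2) * q)"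
    unfolding 1 2 by (simp only: powr_powr powr_add[of c "real DIM('a) - 1" "(real DIM('a) + 2) * q"])
  also have "\<dots> = (c ^ DIM('a)) powr ratio_exponent q TYPE('a)"
    using assms by (simp add: powr_realpow[symmetric] powr_powr ratio_exponent_scaling)
  finally show ?thesis .
qed

lemma shape_ratio_affine:
  fixes \<Omega> :: "'a::euclidean_space set"
  assumes "convex_domain \<Omega>" "c > 0"
  shows "shape_ratio q ((\<lambda>x. a + c *\<^sub>R x) ` \<Omega>) = shape_ratio q \<Omega>"
proof -
  note \<Omega> = convex_domainD[OF assms(1)]
  let ?\<alpha> = "ratio_exponent q TYPE('a)"
  let ?p = "(c ^ DIM('a)) powr ?\<alpha>"
  have "shape_ratio q ((\<lambda>x. a + c *\<^sub>R x) ` \<Omega>)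
      = (c ^ (DIM('a) - 1) * real_perimeter \<Omega>) * (c ^ (DIM('a) + 2) * torsional_rigidity \<Omega>) powr q
        / (c ^ DIM('a) * measure lborel \<Omega>) powr ?\<alpha>"
    unfolding shape_ratio_def
    by (simp only: real_perimeter_affine[OF assms] torsional_rigidity_affine[OF \<Omega>(1,3) assms(2)]
        measure_affine_image[OF assms(2) \<Omega>(5)])
  also have "\<dots> = (c ^ (DIM('a) - 1) * (c ^ (DIM('a) + 2)) powr q) * (real_perimeter \<Omega> * torsional_rigidity \<Omega> powr q)
        / (?p * measure lborel \<Omega> powr ?\<alpha>)"
    using assms(2) torsional_rigidity_nonneg[OF assms(1)] by (simp add: powr_mult del: power_Suc power_add)
  also have "\<dots> = shape_ratio q \<Omega>"
    unfolding scaling_powr[OF assms(2)] shape_ratio_def using assms(2) by simp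
  finally show ?thesis .
qed

text \<open>One inclusion increases the numerator by at most the scaling factor of perimeter and rigidity, the
  other decreases the denominator by at most that of the volume, and the two factors are equal.\<close>

lemma shape_ratio_sandwich:
  fixes A B :: "'a::euclidean_space set"
  assumes A: "convex_domain A" and B: "convex_domain B" and l: "0 < l" and q: "0 < q"
    and AB: "A \<subseteq> (\<lambda>x. 0 + l *\<^sub>R x) ` B" and BA: "B \<subseteq> (\<lambda>x. 0 + l *\<^sub>R x) ` A"
  shows "shape_ratio q A \<le> ((l ^ DIM('a)) powr ratio_exponent q TYPE('a))\<^sup>2 * shape_ratio q B"
proof -
  let ?\<alpha> = "ratio_exponent q TYPE('a)"
  let ?p = "(l ^ DIM('a)) powr ?\<alpha>"
  note A' = convex_domainD[OF A] and B' = convex_domainD[OF B]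
  note lA = convex_domain_affine[OF A l, of 0] and lB = convex_domain_affine[OF B l, of 0]
  note lA' = convex_domainD[OF lA] and lB' = convex_domainD[OF lB]
  have "perimeter A \<le> perimeter ((\<lambda>x. 0 + l *\<^sub>R x) ` B)"
    by (rule perimeter_convex_mono[OF A'(1,2) lB'(5,3) AB])
  then have P: "real_perimeter A \<le> l ^ (DIM('a) - 1) * real_perimeter B"
    unfolding perimeter_eq_real_perimeter[OF A] perimeter_eq_real_perimeter[OF lB]
    by (simp only: ereal_less_eq(3) real_perimeter_affine[OF B l])
  have "torsional_rigidity A \<le> l ^ (DIM('a) + 2) * torsional_rigidity B"
    using torsional_rigidity_mono[OF A'(1) lB'(1,3) AB]
    by (simp only: torsional_rigidity_affine[OF B'(1,3) l])
  then have "torsional_rigidity A powr q \<le> (l ^ (DIM('a) + 2) * torsional_rigidity B) powr q"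
    using torsional_rigidity_nonneg[OF A] q by (intro powr_mono2) auto
  then have T: "torsional_rigidity A powr q \<le> (l ^ (DIM('a) + 2)) powr q * torsional_rigidity B powr q"
    using l torsional_rigidity_nonneg[OF B] by (simp add: powr_mult del: power_add power_Suc)
  have "measure lborel B \<le> measure lborel ((\<lambda>x. 0 + l *\<^sub>R x) ` A)"
    using BA lA' B' by (intro measure_mono_fmeasurable) (auto simp: fmeasurable_def)
  then have "measure lborel B powr ?\<alpha> \<le> (l ^ DIM('a) * measure lborel A) powr ?\<alpha>"
    using ratio_exponent_pos[OF q, where 'a='a]
    by (intro powr_mono2) (auto simp: measure_affine_image[OF l A'(5)] simp del: add_0)
  then have V: "measure lborel B powr ?\<alpha> \<le> ?p * measure lborel A powr ?\<alpha>"
    using l by (simp add: powr_mult)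
  have p: "0 < ?p"
    using l by simp
  have vA: "0 < measure lborel A powr ?\<alpha>" and vB: "0 < measure lborel B powr ?\<alpha>"
    using measure_convex_domain_pos[OF A] measure_convex_domain_pos[OF B] by auto
  have "real_perimeter A * torsional_rigidity A powr q
      \<le> (l ^ (DIM('a) - 1) * real_perimeter B) * ((l ^ (DIM('a) + 2)) powr q * torsional_rigidity B powr q)"
    using P T l real_perimeter_nonneg[OF B] by (intro mult_mono) auto
  also have "\<dots> = ?p * (real_perimeter B * torsional_rigidity B powr q)"
    unfolding scaling_powr[OF l, symmetric] by (simp only: mult_ac)
  finally have "shape_ratio q A \<le> ?p * (real_perimeter B * torsional_rigidity B powr q) / measure lborel A powr ?\<alpha>"
    unfolding shape_ratio_def using vA by (intro divide_right_mono) auto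
  also have "\<dots> \<le> ?p * (real_perimeter B * torsional_rigidity B powr q) / (measure lborel B powr ?\<alpha> / ?p)"
    using V p vA vB real_perimeter_nonneg[OF B] by (intro divide_left_mono) (auto simp: field_simps)
  also have "\<dots> = ?p\<^sup>2 * shape_ratio q B"
    using p by (simp add: shape_ratio_def power2_eq_square)
  finally show ?thesis .
qed



section \<open>Existence of optimal domains\<close>

definition comparable_to_volume :: "real \<Rightarrow> real \<Rightarrow> real \<Rightarrow> real \<Rightarrow> 'a::euclidean_space set \<Rightarrow> bool" where
  "comparable_to_volume k1 k2 k3 k4 D \<longleftrightarrow>
     k1 * measure lborel D \<le> real_perimeter D \<and> real_perimeter D \<le> k2 * measure lborel D \<and>
     k3 * measure lborel D \<le> torsional_rigidity D \<and> torsional_rigidity D \<le> k4 * measure lborel D"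

text \<open>Let \<open>L\<close> be the largest norm of a row of the matrix from \<open>convex_comparable_parallelepiped\<close>. The domain
  lies in a slab of width \<open>2 / L\<close> and contains a ball of radius \<open>1 / (4 d L)\<close>, so width and inradius are
  comparable. The slab bounds the perimeter from below and the rigidity from above, the ball
  bounds the perimeter from above, the parallelepiped bounds the rigidity from below.\<close>

lemma normalized_domain:
  "\<exists>k1 k2 k3 k4. 0 < k1 \<and> 0 < k2 \<and> 0 < k3 \<and> 0 < k4 \<and> (\<forall>\<Omega> :: (real^'n::finite) set. convex_domain \<Omega> \<longrightarrow>
     (\<exists>a c. 0 < c \<and> cball 0 1 \<subseteq> (\<lambda>x. a + c *\<^sub>R x) ` \<Omega> \<and>
        comparable_to_volume k1 k2 k3 k4 ((\<lambda>x. a + c *\<^sub>R x) ` \<Omega>)))"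
proof -
  define d where "d = real CARD('n)"
  have d: "1 \<le> d"
    by (simp add: d_def Suc_le_eq)
  have dim: "DIM(real^'n) = CARD('n)"
    by simp
  obtain k where "0 < k \<and> (\<forall>(\<Omega> :: (real^'n) set) M z L. open \<Omega> \<longrightarrow> bounded \<Omega> \<longrightarrow>
     comparable_parallelepiped M z \<Omega> \<longrightarrow> 0 < L \<longrightarrow> (\<forall>i. norm (M $ i) \<le> L) \<longrightarrow>
     k * measure lborel \<Omega> / L\<^sup>2 \<le> torsional_rigidity \<Omega>)"
    using torsional_rigidity_lower_bound[where 'n='n] ..
  then have k: "0 < k" and k_le: "\<And>(\<Omega> :: (real^'n) set) M z L. open \<Omega> \<Longrightarrow> bounded \<Omega> \<Longrightarrow>
     comparable_parallelepiped M z \<Omega> \<Longrightarrow> 0 < L \<Longrightarrow> (\<And>i. norm (M $ i) \<le> L) \<Longrightarrow>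
     k * measure lborel \<Omega> / L\<^sup>2 \<le> torsional_rigidity \<Omega>"
    by auto
  have main: "\<exists>a c. 0 < c \<and> cball 0 1 \<subseteq> (\<lambda>x. a + c *\<^sub>R x) ` \<Omega> \<and>
      comparable_to_volume (cos 1 / (4 * d)) (d * (2 * 2 ^ CARD('n))) (k * (16 * d\<^sup>2)) (16 * d\<^sup>2)
        ((\<lambda>x. a + c *\<^sub>R x) ` \<Omega>)"
    if dom: "convex_domain \<Omega>" for \<Omega> :: "(real^'n) set"
  proof -
    note \<Omega> = convex_domainD[OF dom]
    obtain z where z: "z \<in> \<Omega>"
      using \<Omega>(4) by blast
    obtain M where comp: "comparable_parallelepiped M z \<Omega>"
      using convex_comparable_parallelepiped[OF \<Omega>(1,2,3) z] .
    then have M: "invertible M"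
      and out: "\<And>x i. x \<in> \<Omega> \<Longrightarrow> \<bar>(M *v (x - z)) $ i\<bar> \<le> 1"
      and inn: "\<And>x. (\<forall>i. 0 < (M *v (x - z)) $ i \<and> (M *v (x - z)) $ i < 1 / CARD('n)) \<Longrightarrow> x \<in> \<Omega>"
      unfolding comparable_parallelepiped_def by auto
    obtain N where N: "M ** N = mat 1"
      using M unfolding invertible_def by blast
    have solve: "M $ i \<bullet> (N *v w) = w $ i" for i w
      by (simp add: matrix_vector_mul_assoc N flip: matrix_vector_mul_component)
    have "Max (range (\<lambda>i. norm (M $ i))) \<in> range (\<lambda>i. norm (M $ i))"
      by (intro Max_in) auto
    then obtain i0 where i0: "Max (range (\<lambda>i. norm (M $ i))) = norm (M $ i0)"
      by blast
    define L where "L = norm (M $ i0)"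
    have L_max: "norm (M $ i) \<le> L" for i
      unfolding L_def i0[symmetric] by (intro Max_ge) auto
    have "M $ i0 \<noteq> 0"
      using solve[of i0 "\<chi> i. 1"] by auto
    then have L: "0 < L"
      by (simp add: L_def)
    \<comment> \<open>The centre of the inner cube; the dilation by \<open>c\<close> turns the ball of radius \<open>1 / (4 d L)\<close> around \<open>p\<close> into the
      unit ball.\<close>
    define p where "p = z + N *v (\<chi> i. 1 / (2 * d))"
    define c where "c = 4 * d * L"
    have c: "0 < c"
      using d L by (simp add: c_def)
    define a where "a = - (c *\<^sub>R p)"
    define D where "D = (\<lambda>x. a + c *\<^sub>R x) ` \<Omega>"
    have dom_D: "convex_domain D"
      unfolding D_def by (rule convex_domain_affine[OF dom c])
    note D' = convex_domainD[OF dom_D]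
    have ball: "cball 0 1 \<subseteq> D"
    proof
      fix y :: "real^'n" assume y: "y \<in> cball 0 1"
      have "p + (1/c) *\<^sub>R y \<in> \<Omega>"
      proof (rule inn, intro allI)
        fix i
        have e1: "(M *v (p + (1/c) *\<^sub>R y - z)) $ i = 1 / (2 * d) + (1/c) * (M $ i \<bullet> y)"
          by (simp add: p_def matrix_vector_mul_component algebra_simps inner_add_right inner_diff_right solve)
        have e2: "\<bar>(1/c) * (M $ i \<bullet> y)\<bar> \<le> 1 / (4 * d)"
        proof -
          have "\<bar>M $ i \<bullet> y\<bar> \<le> norm (M $ i) * norm y"
            by (rule Cauchy_Schwarz_ineq2)
          also have "\<dots> \<le> L * 1"
            using y L_max[of i] L by (intro mult_mono) auto
          finally have "(1/c) * \<bar>M $ i \<bullet> y\<bar> \<le> (1/c) * L"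
            using c by (intro mult_left_mono) auto
          also have "\<dots> = 1 / (4 * d)"
            using L by (simp add: c_def)
          finally show ?thesis
            using c by (simp add: abs_mult)
        qed
        have e3: "1 / (4 * d) < 1 / (2 * d)" "1 / (2 * d) + 1 / (4 * d) < 1 / d"
          using d by (auto simp: field_simps)
        show "0 < (M *v (p + (1/c) *\<^sub>R y - z)) $ i \<and> (M *v (p + (1/c) *\<^sub>R y - z)) $ i < 1 / CARD('n)"
          unfolding d_def[symmetric] e1 using e2 e3 by (intro conjI) linarith+
      qed
      moreover have "a + c *\<^sub>R (p + (1/c) *\<^sub>R y) = y"
        using c by (simp add: a_def scaleR_add_right)
      ultimately show "y \<in> D"
        unfolding D_def by (metis image_eqI)
    qed
    have volD: "measure lborel D = c ^ CARD('n) * measure lborel \<Omega>"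
      unfolding D_def using measure_affine_image[OF c \<Omega>(5), of a] by simp
    have perD: "real_perimeter D = c ^ (CARD('n) - 1) * real_perimeter \<Omega>"
      unfolding D_def using real_perimeter_affine[OF dom c, of a] by simp
    have torD: "torsional_rigidity D = c ^ (CARD('n) + 2) * torsional_rigidity \<Omega>"
      unfolding D_def using torsional_rigidity_affine[OF \<Omega>(1,3) c, of a] by simp
    have slab: "\<And>x. x \<in> \<Omega> \<Longrightarrow> \<bar>M $ i0 \<bullet> (x - z)\<bar> \<le> 1"
      using out by (simp add: matrix_vector_mul_component)
    have "cos 1 * L * measure lborel \<Omega> \<le> real_perimeter \<Omega>"
      using perimeter_lower_bound[OF \<Omega>(5,3) slab] unfolding perimeter_eq_real_perimeter[OF dom] L_def by simp
    then have "c ^ (CARD('n) - 1) * (cos 1 * L * measure lborel \<Omega>) \<le> real_perimeter D"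
      unfolding perD using c by (intro mult_left_mono) auto
    also have "c ^ (CARD('n) - 1) * (cos 1 * L * measure lborel \<Omega>) = cos 1 / (4 * d) * measure lborel D"
    proof -
      have "c ^ CARD('n) = c ^ (CARD('n) - 1) * (4 * d * L)"
        using power_minus_mult[of "CARD('n)" c] by (simp add: c_def)
      then show ?thesis
        using d unfolding volD by simp
    qed
    finally have 1: "cos 1 / (4 * d) * measure lborel D \<le> real_perimeter D" .
    have 2: "real_perimeter D \<le> (d * (2 * 2 ^ CARD('n))) * measure lborel D"
      using perimeter_upper_bound[OF D'(1,2,3) ball] unfolding perimeter_eq_real_perimeter[OF dom_D]
      by (simp add: d_def mult.assoc)
    have cL: "c ^ (CARD('n) + 2) * (v / L\<^sup>2) = (16 * d\<^sup>2) * (c ^ CARD('n) * v)" for v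
      using L unfolding power_add by (simp add: c_def power_mult_distrib power2_eq_square)
    have "k * measure lborel \<Omega> / L\<^sup>2 \<le> torsional_rigidity \<Omega>"
      by (rule k_le[OF \<Omega>(1,3) comp L L_max])
    then have "c ^ (CARD('n) + 2) * (k * measure lborel \<Omega> / L\<^sup>2) \<le> torsional_rigidity D"
      unfolding torD using c by (intro mult_left_mono) auto
    then have 3: "(k * (16 * d\<^sup>2)) * measure lborel D \<le> torsional_rigidity D"
      unfolding cL volD by (simp add: mult_ac)
    have "torsional_rigidity \<Omega> \<le> measure lborel \<Omega> / L\<^sup>2"
      unfolding L_def by (rule torsional_rigidity_upper_bound[OF \<Omega>(1,3) \<open>M $ i0 \<noteq> 0\<close> slab])
    then have "torsional_rigidity D \<le> c ^ (CARD('n) + 2) * (measure lborel \<Omega> / L\<^sup>2)"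
      unfolding torD using c by (intro mult_left_mono) auto
    then have 4: "torsional_rigidity D \<le> (16 * d\<^sup>2) * measure lborel D"
      unfolding cL volD .
    have "comparable_to_volume (cos 1 / (4 * d)) (d * (2 * 2 ^ CARD('n))) (k * (16 * d\<^sup>2)) (16 * d\<^sup>2) D"
      unfolding comparable_to_volume_def using 1 2 3 4 by blast
    with c ball show ?thesis
      unfolding D_def by blast
  qed
  have pos: "0 < cos 1 / (4 * d)" "0 < d * (2 * 2 ^ CARD('n))" "0 < k * (16 * d\<^sup>2)" "0 < 16 * d\<^sup>2"
    using d k cos_gt_zero_pi[of 1] pi_gt3 by auto
  show ?thesis
    by (rule exI[of _ "cos 1 / (4 * d)"], rule exI[of _ "d * (2 * 2 ^ CARD('n))"],
        rule exI[of _ "k * (16 * d\<^sup>2)"], rule exI[of _ "16 * d\<^sup>2"]) (use pos main in blast)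
qed

text \<open>For perimeter and rigidity comparable to the volume \<open>v\<close>, the ratio is comparable to
  \<open>v\<close> raised to the power \<open>1 + q - ratio_exponent q = (1 - 2 q) / d\<close>.\<close>

lemma normalized_shape_ratio:
  assumes q: "0 < q"
  shows "\<exists>k>0. \<exists>K>0. \<forall>\<Omega> :: (real^'n::finite) set. convex_domain \<Omega> \<longrightarrow>
     (\<exists>D :: (real^'n) set. convex_domain D \<and> cball 0 1 \<subseteq> D \<and> shape_ratio q D = shape_ratio q \<Omega> \<and>
        k * measure lborel D powr ((1 - 2 * q) / CARD('n)) \<le> shape_ratio q D \<and>
        shape_ratio q D \<le> K * measure lborel D powr ((1 - 2 * q) / CARD('n)))"
proof -
  obtain k1 k2 k3 k4 where k: "0 < k1" "0 < k2" "0 < k3" "0 < k4"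
    and norm: "\<And>\<Omega> :: (real^'n) set. convex_domain \<Omega> \<Longrightarrow>
     (\<exists>a c. 0 < c \<and> cball 0 1 \<subseteq> (\<lambda>x. a + c *\<^sub>R x) ` \<Omega> \<and>
        comparable_to_volume k1 k2 k3 k4 ((\<lambda>x. a + c *\<^sub>R x) ` \<Omega>))"
    using normalized_domain[where 'n='n] by metis
  let ?s = "(1 - 2 * q) / CARD('n)"
  let ?\<alpha> = "ratio_exponent q TYPE(real^'n)"
  have "\<exists>D :: (real^'n) set. convex_domain D \<and> cball 0 1 \<subseteq> D \<and> shape_ratio q D = shape_ratio q \<Omega> \<and>
        (k1 * k3 powr q) * measure lborel D powr ?s \<le> shape_ratio q D \<and>
        shape_ratio q D \<le> (k2 * k4 powr q) * measure lborel D powr ?s"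
    if dom: "convex_domain \<Omega>" for \<Omega> :: "(real^'n) set"
  proof -
    obtain a c where c: "0 < c" and n: "cball 0 1 \<subseteq> (\<lambda>x. a + c *\<^sub>R x) ` \<Omega>"
        "comparable_to_volume k1 k2 k3 k4 ((\<lambda>x. a + c *\<^sub>R x) ` \<Omega>)"
      using norm[OF dom] by blast
    define D where "D = (\<lambda>x. a + c *\<^sub>R x) ` \<Omega>"
    define v where "v = measure lborel D"
    have D: "cball 0 1 \<subseteq> D" "k1 * v \<le> real_perimeter D" "real_perimeter D \<le> k2 * v"
        "k3 * v \<le> torsional_rigidity D" "torsional_rigidity D \<le> k4 * v"
      using n unfolding comparable_to_volume_def D_def v_def by auto
    have dom_D: "convex_domain D"
      unfolding D_def by (rule convex_domain_affine[OF dom c])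
    have v: "0 < v"
      unfolding v_def by (rule measure_convex_domain_pos[OF dom_D])
    have "1 + q - ?\<alpha> = ?s"
      by (simp add: ratio_exponent_def field_simps)
    then have e: "(v * v powr q) / v powr ?\<alpha> = v powr ?s"
      using v powr_diff[of v "1 + q" ?\<alpha>] powr_add[of v 1 q] by simp
    have tor: "k3 powr q * v powr q \<le> torsional_rigidity D powr q" "torsional_rigidity D powr q \<le> k4 powr q * v powr q"
    proof -
      have "(k3 * v) powr q \<le> torsional_rigidity D powr q"
        using D k v q by (intro powr_mono2) auto
      then show "k3 powr q * v powr q \<le> torsional_rigidity D powr q"
        using k v by (simp add: powr_mult)
      have "torsional_rigidity D powr q \<le> (k4 * v) powr q"
        using D k v q torsional_rigidity_nonneg[OF dom_D] by (intro powr_mono2) auto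
      then show "torsional_rigidity D powr q \<le> k4 powr q * v powr q"
        using k v by (simp add: powr_mult)
    qed
    have lo: "(k1 * k3 powr q) * v powr ?s \<le> shape_ratio q D"
    proof -
      have "(k1 * v) * (k3 powr q * v powr q) \<le> real_perimeter D * torsional_rigidity D powr q"
        using D tor k v real_perimeter_nonneg[OF dom_D] by (intro mult_mono) auto
      then have "(k1 * v) * (k3 powr q * v powr q) / v powr ?\<alpha> \<le> shape_ratio q D"
        unfolding shape_ratio_def v_def[symmetric] using v by (intro divide_right_mono) auto
      moreover have "(k1 * v) * (k3 powr q * v powr q) / v powr ?\<alpha> = (k1 * k3 powr q) * v powr ?s"
        unfolding e[symmetric] by (simp only: mult_ac times_divide_eq_right)
      ultimately show ?thesis
        by (simp only:)
    qed
    have hi: "shape_ratio q D \<le> (k2 * k4 powr q) * v powr ?s"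
    proof -
      have "real_perimeter D * torsional_rigidity D powr q \<le> (k2 * v) * (k4 powr q * v powr q)"
        using D tor k v by (intro mult_mono) auto
      then have "shape_ratio q D \<le> (k2 * v) * (k4 powr q * v powr q) / v powr ?\<alpha>"
        unfolding shape_ratio_def v_def[symmetric] using v by (intro divide_right_mono) auto
      moreover have "(k2 * v) * (k4 powr q * v powr q) / v powr ?\<alpha> = (k2 * k4 powr q) * v powr ?s"
        unfolding e[symmetric] by (simp only: mult_ac times_divide_eq_right)
      ultimately show ?thesis
        by (simp only:)
    qed
    have "shape_ratio q D = shape_ratio q \<Omega>"
      unfolding D_def by (rule shape_ratio_affine[OF dom c])
    with dom_D D(1) lo hi show ?thesis
      unfolding v_def by (intro exI[of _ D] conjI)
  qed
  moreover have "0 < k1 * k3 powr q" "0 < k2 * k4 powr q"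
    using k by auto
  ultimately show ?thesis
    by blast
qed

text \<open>Bounded volume bounds the diameters, so a subsequence converges in the sense of mutual inclusion up
  to dilation by every \<open>l > 1\<close>. The ratio of the limit domain differs from \<open>m\<close> by at most the factor of
  \<open>shape_ratio_sandwich\<close>, which tends to 1 with \<open>l\<close>.\<close>

lemma shape_ratio_limit_attained:
  fixes D :: "nat \<Rightarrow> 'a::euclidean_space set"
  assumes dom: "\<And>n. convex_domain (D n)" and ball: "\<And>n. cball 0 1 \<subseteq> D n"
    and vol: "\<And>n. measure lborel (D n) \<le> V" and lim: "(\<lambda>n. shape_ratio q (D n)) \<longlonglongrightarrow> m" and q: "0 < q"
  shows "\<exists>K :: 'a set. convex_domain K \<and> shape_ratio q K = m"
proof -
  note D = convex_domainD[OF dom]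
  have ball': "ball 0 1 \<subseteq> D n" for n
    using ball[of n] by (meson ball_subset_cball order_trans)
  define R where "R = 2 * V / measure lborel (ball (0::'a) (1/2))"
  have "norm x \<le> R" if "x \<in> D n" for x n
  proof -
    have "norm x \<le> 2 * measure lborel (D n) / measure lborel (ball (0::'a) (1/2))"
      by (rule convex_norm_le_measure[OF D(2,5,6) ball' that])
    also have "\<dots> \<le> R"
      unfolding R_def using vol by (intro divide_right_mono) auto
    finally show ?thesis .
  qed
  then have out: "D n \<subseteq> ball 0 (R + 1)" for n
    by (force intro: le_less_trans)
  obtain K r where K: "open K" "convex K" "ball 0 1 \<subseteq> K" "bounded K" and r: "strict_mono (r :: nat \<Rightarrow> nat)"
    and sandwich: "\<forall>l>1. \<forall>\<^sub>F n in sequentially.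
        K \<subseteq> (\<lambda>x. 0 + l *\<^sub>R x) ` D (r n) \<and> D (r n) \<subseteq> (\<lambda>x. 0 + l *\<^sub>R x) ` K"
    by (rule convex_sandwich_subsequence[of D "R + 1", OF D(1,2) ball' out])
  have "K \<noteq> {}"
    using K(3) by auto
  then have dom_K: "convex_domain K"
    using K by (simp add: convex_domain_def)
  have lim_r: "(\<lambda>n. shape_ratio q (D (r n))) \<longlonglongrightarrow> m"
    using LIMSEQ_subseq_LIMSEQ[OF lim r] by (simp add: o_def)
  let ?p = "\<lambda>l. ((l ^ DIM('a)) powr ratio_exponent q TYPE('a))\<^sup>2"
  have bounds: "shape_ratio q K \<le> ?p l * m \<and> m \<le> ?p l * shape_ratio q K" if l: "1 < l" for l
  proof
    have l0: "0 < l" using l by simp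
    show "shape_ratio q K \<le> ?p l * m"
    proof (rule tendsto_lowerbound[OF tendsto_mult_left[OF lim_r]])
      show "\<forall>\<^sub>F n in sequentially. shape_ratio q K \<le> ?p l * shape_ratio q (D (r n))"
        using sandwich[rule_format, OF l] by eventually_elim (use shape_ratio_sandwich[OF dom_K dom l0 q] in blast)
    qed simp
    show "m \<le> ?p l * shape_ratio q K"
    proof (rule tendsto_upperbound[OF lim_r])
      show "\<forall>\<^sub>F n in sequentially. shape_ratio q (D (r n)) \<le> ?p l * shape_ratio q K"
        using sandwich[rule_format, OF l] by eventually_elim (use shape_ratio_sandwich[OF dom dom_K l0 q] in blast)
    qed simp
  qed
  define l where "l n = 1 + inverse (real (Suc n))" for n
  have l1: "1 < l n" for n
    by (simp add: l_def)
  have "l \<longlonglongrightarrow> 1 + 0"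
    unfolding l_def[abs_def] by (intro tendsto_intros LIMSEQ_inverse_real_of_nat)
  then have "(\<lambda>n. ?p (l n)) \<longlonglongrightarrow> ((1 ^ DIM('a)) powr ratio_exponent q TYPE('a))\<^sup>2"
    by (intro tendsto_intros) auto
  then have lp: "(\<lambda>n. ?p (l n) * c) \<longlonglongrightarrow> c" for c
    using tendsto_mult_right[of "\<lambda>n. ?p (l n)" 1 sequentially c] by simp
  have "shape_ratio q K \<le> m"
    by (rule LIMSEQ_le_const[OF lp]) (use bounds l1 in auto)
  moreover have "m \<le> shape_ratio q K"
    by (rule LIMSEQ_le_const[OF lp]) (use bounds l1 in auto)
  ultimately have "shape_ratio q K = m"
    by (rule antisym)
  with dom_K show ?thesis
    by blast
qed

lemma convex_domain_unit_ball: "convex_domain (ball 0 1)"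
  by (simp add: convex_domain_def)

lemma shape_ratio_nonneg: "convex_domain \<Omega> \<Longrightarrow> 0 \<le> shape_ratio q \<Omega>"
  using real_perimeter_nonneg[of \<Omega>] by (simp add: shape_ratio_def)

text \<open>The exponent \<open>s\<close> is positive, so along a minimizing sequence the bounded ratios bound the volumes.\<close>

lemma minimizer_exists:
  assumes q: "0 < q" "q < 1/2"
  shows "\<exists>K :: (real^'n::finite) set. convex_domain K \<and> (\<forall>\<Omega> :: (real^'n) set. convex_domain \<Omega> \<longrightarrow> shape_ratio q K \<le> shape_ratio q \<Omega>)"
proof -
  let ?dom = "convex_domain :: (real^'n) set \<Rightarrow> bool"
  define X where "X = shape_ratio q ` {\<Omega>. ?dom \<Omega>}"
  define m where "m = Inf X"
  have X: "X \<noteq> {}" "bdd_below X"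
    unfolding X_def using convex_domain_unit_ball shape_ratio_nonneg by (auto intro!: bdd_belowI2[where m=0])
  have m_le: "m \<le> shape_ratio q \<Omega>" if "?dom \<Omega>" for \<Omega>
    unfolding m_def using X that by (intro cInf_lower) (auto simp: X_def)
  define s where "s = (1 - 2 * q) / CARD('n)"
  obtain k K where k: "0 < k" and norm: "\<And>\<Omega>. ?dom \<Omega> \<Longrightarrow>
     (\<exists>D. ?dom D \<and> cball 0 1 \<subseteq> D \<and> shape_ratio q D = shape_ratio q \<Omega> \<and>
        k * measure lborel D powr s \<le> shape_ratio q D \<and>
        shape_ratio q D \<le> K * measure lborel D powr s)"
    using normalized_shape_ratio[OF q(1), where 'n='n] unfolding s_def by blast
  have s: "0 < s"
    using q by (simp add: s_def)
  have "\<exists>D. ?dom D \<and> cball 0 1 \<subseteq> D \<and> shape_ratio q D < m + inverse (real (Suc n)) \<and>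
      k * measure lborel D powr s \<le> shape_ratio q D" for n
  proof -
    have "m < m + inverse (real (Suc n))"
      by simp
    then obtain \<Omega> where "?dom \<Omega>" "shape_ratio q \<Omega> < m + inverse (real (Suc n))"
      using cInf_lessD[OF X(1)] unfolding m_def X_def by blast
    then show ?thesis
      using norm[of \<Omega>] by metis
  qed
  then obtain D where D: "\<And>n. ?dom (D n)" "\<And>n. cball 0 1 \<subseteq> D n"
      "\<And>n. shape_ratio q (D n) < m + inverse (real (Suc n))" "\<And>n. k * measure lborel (D n) powr s \<le> shape_ratio q (D n)"
    by metis
  have vol: "measure lborel (D n) \<le> ((m + 1) / k) powr (1 / s)" for n
  proof -
    have "inverse (real (Suc n)) \<le> 1"
      by (simp add: field_simps)
    then have "k * measure lborel (D n) powr s \<le> m + 1"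
      using D(3,4)[of n] by linarith
    then have "measure lborel (D n) powr s \<le> (m + 1) / k"
      using k by (simp add: field_simps)
    then have "(measure lborel (D n) powr s) powr (1 / s) \<le> ((m + 1) / k) powr (1 / s)"
      using s by (intro powr_mono2) auto
    then show ?thesis
      using s measure_convex_domain_pos[OF D(1)] by (simp add: powr_powr)
  qed
  have lim: "(\<lambda>n. shape_ratio q (D n)) \<longlonglongrightarrow> m"
  proof (rule tendsto_sandwich[OF _ _ tendsto_const])
    show "(\<lambda>n. m + inverse (real (Suc n))) \<longlonglongrightarrow> m"
      using tendsto_add[OF tendsto_const[of m] LIMSEQ_inverse_real_of_nat] by simp
    show "\<forall>\<^sub>F n in sequentially. m \<le> shape_ratio q (D n)"
      by (intro always_eventually allI m_le D)
    show "\<forall>\<^sub>F n in sequentially. shape_ratio q (D n) \<le> m + inverse (real (Suc n))"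
      by (intro always_eventually allI less_imp_le D)
  qed
  obtain K where "?dom K" "shape_ratio q K = m"
    using shape_ratio_limit_attained[OF D(1,2) vol lim q(1)] by blast
  with m_le show ?thesis
    by blast
qed

text \<open>The exponent \<open>s\<close> is negative. As normalized domains contain the unit ball, the ratio is bounded above.
  The supremum is positive, and along a maximizing sequence with ratios above half of it
  the volumes are bounded.\<close>

lemma maximizer_exists:
  assumes q: "1/2 < q"
  shows "\<exists>K :: (real^'n::finite) set. convex_domain K \<and> (\<forall>\<Omega> :: (real^'n) set. convex_domain \<Omega> \<longrightarrow> shape_ratio q \<Omega> \<le> shape_ratio q K)"
proof -
  let ?dom = "convex_domain :: (real^'n) set \<Rightarrow> bool"
  have q0: "0 < q"
    using q by simp
  define s where "s = (1 - 2 * q) / CARD('n)"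
  have s: "s < 0"
    using q by (simp add: s_def divide_neg_pos)
  obtain k K where k: "0 < k" "0 < K" and norm: "\<And>\<Omega>. ?dom \<Omega> \<Longrightarrow>
     (\<exists>D. ?dom D \<and> cball 0 1 \<subseteq> D \<and> shape_ratio q D = shape_ratio q \<Omega> \<and>
        k * measure lborel D powr s \<le> shape_ratio q D \<and>
        shape_ratio q D \<le> K * measure lborel D powr s)"
    using normalized_shape_ratio[OF q0, where 'n='n] unfolding s_def by blast
  define \<beta> where "\<beta> = measure lborel (ball (0 :: real^'n) 1)"
  have \<beta>: "0 < \<beta>"
    unfolding \<beta>_def by (rule measure_convex_domain_pos[OF convex_domain_unit_ball])
  define X where "X = shape_ratio q ` {\<Omega>. ?dom \<Omega>}"
  define m where "m = Sup X"
  have "shape_ratio q \<Omega> \<le> K * \<beta> powr s" if \<Omega>: "?dom \<Omega>" for \<Omega>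
  proof -
    obtain D where D: "?dom D" "cball 0 1 \<subseteq> D" "shape_ratio q D = shape_ratio q \<Omega>"
        "shape_ratio q D \<le> K * measure lborel D powr s"
      using norm[OF \<Omega>] by blast
    have "ball 0 1 \<subseteq> D"
      using D(2) by (meson ball_subset_cball order_trans)
    then have "\<beta> \<le> measure lborel D"
      unfolding \<beta>_def using convex_domainD[OF D(1)] by (intro measure_mono_fmeasurable) (auto simp: fmeasurable_def)
    then have "measure lborel D powr s \<le> \<beta> powr s"
      using s \<beta> by (intro powr_mono2') auto
    then have "K * measure lborel D powr s \<le> K * \<beta> powr s"
      using k by (intro mult_left_mono) auto
    then show ?thesis
      using D by linarith
  qed
  then have X: "X \<noteq> {}" "bdd_above X"
    unfolding X_def using convex_domain_unit_ball by (auto intro!: bdd_aboveI2)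
  have le_m: "shape_ratio q \<Omega> \<le> m" if "?dom \<Omega>" for \<Omega>
    unfolding m_def using X that by (intro cSup_upper) (auto simp: X_def)
  have m: "0 < m"
  proof -
    obtain D where D: "?dom D" "k * measure lborel D powr s \<le> shape_ratio q D"
      using norm[OF convex_domain_unit_ball] by blast
    have "0 < k * measure lborel D powr s"
      using k measure_convex_domain_pos[OF D(1)] by simp
    then show ?thesis
      using D(2) le_m[OF D(1)] by linarith
  qed
  have "\<exists>D. ?dom D \<and> cball 0 1 \<subseteq> D \<and> m - m / 2 * inverse (real (Suc n)) < shape_ratio q D \<and>
      shape_ratio q D \<le> K * measure lborel D powr s" for n
  proof -
    \<comment> \<open>The factor \<open>m / 2\<close> keeps the whole sequence above \<open>m / 2\<close>.\<close>
    have "m - m / 2 * inverse (real (Suc n)) < m"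
      using m by simp
    then obtain \<Omega> where "?dom \<Omega>" "m - m / 2 * inverse (real (Suc n)) < shape_ratio q \<Omega>"
      using less_cSupD[OF X(1)] unfolding m_def X_def by blast
    then show ?thesis
      using norm[of \<Omega>] by metis
  qed
  then obtain D where D: "\<And>n. ?dom (D n)" "\<And>n. cball 0 1 \<subseteq> D n"
      "\<And>n. m - m / 2 * inverse (real (Suc n)) < shape_ratio q (D n)" "\<And>n. shape_ratio q (D n) \<le> K * measure lborel (D n) powr s"
    by metis
  have vol: "measure lborel (D n) \<le> (m / (2 * K)) powr (1 / s)" for n
  proof -
    have "inverse (real (Suc n)) \<le> 1"
      by (simp add: field_simps)
    then have "m / 2 * inverse (real (Suc n)) \<le> m / 2 * 1"
      using m by (intro mult_left_mono) auto
    then have "m / 2 \<le> K * measure lborel (D n) powr s"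
      using D(3,4)[of n] by linarith
    then have "m / (2 * K) \<le> measure lborel (D n) powr s"
      using k by (simp add: field_simps)
    then have "(measure lborel (D n) powr s) powr (1 / s) \<le> (m / (2 * K)) powr (1 / s)"
      using s m k by (intro powr_mono2') (auto simp: divide_nonpos_neg divide_le_0_iff)
    then show ?thesis
      using s measure_convex_domain_pos[OF D(1)] by (simp add: powr_powr)
  qed
  have lim: "(\<lambda>n. shape_ratio q (D n)) \<longlonglongrightarrow> m"
  proof (rule tendsto_sandwich[OF _ _ _ tendsto_const])
    show "(\<lambda>n. m - m / 2 * inverse (real (Suc n))) \<longlonglongrightarrow> m"
      using tendsto_diff[OF tendsto_const[of m] tendsto_mult_left[OF LIMSEQ_inverse_real_of_nat, of "m/2"]] by simp
    show "\<forall>\<^sub>F n in sequentially. shape_ratio q (D n) \<le> m"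
      by (intro always_eventually allI le_m D)
    show "\<forall>\<^sub>F n in sequentially. m - m / 2 * inverse (real (Suc n)) \<le> shape_ratio q (D n)"
      by (intro always_eventually allI less_imp_le D)
  qed
  obtain K where "?dom K" "shape_ratio q K = m"
    using shape_ratio_limit_attained[OF D(1,2) vol lim q0] by blast
  with le_m show ?thesis
    by blast
qed

theorem theorem3p7:
  assumes "CARD('n::finite) \<ge> 2"
  shows "(\<forall>q::real. 0 < q \<and> q < 1/2 \<longrightarrow>
            (\<exists>\<Omega>\<^sub>0 \<in> (A_convex :: (real^'n) set set).
               \<forall>\<Omega> \<in> (A_convex :: (real^'n) set set). F q \<Omega>\<^sub>0 \<le> F q \<Omega>)) \<and>
         (\<forall>q::real. q > 1/2 \<longrightarrow>
            (\<exists>\<Omega>\<^sub>0 \<in> (A_convex :: (real^'n) set set).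
               \<forall>\<Omega> \<in> (A_convex :: (real^'n) set set). F q \<Omega>\<^sub>0 \<ge> F q \<Omega>))"
proof (intro conjI allI impI)
  fix q :: real
  assume "0 < q \<and> q < 1/2"
  then obtain K :: "(real^'n) set" where "convex_domain K" "\<And>\<Omega> :: (real^'n) set. convex_domain \<Omega> \<Longrightarrow> shape_ratio q K \<le> shape_ratio q \<Omega>"
    using minimizer_exists[of q, where 'n='n] by blast
  then show "\<exists>\<Omega>\<^sub>0 \<in> (A_convex :: (real^'n) set set). \<forall>\<Omega> \<in> (A_convex :: (real^'n) set set). F q \<Omega>\<^sub>0 \<le> F q \<Omega>"
    by (intro bexI[of _ K]) (auto simp: A_convex_iff F_eq_shape_ratio)
next
  fix q :: real
  assume "q > 1/2"
  then obtain K :: "(real^'n) set" where "convex_domain K" "\<And>\<Omega> :: (real^'n) set. convex_domain \<Omega> \<Longrightarrow> shape_ratio q \<Omega> \<le> shape_ratio q K"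
    using maximizer_exists[of q, where 'n='n] by blast
  then show "\<exists>\<Omega>\<^sub>0 \<in> (A_convex :: (real^'n) set set). \<forall>\<Omega> \<in> (A_convex :: (real^'n) set set). F q \<Omega>\<^sub>0 \<ge> F q \<Omega>"
    by (intro bexI[of _ K]) (auto simp: A_convex_iff F_eq_shape_ratio)
qed

end
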